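(* Fix a nonnegative integer $c$. (a) There is a fully polynomial randomized approximation scheme (FPRAS) for $f^{\lambda,N}$ on the instances $(\lambda,N)$, with $\lambda$ a partition and $N\ge|\lambda|$ a positive integer, for which $|\lambda|=c$. (b) There is a FPRAS for $f^{\lambda,N}$ on the instances $(\lambda,N)$, with $\lambda$ a partition and $N\ge|\lambda|$ a positive integer, for which $N-|\lambda|=c$.
   Context: A partition is a finite weakly decreasing sequence of positive integers $\lambda=(\lambda_1\ge\cdots\ge\lambda_\ell>0)$, identified with its Young diagram $\{(r,c): 1\le r\le \ell,\ 1\le c\le\lambda_r\}$ (left-justified boxes, rows numbered from the top, columns from the left). $|\lambda|$ is the number of boxes. For $N\ge|\lambda|$, an $N$-standard set-valued tableau of shape $\lambda$ is an assignment of a nonempty subset of $\{1,\ldots,N\}$ to each box of $\lambda$ such that each value in $\{1,\ldots,N\}$ appears exactly once overall and, whenever a single value is selected from each box, the resulting filling increases down each column and weakly increases from left to right along each row. Let $\mathsf{SVT}(\lambda,N)$ be the set of these, and $f^{\lambda,N}=|\mathsf{SVT}(\lambda,N)|$. A FPRAS for $f^{\lambda,N}$ is a randomized algorithm that, given an instance $(\lambda,N)$ and any $\epsilon,\delta\in(0,1]$, computes an approximation $A$ such that $P\big((1-\epsilon)f^{\lambda,N}\le A\le(1+\epsilon)f^{\lambda,N}\big)\ge 1-\delta$, in time polynomial in $|\lambda|$, $N$, $\frac1\epsilon$ and $\ln\delta^{-1}$ (the polynomial may depend on the fixed constant). *)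

theory Defs
  imports "HOL-Probability.Probability" "HOL-Library.Log_Nat"
begin

section \<open>Standard set-valued tableaux\<close>

definition is_partition :: "nat list \<Rightarrow> bool" where
  "is_partition lam \<longleftrightarrow> sorted_wrt (\<ge>) lam \<and> (\<forall>k \<in> set lam. 0 < k)"

definition diagram :: "nat list \<Rightarrow> (nat \<times> nat) set" where
  "diagram lam = {(r, c). 1 \<le> r \<and> r \<le> length lam \<and> 1 \<le> c \<and> c \<le> lam ! (r - 1)}"

definition semistandard_filling :: "nat list \<Rightarrow> (nat \<times> nat \<Rightarrow> nat) \<Rightarrow> bool" where
  "semistandard_filling lam F \<longleftrightarrow>
     (\<forall>r r' c. (r, c) \<in> diagram lam \<and> (r', c) \<in> diagram lam \<and> r < r' \<longrightarrow> F (r, c) < F (r', c)) \<and>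
     (\<forall>r c c'. (r, c) \<in> diagram lam \<and> (r, c') \<in> diagram lam \<and> c < c' \<longrightarrow> F (r, c) \<le> F (r, c'))"

text \<open>Tableaux are extensional functions (undefined outside the diagram), so that distinct
  elements of the set below are distinct assignments.\<close>

definition SVT :: "nat list \<Rightarrow> nat \<Rightarrow> (nat \<times> nat \<Rightarrow> nat set) set" where
  "SVT lam N =
     {T \<in> diagram lam \<rightarrow>\<^sub>E {A. A \<subseteq> {1..N} \<and> A \<noteq> {}}.
        (\<forall>v \<in> {1..N}. \<exists>!b. b \<in> diagram lam \<and> v \<in> T b) \<and>
        (\<forall>F. (\<forall>b \<in> diagram lam. F b \<in> T b) \<longrightarrow> semistandard_filling lam F)}"

definition num_SVT :: "nat list \<Rightarrow> nat \<Rightarrow> nat" where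
  "num_SVT lam N = card (SVT lam N)"

section \<open>Randomized algorithms\<close>

text \<open>
  The machine model is the random access machine under the logarithmic cost criterion
  (which is polynomially equivalent to the Turing machine), presented as a structured
  language and extended with fair coin tosses.  The memory consists of arrays of natural
  numbers, of which a program mentions finitely many; a scalar is entry 0 of an array.

  The accuracy and confidence parameters are arbitrary real numbers.  They are available only
  through their binary expansions: \<open>Digits q e\<close> returns the integer formed by
  the first \<open>k\<close> binary digits after the point (and the integer part) of the parameter
  \<open>q\<close>, where \<open>k\<close> is the value of \<open>e\<close>; this takes time
  at least \<open>k\<close>.
\<close>

datatype rparam = Eps | Del

datatype aexp =
    Num nat
  | Get string aexp
  | Add aexp aexp
  | Sub aexp aexp
  | Mul aexp aexp
  | Div aexp aexp
  | Digits rparam aexp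

datatype com =
    Skip
  | Assign string aexp aexp
  | Toss string aexp
  | Seq com com
  | Cond aexp com com
  | While aexp com

type_synonym store = "string \<Rightarrow> nat \<Rightarrow> nat"

definition store_upd :: "store \<Rightarrow> string \<Rightarrow> nat \<Rightarrow> nat \<Rightarrow> store" where
  "store_upd s x i v = s(x := (s x)(i := v))"

text \<open>\<open>Sub\<close> is truncated subtraction and division by zero yields zero.\<close>

fun aval :: "(rparam \<Rightarrow> real) \<Rightarrow> store \<Rightarrow> aexp \<Rightarrow> nat" where
  "aval \<rho> s (Num n) = n"
| "aval \<rho> s (Get x e) = s x (aval \<rho> s e)"
| "aval \<rho> s (Add e1 e2) = aval \<rho> s e1 + aval \<rho> s e2"
| "aval \<rho> s (Sub e1 e2) = aval \<rho> s e1 - aval \<rho> s e2"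
| "aval \<rho> s (Mul e1 e2) = aval \<rho> s e1 * aval \<rho> s e2"
| "aval \<rho> s (Div e1 e2) = aval \<rho> s e1 div aval \<rho> s e2"
| "aval \<rho> s (Digits q e) = nat \<lfloor>\<rho> q * 2 ^ aval \<rho> s e\<rfloor>"

definition bit_size :: "nat \<Rightarrow> nat" where
  "bit_size n = 1 + floorlog 2 n"

text \<open>Every operation is charged the bit size of its result, hence (through the costs of its
  subexpressions) also those of its operands.\<close>

fun acost :: "(rparam \<Rightarrow> real) \<Rightarrow> store \<Rightarrow> aexp \<Rightarrow> nat" where
  "acost \<rho> s (Num n) = bit_size n"
| "acost \<rho> s (Get x e) = acost \<rho> s e + bit_size (aval \<rho> s (Get x e))"
| "acost \<rho> s (Add e1 e2) = acost \<rho> s e1 + acost \<rho> s e2 + bit_size (aval \<rho> s (Add e1 e2))"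
| "acost \<rho> s (Sub e1 e2) = acost \<rho> s e1 + acost \<rho> s e2 + bit_size (aval \<rho> s (Sub e1 e2))"
| "acost \<rho> s (Mul e1 e2) = acost \<rho> s e1 + acost \<rho> s e2 + bit_size (aval \<rho> s (Mul e1 e2))"
| "acost \<rho> s (Div e1 e2) = acost \<rho> s e1 + acost \<rho> s e2 + bit_size (aval \<rho> s (Div e1 e2))"
| "acost \<rho> s (Digits q e) =
     acost \<rho> s e + aval \<rho> s e + bit_size (aval \<rho> s (Digits q e))"

text \<open>
  \<open>exec \<rho> P (s, \<omega>) t (s', \<omega>')\<close>: started in store \<open>s\<close>,
  the program \<open>P\<close> halts in store \<open>s'\<close> after time \<open>t\<close>;
  \<open>\<omega>\<close> is the stream of coin tosses available to it and \<open>\<omega>'\<close> its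
  unused remainder.  A guard holds iff its value is nonzero.
\<close>

inductive exec ::
  "(rparam \<Rightarrow> real) \<Rightarrow> com \<Rightarrow> store \<times> bool stream \<Rightarrow> nat \<Rightarrow> store \<times> bool stream \<Rightarrow> bool"
  for \<rho> :: "rparam \<Rightarrow> real"
where
  Skip: "exec \<rho> Skip (s, \<omega>) 1 (s, \<omega>)"
| Assign: "exec \<rho> (Assign x e1 e2) (s, \<omega>) (1 + acost \<rho> s e1 + acost \<rho> s e2)
    (store_upd s x (aval \<rho> s e1) (aval \<rho> s e2), \<omega>)"
| Toss: "exec \<rho> (Toss x e) (s, \<omega>) (1 + acost \<rho> s e)
    (store_upd s x (aval \<rho> s e) (of_bool (shd \<omega>)), stl \<omega>)"
| Seq: "exec \<rho> P (s, \<omega>) t1 (s1, \<omega>1) \<Longrightarrow> exec \<rho> Q (s1, \<omega>1) t2 (s2, \<omega>2) \<Longrightarrow>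
    exec \<rho> (Seq P Q) (s, \<omega>) (t1 + t2) (s2, \<omega>2)"
| CondTrue: "aval \<rho> s e \<noteq> 0 \<Longrightarrow> exec \<rho> P (s, \<omega>) t (s1, \<omega>1) \<Longrightarrow>
    exec \<rho> (Cond e P Q) (s, \<omega>) (1 + acost \<rho> s e + t) (s1, \<omega>1)"
| CondFalse: "aval \<rho> s e = 0 \<Longrightarrow> exec \<rho> Q (s, \<omega>) t (s1, \<omega>1) \<Longrightarrow>
    exec \<rho> (Cond e P Q) (s, \<omega>) (1 + acost \<rho> s e + t) (s1, \<omega>1)"
| WhileFalse: "aval \<rho> s e = 0 \<Longrightarrow>
    exec \<rho> (While e P) (s, \<omega>) (1 + acost \<rho> s e) (s, \<omega>)"
| WhileTrue: "aval \<rho> s e \<noteq> 0 \<Longrightarrow> exec \<rho> P (s, \<omega>) t1 (s1, \<omega>1) \<Longrightarrow>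
    exec \<rho> (While e P) (s1, \<omega>1) t2 (s2, \<omega>2) \<Longrightarrow>
    exec \<rho> (While e P) (s, \<omega>) (1 + acost \<rho> s e + t1 + t2) (s2, \<omega>2)"

lemma exec_deterministic:
  "exec \<rho> P a t b \<Longrightarrow> exec \<rho> P a t' b' \<Longrightarrow> t' = t \<and> b' = b"
proof (induction arbitrary: t' b' rule: exec.induct)
  case (Skip s \<omega>)
  from Skip.prems show ?case by cases simp
next
  case (Assign x e1 e2 s \<omega>)
  from Assign.prems show ?case by cases simp
next
  case (Toss x e s \<omega>)
  from Toss.prems show ?case by cases simp
next
  case (Seq P s \<omega> t1 s1 \<omega>1 Q t2 s2 \<omega>2)
  from Seq.prems show ?case
  proof cases
    case (Seq u1 r1 v1 u2 r2 v2)
    with Seq.IH(1)[OF Seq(3)] Seq.IH(2)[of u2 "(r2, v2)"] show ?thesis by simp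
  qed
next
  case (CondTrue s e P \<omega> t s1 \<omega>1 Q)
  from CondTrue.prems show ?case
  proof cases
    case (CondTrue u r v)
    with CondTrue.IH[OF CondTrue(4)] show ?thesis by simp
  next
    case CondFalse
    with CondTrue.hyps show ?thesis by simp
  qed
next
  case (CondFalse s e Q \<omega> t s1 \<omega>1 P)
  from CondFalse.prems show ?case
  proof cases
    case CondTrue
    with CondFalse.hyps show ?thesis by simp
  next
    case (CondFalse u r v)
    with CondFalse.IH[OF CondFalse(4)] show ?thesis by simp
  qed
next
  case (WhileFalse s e P \<omega>)
  from WhileFalse.prems show ?case by cases (use WhileFalse.hyps in simp_all)
next
  case (WhileTrue s e P \<omega> t1 s1 \<omega>1 t2 s2 \<omega>2)
  from WhileTrue.prems show ?case
  proof cases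
    case WhileFalse
    with WhileTrue.hyps show ?thesis by simp
  next
    case (WhileTrue u1 r1 v1 u2 r2 v2)
    with WhileTrue.IH(1)[OF WhileTrue(4)] WhileTrue.IH(2)[of u2 "(r2, v2)"] show ?thesis by simp
  qed
qed

definition coins :: "bool stream measure" where
  "coins = stream_space (measure_pmf (bernoulli_pmf (1 / 2)))"

section \<open>Fully polynomial randomized approximation schemes\<close>

text \<open>The parts of the partition, their number and \<open>N\<close> are placed in memory; all other
  cells are 0.  The output is a nonnegative rational number, given by numerator and denominator.\<close>

definition input_store :: "nat list \<Rightarrow> nat \<Rightarrow> store" where
  "input_store lam N = (\<lambda>x i.
     if x = ''lambda'' \<and> i < length lam then lam ! i
     else if x = ''len'' \<and> i = 0 then length lam
     else if x = ''N'' \<and> i = 0 then N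
     else 0)"

definition result :: "store \<Rightarrow> real" where
  "result s = real (s ''num'' 0) / real (s ''den'' 0)"

definition real_params :: "real \<Rightarrow> real \<Rightarrow> rparam \<Rightarrow> real" where
  "real_params \<epsilon> \<delta> q = (case q of Eps \<Rightarrow> \<epsilon> | Del \<Rightarrow> \<delta>)"

text \<open>A single program serves all instances in \<open>I\<close> and all accuracies, and its running
  time is bounded by the same polynomial for all outcomes of the coin tosses.\<close>

definition has_FPRAS :: "(nat list \<Rightarrow> nat \<Rightarrow> nat) \<Rightarrow> (nat list \<times> nat) set \<Rightarrow> bool" where
  "has_FPRAS f I \<longleftrightarrow>
     (\<exists>P. \<exists>p :: real \<times> real \<times> real \<times> real \<Rightarrow> real. real_polynomial_function p \<and>
       (\<forall>(lam, N) \<in> I. \<forall>\<epsilon> \<in> {0<..1}. \<forall>\<delta> \<in> {0<..1}.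
          (\<forall>\<omega>. \<exists>t s' \<omega>'. exec (real_params \<epsilon> \<delta>) P (input_store lam N, \<omega>) t (s', \<omega>') \<and>
             real t \<le> p (real (sum_list lam), real N, 1 / \<epsilon>, ln (1 / \<delta>))) \<and>
          measure coins {\<omega>. \<exists>t s' \<omega>'.
             exec (real_params \<epsilon> \<delta>) P (input_store lam N, \<omega>) t (s', \<omega>') \<and>
             (1 - \<epsilon>) * real (f lam N) \<le> result s' \<and>
             result s' \<le> (1 + \<epsilon>) * real (f lam N)} \<ge> 1 - \<delta>))"

end

theory Submission
  imports Defs "Jordan_Normal_Form.Determinant"
begin

text \<open>
  Both counts can be computed exactly and without coin tosses.  Write \<open>f \<lambda> N\<close> for the number
  of tableaux.  Deleting the largest value gives the recurrence
  \<open>f \<lambda> (N + 1) = (\<Sum>i. f (\<lambda> - e\<^sub>i) N + f \<lambda> N)\<close>, where \<open>i\<close> runs over the rows of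
  \<open>\<lambda>\<close> that end in a corner.

  If \<open>|\<lambda>| = c\<close>, only finitely many shapes occur, and the recurrence is a linear one with a
  constant matrix.

  If \<open>N = |\<lambda>| + c\<close>, let \<open>g \<lambda>\<close> be the determinant of the matrix
  \<open>1 / (\<lambda>\<^sub>i - i + j)!\<close> (so that \<open>|\<lambda>|! g \<lambda>\<close> counts the standard tableaux),
  and put \<open>(A h) \<lambda> = (\<Sum>j. \<lambda>\<^sub>j * h (\<lambda> + e\<^sub>j))\<close> and
  \<open>(E\<^sub>i h) \<lambda> = h (\<lambda> - e\<^sub>i)\<close>.  Then \<open>f \<lambda> N = N! / c! * (A\<^sup>c g) \<lambda>\<close>.
  Indeed \<open>E\<^sub>i A = A E\<^sub>i - 1\<close> and \<open>|\<lambda>| g \<lambda> = (\<Sum>i. (E\<^sub>i g) \<lambda>)\<close>, which yields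
  the recurrence with a sum over all rows; but \<open>E\<^sub>i g\<close> is antisymmetric in the coordinates
  \<open>i\<close> and \<open>i + 1\<close>, \<open>A\<close> preserves this, and so the rows without a corner contribute 0.
  The determinant is a Vandermonde product, and \<open>A\<^sup>c\<close> becomes \<open>c\<close> nested loops over
  the rows.
\<close>

text \<open>With bounded excess the recurrence cannot simply be tabulated: the number of shapes
  below \<open>\<lambda>\<close> is not polynomially bounded in \<open>N\<close>. A closed
  expression has to absorb the second summand \<open>f \<lambda> N\<close>, and \<open>A\<close> is
  built for that. Its coefficient \<open>\<lambda>\<^sub>j\<close> drops by one when a box is
  removed, so moving \<open>E\<^sub>i\<close> past the k-th power of \<open>A\<close> leaves k times
  the (k-1)-st power; scaled by \<open>N! / k!\<close>, this is the count with excess k - 1. Each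
  \<open>A\<close> also looks one box further up, so the factor \<open>|\<lambda>|\<close> becomes
  \<open>|\<lambda>| + k\<close>, the quotient of two consecutive factorials. The last row has no
  partner for the antisymmetry. There \<open>E\<^sub>i g\<close> vanishes on empty rows, and
  \<open>A\<close> preserves this because its coefficient for an empty row is 0. Expanding the c-th
  power of \<open>A\<close> gives at most \<open>m ^ c\<close> terms for \<open>m\<close> rows,
  polynomially many for fixed \<open>c\<close>. The terms have mixed signs and rational values,
  while the machine has natural numbers only; hence the pairs of cells, the common denominator
  \<open>(2 * N)! ^ m\<close>, and the size bounds carried through every loop.\<close>

hide_const (open) Determinants.det Finite_Cartesian_Product.transpose module.smult

section \<open>Deleting the largest value\<close>

text \<open>Distinct boxes share no value, so the weak inequality along rows is as strict as the one
  down columns, and only a relation \<open>R\<close> between boxes matters. In this generality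
  deleting a box stays within the definition, which a diagram with a hole would not.\<close>

definition poset_svt :: "('a \<Rightarrow> 'a \<Rightarrow> bool) \<Rightarrow> 'a set \<Rightarrow> nat \<Rightarrow> ('a \<Rightarrow> nat set) set" where
  "poset_svt R D N =
     {T \<in> D \<rightarrow>\<^sub>E {A. A \<subseteq> {1..N} \<and> A \<noteq> {}}.
        (\<forall>v \<in> {1..N}. \<exists>b \<in> D. v \<in> T b) \<and>
        (\<forall>b \<in> D. \<forall>b' \<in> D. b \<noteq> b' \<longrightarrow> T b \<inter> T b' = {}) \<and>
        (\<forall>b \<in> D. \<forall>b' \<in> D. R b b' \<longrightarrow> (\<forall>x \<in> T b. \<forall>y \<in> T b'. x < y))}"

lemma finite_poset_svt: "finite D \<Longrightarrow> finite (poset_svt R D N)"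
proof (rule finite_subset)
  show "poset_svt R D N \<subseteq> D \<rightarrow>\<^sub>E Pow {1..N}"
    unfolding poset_svt_def by (rule order.trans[OF Collect_restrict PiE_mono]) auto
qed (simp add: finite_PiE)

lemma poset_svt_0: "poset_svt R D 0 = (if D = {} then {\<lambda>_. undefined} else {})"
proof (cases "D = {}")
  case False
  then obtain b where b: "b \<in> D" by auto
  have "T b = {}" if "T \<in> poset_svt R D 0" for T
  proof -
    have "T b \<subseteq> {1..0}" using that b unfolding poset_svt_def by blast
    then show ?thesis by simp
  qed
  moreover have "T b \<noteq> {}" if "T \<in> poset_svt R D 0" for T
    using that b unfolding poset_svt_def by blast
  ultimately have "poset_svt R D 0 = {}" by blast
  with False show ?thesis by simp
qed (simp add: poset_svt_def)

lemma poset_svtI: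
  assumes "T \<in> extensional D" "\<And>b. b \<in> D \<Longrightarrow> T b \<noteq> {}" "\<And>b v. b \<in> D \<Longrightarrow> v \<in> T b \<Longrightarrow> 1 \<le> v \<and> v \<le> N"
    "\<And>v. 1 \<le> v \<Longrightarrow> v \<le> N \<Longrightarrow> \<exists>b \<in> D. v \<in> T b"
    "\<And>b b' v. b \<in> D \<Longrightarrow> b' \<in> D \<Longrightarrow> v \<in> T b \<Longrightarrow> v \<in> T b' \<Longrightarrow> b = b'"
    "\<And>b b' x y. b \<in> D \<Longrightarrow> b' \<in> D \<Longrightarrow> R b b' \<Longrightarrow> x \<in> T b \<Longrightarrow> y \<in> T b' \<Longrightarrow> x < y"
  shows "T \<in> poset_svt R D N"
proof -
  have "T \<in> D \<rightarrow>\<^sub>E {A. A \<subseteq> {1..N} \<and> A \<noteq> {}}"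
    using assms(1,2,3) by (auto simp: PiE_iff subset_iff)
  moreover have "\<forall>v \<in> {1..N}. \<exists>b \<in> D. v \<in> T b"
    using assms(4) by simp
  moreover have "\<forall>b \<in> D. \<forall>b' \<in> D. b \<noteq> b' \<longrightarrow> T b \<inter> T b' = {}"
    using assms(5) by blast
  moreover have "\<forall>b \<in> D. \<forall>b' \<in> D. R b b' \<longrightarrow> (\<forall>x \<in> T b. \<forall>y \<in> T b'. x < y)"
    using assms(6) by blast
  ultimately show ?thesis
    unfolding poset_svt_def by blast
qed

lemma poset_svtD:
  assumes "T \<in> poset_svt R D N"
  shows "T \<in> extensional D" "\<And>b. b \<in> D \<Longrightarrow> T b \<noteq> {}"
    "\<And>b v. b \<in> D \<Longrightarrow> v \<in> T b \<Longrightarrow> 1 \<le> v \<and> v \<le> N"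
    "\<And>v. 1 \<le> v \<Longrightarrow> v \<le> N \<Longrightarrow> \<exists>b \<in> D. v \<in> T b"
    "\<And>b b' v. b \<in> D \<Longrightarrow> b' \<in> D \<Longrightarrow> v \<in> T b \<Longrightarrow> v \<in> T b' \<Longrightarrow> b = b'"
    "\<And>b b' x y. b \<in> D \<Longrightarrow> b' \<in> D \<Longrightarrow> R b b' \<Longrightarrow> x \<in> T b \<Longrightarrow> y \<in> T b' \<Longrightarrow> x < y"
proof -
  from assms have T: "T \<in> D \<rightarrow>\<^sub>E {A. A \<subseteq> {1..N} \<and> A \<noteq> {}}" and cov: "\<forall>v \<in> {1..N}. \<exists>b \<in> D. v \<in> T b"
    and dj: "\<forall>b \<in> D. \<forall>b' \<in> D. b \<noteq> b' \<longrightarrow> T b \<inter> T b' = {}"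
    and ord: "\<forall>b \<in> D. \<forall>b' \<in> D. R b b' \<longrightarrow> (\<forall>x \<in> T b. \<forall>y \<in> T b'. x < y)"
    by (auto simp: poset_svt_def)
  show "T \<in> extensional D" using T by (simp add: PiE_iff)
  show "T b \<noteq> {}" if "b \<in> D" for b using PiE_mem[OF T that] by simp
  show "1 \<le> v \<and> v \<le> N" if "b \<in> D" "v \<in> T b" for b v using PiE_mem[OF T that(1)] that(2) by auto
  show "\<exists>b \<in> D. v \<in> T b" if "1 \<le> v" "v \<le> N" for v using cov that by auto
  show "b = b'" if "b \<in> D" "b' \<in> D" "v \<in> T b" "v \<in> T b'" for b b' v using dj that by blast
  show "x < y" if "b \<in> D" "b' \<in> D" "R b b'" "x \<in> T b" "y \<in> T b'" for b b' x y using ord that by blast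
qed

text \<open>If \<open>Suc N\<close> is alone in \<open>b\<close>, box and value are deleted
  together. The inverse is legitimate because \<open>b\<close> is maximal: no box is required to
  exceed the value put back.\<close>

lemma card_poset_svt_singleton:
  assumes b: "b \<in> D" and max: "\<And>b'. b' \<in> D \<Longrightarrow> \<not> R b b'"
  shows "card {T \<in> poset_svt R D (Suc N). T b = {Suc N}} = card (poset_svt R (D - {b}) N)"
proof (rule bij_betw_same_card, rule bij_betwI)
  show "(\<lambda>T. T(b := undefined)) \<in> {T \<in> poset_svt R D (Suc N). T b = {Suc N}} \<rightarrow> poset_svt R (D - {b}) N"
  proof
    fix T assume "T \<in> {T \<in> poset_svt R D (Suc N). T b = {Suc N}}"
    then have T: "T \<in> poset_svt R D (Suc N)" and Tb: "T b = {Suc N}" by auto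
    note D = poset_svtD[OF T]
    have notin: "Suc N \<notin> T b'" if "b' \<in> D - {b}" for b'
      using D(5)[of b' b "Suc N"] b Tb that by auto
    show "T(b := undefined) \<in> poset_svt R (D - {b}) N"
    proof (rule poset_svtI)
      fix b' v assume "b' \<in> D - {b}" "v \<in> (T(b := undefined)) b'"
      then show "1 \<le> v \<and> v \<le> N"
        using D(3)[of b' v] notin[of b'] by (auto simp: le_Suc_eq)
    next
      fix v assume v: "1 \<le> v" "v \<le> N"
      then obtain b1 where b1: "b1 \<in> D" "v \<in> T b1"
        using D(4)[of v] by auto
      have "b1 \<noteq> b"
      proof
        assume "b1 = b"
        with b1 Tb have "v = Suc N" by simp
        with v show False by simp
      qed
      with b1 have "b1 \<in> D - {b}" "v \<in> (T(b := undefined)) b1" by simp_all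
      then show "\<exists>b'\<in>D - {b}. v \<in> (T(b := undefined)) b'" by (rule bexI[rotated])
    next
      fix b1 b2 v assume "b1 \<in> D - {b}" "b2 \<in> D - {b}" "v \<in> (T(b := undefined)) b1" "v \<in> (T(b := undefined)) b2"
      then show "b1 = b2" using D(5)[of b1 b2 v] by simp
    next
      fix b1 b2 x y
      assume "b1 \<in> D - {b}" "b2 \<in> D - {b}" "R b1 b2" "x \<in> (T(b := undefined)) b1" "y \<in> (T(b := undefined)) b2"
      then show "x < y" using D(6)[of b1 b2 x y] by simp
    next
      show "T(b := undefined) \<in> extensional (D - {b})"
        using D(1) by (simp add: extensional_def)
    next
      fix b' assume "b' \<in> D - {b}"
      then show "(T(b := undefined)) b' \<noteq> {}" using D(2)[of b'] by simp
    qed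
  qed
  show "(\<lambda>T. T(b := {Suc N})) \<in> poset_svt R (D - {b}) N \<rightarrow> {T \<in> poset_svt R D (Suc N). T b = {Suc N}}"
  proof
    fix T assume T: "T \<in> poset_svt R (D - {b}) N"
    note D = poset_svtD[OF T]
    have "T(b := {Suc N}) \<in> poset_svt R D (Suc N)"
    proof (rule poset_svtI)
      fix b' v assume "b' \<in> D" "v \<in> (T(b := {Suc N})) b'"
      then show "1 \<le> v \<and> v \<le> Suc N"
        using D(3)[of b' v] by (auto split: if_splits)
    next
      fix v assume v: "1 \<le> v" "v \<le> Suc N"
      show "\<exists>b'\<in>D. v \<in> (T(b := {Suc N})) b'"
      proof (cases "v = Suc N")
        case False
        then obtain b' where "b' \<in> D - {b}" "v \<in> T b'" using D(4)[of v] v by auto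
        then show ?thesis by (intro bexI[of _ b']) auto
      qed (use b in auto)
    next
      fix b1 b2 v assume "b1 \<in> D" "b2 \<in> D" "v \<in> (T(b := {Suc N})) b1" "v \<in> (T(b := {Suc N})) b2"
      then show "b1 = b2"
        using D(3)[of b1 v] D(3)[of b2 v] D(5)[of b1 b2 v] by (auto split: if_splits)
    next
      fix b1 b2 x y
      assume "b1 \<in> D" "b2 \<in> D" "R b1 b2" "x \<in> (T(b := {Suc N})) b1" "y \<in> (T(b := {Suc N})) b2"
      then show "x < y"
        using D(3)[of b1 x] D(6)[of b1 b2 x y] max by (auto split: if_splits)
    qed (use b D(1,2) in \<open>auto simp: extensional_def\<close>)
    then show "T(b := {Suc N}) \<in> {T \<in> poset_svt R D (Suc N). T b = {Suc N}}" by simp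
  qed
next
  fix T assume "T \<in> poset_svt R (D - {b}) N"
  from poset_svtD(1)[OF this] have "T b = undefined" by (simp add: extensional_def)
  then show "(T(b := {Suc N}))(b := undefined) = T"
    by (simp only: fun_upd_upd fun_upd_idem)
next
  fix T assume "T \<in> {T \<in> poset_svt R D (Suc N). T b = {Suc N}}"
  then have "T b = {Suc N}" by blast
  then show "(T(b := undefined))(b := {Suc N}) = T"
    by (simp only: fun_upd_upd fun_upd_idem)
qed

text \<open>If \<open>Suc N\<close> has company in \<open>b\<close>, only the value is deleted and
  the box keeps a nonempty set. Conversely, adding the new maximum to a maximal box breaks no
  inequality.\<close>

lemma card_poset_svt_larger:
  assumes b: "b \<in> D" and max: "\<And>b'. b' \<in> D \<Longrightarrow> \<not> R b b'"
  shows "card {T \<in> poset_svt R D (Suc N). Suc N \<in> T b \<and> T b \<noteq> {Suc N}} = card (poset_svt R D N)"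
proof (rule bij_betw_same_card, rule bij_betwI)
  show "(\<lambda>T. T(b := T b - {Suc N})) \<in> {T \<in> poset_svt R D (Suc N). Suc N \<in> T b \<and> T b \<noteq> {Suc N}} \<rightarrow> poset_svt R D N"
  proof
    fix T assume "T \<in> {T \<in> poset_svt R D (Suc N). Suc N \<in> T b \<and> T b \<noteq> {Suc N}}"
    then have T: "T \<in> poset_svt R D (Suc N)" and Tb: "Suc N \<in> T b" "T b \<noteq> {Suc N}" by auto
    note D = poset_svtD[OF T]
    have notin: "Suc N \<notin> T b'" if "b' \<in> D" "b' \<noteq> b" for b'
      using D(5)[of b' b "Suc N"] b Tb that by auto
    show "T(b := T b - {Suc N}) \<in> poset_svt R D N"
    proof (rule poset_svtI)
      fix b' v assume "b' \<in> D" "v \<in> (T(b := T b - {Suc N})) b'"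
      then show "1 \<le> v \<and> v \<le> N"
        using D(3)[of b' v] notin[of b'] by (auto simp: le_Suc_eq split: if_splits)
    next
      fix v assume v: "1 \<le> v" "v \<le> N"
      then obtain b' where "b' \<in> D" "v \<in> T b'" using D(4)[of v] by auto
      with v show "\<exists>b'\<in>D. v \<in> (T(b := T b - {Suc N})) b'" by (intro bexI[of _ b']) auto
    next
      fix b' assume "b' \<in> D"
      then show "(T(b := T b - {Suc N})) b' \<noteq> {}" using D(2)[of b'] Tb by auto
    next
      fix b1 b2 x y
      assume "b1 \<in> D" "b2 \<in> D" "R b1 b2" "x \<in> (T(b := T b - {Suc N})) b1" "y \<in> (T(b := T b - {Suc N})) b2"
      then show "x < y" using D(6)[of b1 b2 x y] by (auto split: if_splits)
    next
      fix b1 b2 v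
      assume "b1 \<in> D" "b2 \<in> D" "v \<in> (T(b := T b - {Suc N})) b1" "v \<in> (T(b := T b - {Suc N})) b2"
      then show "b1 = b2" using D(5)[of b1 b2 v] by (auto split: if_splits)
    qed (use b D(1) in \<open>auto simp: extensional_def\<close>)
  qed
  show "(\<lambda>T. T(b := insert (Suc N) (T b))) \<in> poset_svt R D N \<rightarrow> {T \<in> poset_svt R D (Suc N). Suc N \<in> T b \<and> T b \<noteq> {Suc N}}"
  proof
    fix T assume T: "T \<in> poset_svt R D N"
    note D = poset_svtD[OF T]
    have "T(b := insert (Suc N) (T b)) \<in> poset_svt R D (Suc N)"
    proof (rule poset_svtI)
      fix b' v assume "b' \<in> D" "v \<in> (T(b := insert (Suc N) (T b))) b'"
      then show "1 \<le> v \<and> v \<le> Suc N"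
        using D(3)[of b' v] by (auto split: if_splits)
    next
      fix v assume v: "1 \<le> v" "v \<le> Suc N"
      show "\<exists>b'\<in>D. v \<in> (T(b := insert (Suc N) (T b))) b'"
      proof (cases "v = Suc N")
        case False
        then obtain b' where "b' \<in> D" "v \<in> T b'" using D(4)[of v] v by auto
        then show ?thesis by (intro bexI[of _ b']) auto
      qed (use b in auto)
    next
      fix b1 b2 v
      assume "b1 \<in> D" "b2 \<in> D" "v \<in> (T(b := insert (Suc N) (T b))) b1" "v \<in> (T(b := insert (Suc N) (T b))) b2"
      then show "b1 = b2"
        using D(3)[of b1 v] D(3)[of b2 v] D(5)[of b1 b2 v] by (auto split: if_splits)
    next
      fix b1 b2 x y
      assume "b1 \<in> D" "b2 \<in> D" "R b1 b2"
        "x \<in> (T(b := insert (Suc N) (T b))) b1" "y \<in> (T(b := insert (Suc N) (T b))) b2"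
      then show "x < y"
        using D(3)[of b1 x] D(6)[of b1 b2 x y] max by (auto split: if_splits)
    next
      fix b' assume "b' \<in> D"
      then show "(T(b := insert (Suc N) (T b))) b' \<noteq> {}" using D(2)[of b'] by auto
    qed (use b D(1) in \<open>auto simp: extensional_def\<close>)
    moreover have "insert (Suc N) (T b) \<noteq> {Suc N}"
      using D(2)[OF b] D(3)[OF b] by fastforce
    ultimately show "T(b := insert (Suc N) (T b)) \<in> {T \<in> poset_svt R D (Suc N). Suc N \<in> T b \<and> T b \<noteq> {Suc N}}"
      by simp
  qed
next
  fix T assume "T \<in> poset_svt R D N"
  then have "Suc N \<notin> T b"
    using poset_svtD(3)[of T R D N b "Suc N"] b by auto
  then have "insert (Suc N) (T b) - {Suc N} = T b" by simp
  then show "(T(b := insert (Suc N) (T b)))(b := (T(b := insert (Suc N) (T b))) b - {Suc N}) = T"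
    by (simp only: fun_upd_upd fun_upd_same fun_upd_idem)
next
  fix T assume "T \<in> {T \<in> poset_svt R D (Suc N). Suc N \<in> T b \<and> T b \<noteq> {Suc N}}"
  then have "insert (Suc N) (T b - {Suc N}) = T b" by blast
  then show "(T(b := T b - {Suc N}))(b := insert (Suc N) ((T(b := T b - {Suc N})) b)) = T"
    by (simp only: fun_upd_upd fun_upd_same fun_upd_idem)
qed

text \<open>The tableaux are sorted by the box that holds the largest value, and then by whether
  that value is alone there.\<close>

lemma card_poset_svt_Suc:
  assumes "finite D"
  shows "card (poset_svt R D (Suc N)) =
    (\<Sum>b | b \<in> D \<and> (\<forall>b' \<in> D. \<not> R b b'). card (poset_svt R (D - {b}) N) + card (poset_svt R D N))"
proof -
  let ?M = "{b. b \<in> D \<and> (\<forall>b' \<in> D. \<not> R b b')}"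
  let ?S = "\<lambda>b. {T \<in> poset_svt R D (Suc N). Suc N \<in> T b}"
  have "poset_svt R D (Suc N) = (\<Union>b\<in>?M. ?S b)"
  proof safe
    fix T assume T: "T \<in> poset_svt R D (Suc N)"
    note D = poset_svtD[OF T]
    obtain b where b: "b \<in> D" "Suc N \<in> T b" using D(4)[of "Suc N"] by auto
    \<comment> \<open>A box beyond \<open>b\<close> is nonempty and would need a value larger than
      \<open>Suc N\<close>.\<close>
    have "\<not> R b b'" if "b' \<in> D" for b'
    proof
      assume "R b b'"
      obtain y where "y \<in> T b'" using D(2)[OF \<open>b' \<in> D\<close>] by auto
      then show False
        using D(3)[OF \<open>b' \<in> D\<close>, of y] D(6)[OF b(1) \<open>b' \<in> D\<close> \<open>R b b'\<close> b(2), of y] by auto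
    qed
    with b T show "T \<in> (\<Union>b\<in>?M. ?S b)" by blast
  qed
  also have "card \<dots> = (\<Sum>b\<in>?M. card (?S b))"
    using assms poset_svtD(5)[of _ R D "Suc N"]
    by (intro card_UN_disjoint) (auto simp: finite_poset_svt)
  also have "\<dots> = (\<Sum>b\<in>?M. card (poset_svt R (D - {b}) N) + card (poset_svt R D N))"
  proof (intro sum.cong refl)
    fix b assume b: "b \<in> ?M"
    have "?S b = {T \<in> poset_svt R D (Suc N). T b = {Suc N}} \<union>
        {T \<in> poset_svt R D (Suc N). Suc N \<in> T b \<and> T b \<noteq> {Suc N}}"
      by auto
    also have "card \<dots> = card {T \<in> poset_svt R D (Suc N). T b = {Suc N}} +
        card {T \<in> poset_svt R D (Suc N). Suc N \<in> T b \<and> T b \<noteq> {Suc N}}"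
      by (intro card_Un_disjoint) (auto simp: assms finite_poset_svt)
    finally show "card (?S b) = card (poset_svt R (D - {b}) N) + card (poset_svt R D N)"
      using b by (simp add: card_poset_svt_singleton card_poset_svt_larger)
  qed
  finally show ?thesis .
qed

section \<open>Young diagrams, their corners and the recurrence\<close>

definition before :: "nat \<times> nat \<Rightarrow> nat \<times> nat \<Rightarrow> bool" where
  "before b b' \<longleftrightarrow> snd b = snd b' \<and> fst b < fst b' \<or> fst b = fst b' \<and> snd b < snd b'"

lemma finite_diagram: "finite (diagram lam)"
proof (rule finite_subset)
  show "diagram lam \<subseteq> {..length lam} \<times> {..sum_list lam}"
  proof (rule subrelI)
    fix r c assume "(r, c) \<in> diagram lam"
    then have "1 \<le> r" "r \<le> length lam" "c \<le> lam ! (r - 1)" by (simp_all add: diagram_def)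
    moreover from this have "r - 1 < length lam" by linarith
    ultimately show "(r, c) \<in> {..length lam} \<times> {..sum_list lam}"
      using elem_le_sum_list[of "r - 1" lam] by simp
  qed
qed simp

text \<open>The condition on all selections reduces to pairs of boxes: any two values
  \<open>x\<close> and \<open>y\<close> taken from different boxes extend to a selection, by
  choosing arbitrarily elsewhere. Disjointness upgrades the weak row condition to a strict
  one.\<close>

lemma SVT_eq_poset_svt: "SVT lam N = poset_svt before (diagram lam) N"
proof (intro equalityI subsetI)
  fix T assume "T \<in> SVT lam N"
  then have T: "T \<in> diagram lam \<rightarrow>\<^sub>E {A. A \<subseteq> {1..N} \<and> A \<noteq> {}}"
    and uniq: "\<And>v. v \<in> {1..N} \<Longrightarrow> \<exists>!b. b \<in> diagram lam \<and> v \<in> T b"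
    and ss: "\<And>F. (\<forall>b \<in> diagram lam. F b \<in> T b) \<Longrightarrow> semistandard_filling lam F"
    by (auto simp: SVT_def)
  have rng: "1 \<le> v \<and> v \<le> N" if "b \<in> diagram lam" "v \<in> T b" for b v
    using PiE_mem[OF T that(1)] that(2) by auto
  have dj: "b = b'" if "b \<in> diagram lam" "b' \<in> diagram lam" "v \<in> T b" "v \<in> T b'" for b b' v
    using uniq[of v] rng[of b v] that by auto
  show "T \<in> poset_svt before (diagram lam) N"
  proof (rule poset_svtI)
    fix b b' x y
    assume b: "b \<in> diagram lam" "b' \<in> diagram lam" "before b b'" "x \<in> T b" "y \<in> T b'"
    define F where "F = (\<lambda>d. SOME z. z \<in> T d)(b := x, b' := y)"
    have "(SOME z. z \<in> T d) \<in> T d" if "d \<in> diagram lam" for d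
      using PiE_mem[OF T that] by (auto intro: someI_ex)
    then have "semistandard_filling lam F"
      using b by (intro ss) (auto simp: F_def)
    moreover have "b \<noteq> b'" using b(3) by (auto simp: before_def)
    moreover have "x \<noteq> y" using dj[of b b' x] b \<open>b \<noteq> b'\<close> by auto
    moreover have "F b = x" "F b' = y" using \<open>b \<noteq> b'\<close> by (auto simp: F_def)
    ultimately show "x < y"
      using b(1-3) unfolding semistandard_filling_def before_def
      by (metis order_le_less prod.collapse)
  next
    fix v assume "1 \<le> v" "v \<le> N"
    then show "\<exists>b \<in> diagram lam. v \<in> T b" using uniq[of v] by auto
  next
    show "T \<in> extensional (diagram lam)" using T by (simp add: PiE_iff)
  next
    fix b assume "b \<in> diagram lam"
    then show "T b \<noteq> {}" using PiE_mem[OF T] by auto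
  qed (use rng dj in blast)+
next
  fix T assume T: "T \<in> poset_svt before (diagram lam) N"
  note D = poset_svtD[OF T]
  have "semistandard_filling lam F" if F: "\<forall>b \<in> diagram lam. F b \<in> T b" for F
    unfolding semistandard_filling_def
  proof safe
    fix r r' c assume "(r, c) \<in> diagram lam" "(r', c) \<in> diagram lam" "r < r'"
    then show "F (r, c) < F (r', c)"
      using F by (intro D(6)[of "(r, c)" "(r', c)"]) (auto simp: before_def)
  next
    fix r c c' assume "(r, c) \<in> diagram lam" "(r, c') \<in> diagram lam" "c < c'"
    then have "F (r, c) < F (r, c')"
      using F by (intro D(6)[of "(r, c)" "(r, c')"]) (auto simp: before_def)
    then show "F (r, c) \<le> F (r, c')" by simp
  qed
  moreover have "\<exists>!b. b \<in> diagram lam \<and> v \<in> T b" if "v \<in> {1..N}" for v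
    using D(4)[of v] D(5)[of _ _ v] that by auto
  moreover have "T \<in> diagram lam \<rightarrow>\<^sub>E {A. A \<subseteq> {1..N} \<and> A \<noteq> {}}"
    using T by (auto simp: poset_svt_def)
  ultimately show "T \<in> SVT lam N"
    by (auto simp: SVT_def)
qed

text \<open>Rows are counted from 0, unlike in \<open>diagram\<close>. Removing a box never shortens
  the list, so zero parts can appear at its end; the positivity condition keeps them from counting
  as corners.\<close>

definition corners :: "nat list \<Rightarrow> nat set" where
  "corners lam = {i. i < length lam \<and> 0 < lam ! i \<and> (Suc i < length lam \<longrightarrow> lam ! Suc i < lam ! i)}"

lemma maximal_boxes:
  assumes "sorted_wrt (\<ge>) lam"
  shows "{b. b \<in> diagram lam \<and> (\<forall>b' \<in> diagram lam. \<not> before b b')} = (\<lambda>i. (Suc i, lam ! i)) ` corners lam"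
proof safe
  fix r c assume rc: "(r, c) \<in> diagram lam" and max: "\<forall>b'\<in>diagram lam. \<not> before (r, c) b'"
  obtain i where i: "r = Suc i" "i < length lam" "1 \<le> c" "c \<le> lam ! i"
    using rc by (cases r) (auto simp: diagram_def)
  have "c = lam ! i"
    using max[rule_format, of "(r, lam ! i)"] i by (auto simp: diagram_def before_def)
  moreover have "lam ! Suc i < c" if "Suc i < length lam"
    using max[rule_format, of "(Suc r, c)"] i that by (fastforce simp: diagram_def before_def not_le)
  ultimately show "(r, c) \<in> (\<lambda>i. (Suc i, lam ! i)) ` corners lam"
    using i by (auto simp: corners_def)
next
  fix i assume "i \<in> corners lam"
  then show "(Suc i, lam ! i) \<in> diagram lam" by (auto simp: corners_def diagram_def)
next
  fix i r c assume i: "i \<in> corners lam" and rc: "(r, c) \<in> diagram lam" "before (Suc i, lam ! i) (r, c)"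
  show False
  proof (cases "r = Suc i")
    case False
    then have "Suc i < r" "c = lam ! i" using rc by (auto simp: before_def)
    moreover have "lam ! (r - 1) \<le> lam ! Suc i"
      using assms rc \<open>Suc i < r\<close> by (cases "r - 1 = Suc i") (auto simp: sorted_wrt_iff_nth_less diagram_def)
    ultimately show False
      using i rc by (auto simp: corners_def diagram_def)
  qed (use i rc in \<open>auto simp: before_def diagram_def\<close>)
qed

lemma diagram_remove_corner:
  assumes "i \<in> corners lam"
  shows "diagram lam - {(Suc i, lam ! i)} = diagram (lam[i := lam ! i - 1])"
proof (rule Set.set_eqI, clarify)
  fix r c
  have "0 < lam ! i" "i < length lam" using assms by (auto simp: corners_def)
  then show "(r, c) \<in> diagram lam - {(Suc i, lam ! i)} \<longleftrightarrow> (r, c) \<in> diagram (lam[i := lam ! i - 1])"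
    by (cases "r = Suc i") (auto simp: diagram_def nth_list_update)
qed

lemma num_SVT_Suc:
  assumes "sorted_wrt (\<ge>) lam"
  shows "num_SVT lam (Suc N) = (\<Sum>i\<in>corners lam. num_SVT (lam[i := lam ! i - 1]) N + num_SVT lam N)"
proof -
  have "num_SVT lam (Suc N) = (\<Sum>b\<in>(\<lambda>i. (Suc i, lam ! i)) ` corners lam.
      card (poset_svt before (diagram lam - {b}) N) + card (poset_svt before (diagram lam) N))"
    by (simp only: num_SVT_def SVT_eq_poset_svt card_poset_svt_Suc[OF finite_diagram] maximal_boxes[OF assms])
  also have "\<dots> = (\<Sum>i\<in>corners lam.
      card (poset_svt before (diagram lam - {(Suc i, lam ! i)}) N) + card (poset_svt before (diagram lam) N))"
    by (rule sum.reindex_cong[of "\<lambda>i. (Suc i, lam ! i)"]) (simp_all add: inj_on_def)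
  also have "\<dots> = (\<Sum>i\<in>corners lam. num_SVT (lam[i := lam ! i - 1]) N + num_SVT lam N)"
  proof (rule sum.cong[OF refl])
    fix i assume "i \<in> corners lam"
    then show "card (poset_svt before (diagram lam - {(Suc i, lam ! i)}) N) + card (poset_svt before (diagram lam) N) =
        num_SVT (lam[i := lam ! i - 1]) N + num_SVT lam N"
      unfolding num_SVT_def SVT_eq_poset_svt by (simp only: diagram_remove_corner)
  qed
  finally show ?thesis .
qed

lemma num_SVT_0: "num_SVT lam 0 = (if \<forall>k\<in>set lam. k = 0 then 1 else 0)"
proof -
  have "diagram lam = {} \<longleftrightarrow> (\<forall>k\<in>set lam. k = 0)"
  proof
    assume empty: "diagram lam = {}"
    show "\<forall>k\<in>set lam. k = 0"
    proof
      fix k assume "k \<in> set lam"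
      then obtain i where i: "i < length lam" "lam ! i = k" by (metis in_set_conv_nth)
      have "(Suc i, 1) \<notin> diagram lam" by (simp add: empty)
      then show "k = 0" using i by (simp add: diagram_def)
    qed
  next
    assume zero: "\<forall>k\<in>set lam. k = 0"
    show "diagram lam = {}"
    proof (rule equals0I, clarify)
      fix r c assume "(r, c) \<in> diagram lam"
      then have "r - 1 < length lam" "1 \<le> lam ! (r - 1)" by (auto simp: diagram_def)
      moreover from this(1) zero have "lam ! (r - 1) = 0" by (metis nth_mem)
      ultimately show False by simp
    qed
  qed
  then show ?thesis
    unfolding num_SVT_def SVT_eq_poset_svt poset_svt_0 by simp
qed

lemma corner_sorted:
  assumes "sorted_wrt (\<ge>) lam" "i \<in> corners lam"
  shows "sorted_wrt (\<ge>) (lam[i := lam ! i - 1])"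
  unfolding sorted_wrt_iff_nth_less
proof (intro allI impI)
  fix a b assume ab: "a < b" "b < length (lam[i := lam ! i - 1])"
  have le: "lam ! b \<le> lam ! a" using assms ab by (auto simp: sorted_wrt_iff_nth_less)
  show "lam[i := lam ! i - 1] ! b \<le> lam[i := lam ! i - 1] ! a"
  proof (cases "a = i")
    case True
    have "lam ! b \<le> lam ! Suc a"
      using assms ab by (cases "b = Suc a") (auto simp: sorted_wrt_iff_nth_less)
    moreover have "lam ! Suc a < lam ! a"
      using True assms ab by (auto simp: corners_def)
    ultimately show ?thesis using True ab by (auto simp: nth_list_update)
  next
    case False
    have "lam[i := lam ! i - 1] ! b \<le> lam ! b"
      using ab by (cases "b = i") simp_all
    with False le show ?thesis by simp
  qed
qed

lemma sum_list_decrease: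
  assumes "i < length lam" "0 < lam ! i"
  shows "Suc (sum_list (lam[i := lam ! i - 1])) = sum_list (lam :: nat list)"
proof -
  have "sum_list (lam[i := lam ! i - 1]) = sum_list lam + (lam ! i - 1) - lam ! i"
    using assms by (simp add: sum_list_update)
  moreover have "lam ! i \<le> sum_list lam"
    using assms by (simp add: elem_le_sum_list)
  ultimately show ?thesis using assms by linarith
qed

text \<open>In the recurrence for \<open>|\<lambda>| = N + 1\<close> the summand
  \<open>f \<lambda> N\<close> leaves the range of the closed formula; this is the value it must
  have there.\<close>

lemma num_SVT_eq_0:
  assumes "sorted_wrt (\<ge>) lam" "N < sum_list lam"
  shows "num_SVT lam N = 0"
  using assms
proof (induction N arbitrary: lam)
  case 0
  have "\<not> (\<forall>k\<in>set lam. k = 0)"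
  proof
    assume "\<forall>k\<in>set lam. k = 0"
    then have "sum_list lam = 0" by simp
    with 0 show False by simp
  qed
  then show ?case
    by (simp only: num_SVT_0 if_False)
next
  case (Suc N)
  have "num_SVT (lam[i := lam ! i - 1]) N = 0" if i: "i \<in> corners lam" for i
  proof (rule Suc.IH[OF corner_sorted[OF Suc.prems(1) i]])
    have "Suc (sum_list (lam[i := lam ! i - 1])) = sum_list lam"
      using i by (intro sum_list_decrease) (auto simp: corners_def)
    then show "N < sum_list (lam[i := lam ! i - 1])"
      using Suc.prems(2) by linarith
  qed
  moreover have "num_SVT lam N = 0"
    by (rule Suc.IH[OF Suc.prems(1)]) (use Suc.prems(2) in linarith)
  ultimately show ?case
    by (simp add: num_SVT_Suc[OF Suc.prems(1)])
qed

section \<open>The determinant and its raising operator\<close>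

text \<open>Vandermonde's determinant for monic polynomials of descending degrees. With the first
  node replaced by a variable \<open>y\<close>, Laplace expansion shows a polynomial in
  \<open>y\<close> of degree at most \<open>m\<close> whose coefficient at \<open>m\<close> is the
  smaller determinant \<open>D\<close>. It agrees with \<open>D\<close> times the product of the
  \<open>y - x (Suc j)\<close>, since their difference has degree below \<open>m\<close> but
  vanishes at the \<open>m\<close> other nodes.\<close>

lemma det_monic_polys:
  fixes p :: "nat \<Rightarrow> 'a::idom poly"
  assumes "\<And>j. j < m \<Longrightarrow> degree (p j) = m - 1 - j" "\<And>j. j < m \<Longrightarrow> lead_coeff (p j) = 1"
  shows "det (Matrix.mat m m (\<lambda>(i, j). poly (p j) (x i))) = (\<Prod>j<m. \<Prod>i<j. x i - x j)"
  using assms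
proof (induction m arbitrary: p x)
  case 0
  show ?case by simp
next
  case (Suc m)
  define M where "M y = Matrix.mat (Suc m) (Suc m) (\<lambda>(i, j). poly (p j) (if i = 0 then y else x i))" for y
  define C where "C j = cofactor (M 0) 0 j" for j
  define D where "D = (\<Prod>j<m. \<Prod>i<j. x (Suc i) - x (Suc j))"
  have carr: "M y \<in> carrier_mat (Suc m) (Suc m)" for y
    by (simp add: M_def)
  \<comment> \<open>Only row 0 depends on \<open>y\<close>, and it is the row being deleted.\<close>
  have cof: "cofactor (M y) 0 j = C j" for y j
  proof -
    have "mat_delete (M y) 0 j = mat_delete (M 0) 0 j"
      by (intro eq_matI) (auto simp: mat_delete_def M_def)
    then show ?thesis
      by (simp add: C_def cofactor_def)
  qed
  have C0: "C 0 = D"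
  proof -
    have "mat_delete (M 0) 0 0 = Matrix.mat m m (\<lambda>(i, j). poly (p (Suc j)) (x (Suc i)))"
      by (intro eq_matI) (auto simp: mat_delete_def M_def)
    moreover have "degree (p (Suc j)) = m - 1 - j" "lead_coeff (p (Suc j)) = 1" if "j < m" for j
      using Suc.prems(1)[of "Suc j"] Suc.prems(2)[of "Suc j"] that by simp_all
    ultimately show ?thesis
      using Suc.IH[of "\<lambda>j. p (Suc j)" "\<lambda>i. x (Suc i)"] by (simp add: C_def cofactor_def D_def)
  qed
  have detM: "det (M y) = (\<Sum>j<Suc m. poly (p j) y * C j)" for y
    using laplace_expansion_row[OF carr, of 0 y] unfolding cof by (simp add: M_def)
  define q where "q = (\<Sum>j<Suc m. smult (C j) (p j)) - smult D (\<Prod>j<m. [:- x (Suc j), 1:])"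
  have poly_q: "poly q y = det (M y) - D * (\<Prod>j<m. y - x (Suc j))" for y
    by (simp add: q_def detM poly_sum poly_prod mult.commute del: sum.lessThan_Suc)
  have root: "det (M (x (Suc i))) = 0" if "i < m" for i
    by (rule det_identical_rows[OF carr, of 0 "Suc i"]) (use that in \<open>auto simp: M_def row_def\<close>)
  have "det (M (x 0)) = D * (\<Prod>j<m. x 0 - x (Suc j))"
  \<comment> \<open>Counting roots needs distinct nodes; if two nodes beyond the first coincide,
    both sides are 0.\<close>
  proof (cases "inj_on x {1..<Suc m}")
    case False
    then obtain u v where uv: "u \<in> {1..<Suc m}" "v \<in> {1..<Suc m}" "u < v" "x u = x v"
      unfolding inj_on_def by (metis linorder_neqE_nat)
    define a b where "a = u - 1" and "b = v - 1"
    have ab: "a < b" "b < m" "x (Suc a) = x (Suc b)"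
      using uv by (auto simp: a_def b_def)
    have "det (M (x 0)) = 0"
      by (rule det_identical_rows[OF carr, of "Suc a" "Suc b"]) (use ab in \<open>auto simp: M_def row_def\<close>)
    moreover have "D = 0"
    proof -
      have "(\<Prod>i<b. x (Suc i) - x (Suc b)) = 0"
        using ab by (intro prod_zero bexI[of _ a]) auto
      then have "\<exists>j\<in>{..<m}. (\<Prod>i<j. x (Suc i) - x (Suc j)) = 0"
        using ab(2) by blast
      then show ?thesis
        unfolding D_def by (rule prod_zero[OF finite_lessThan])
    qed
    ultimately show ?thesis by simp
  next
    case True
    define r where "r = smult D (\<Prod>j<m. [:- x (Suc j), 1:])"
    have pr: "degree (\<Prod>j<m. [:- x (Suc j), 1:]) = m" "lead_coeff (\<Prod>j<m. [:- x (Suc j), 1:]) = 1"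
      by (subst degree_prod_sum_eq) (auto simp: lead_coeff_prod)
    have cr: "coeff r m = D" "degree r \<le> m"
      using pr by (auto simp: r_def intro: order.trans[OF degree_smult_le])
    have cp: "coeff (p 0) m = 1" "degree (p j) \<le> m" if "j < Suc m" for j
      using Suc.prems(1)[of 0] Suc.prems(2)[of 0] Suc.prems(1)[of j] that by auto
    have cj: "coeff (p j) m = 0" if "j < Suc m" "j \<noteq> 0" for j
      using Suc.prems(1)[of j] that by (intro coeff_eq_0) auto
    have "coeff (\<Sum>j<Suc m. smult (C j) (p j)) m = (\<Sum>j<Suc m. if j = 0 then D else 0)"
      unfolding coeff_sum by (intro sum.cong) (auto simp: C0 cp(1)[of 0] cj)
    \<comment> \<open>Only \<open>p 0\<close> reaches degree \<open>m\<close>, and its coefficient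
      \<open>C 0 = D\<close> cancels against the product.\<close>
    then have "coeff q m = 0"
      by (simp add: q_def r_def[symmetric] cr del: sum.lessThan_Suc)
    moreover have "degree q \<le> m"
      unfolding q_def r_def[symmetric] using cr(2)
      by (intro degree_diff_le degree_sum_le order.trans[OF degree_smult_le]) (auto intro: cp)
    ultimately have deg: "q = 0 \<or> degree q < m"
      by (metis leading_coeff_0_iff le_neq_implies_less)
    have "q = 0"
    proof (rule ccontr)
      assume q: "q \<noteq> 0"
      have "x ` {1..<Suc m} \<subseteq> {y. poly q y = 0}"
      proof safe
        fix i assume i: "i \<in> {1..<Suc m}"
        then obtain k where "i = Suc k" "k < m" by (cases i) auto
        then show "poly q (x i) = 0"
          using root[of k] by (auto simp: poly_q)
      qed
      then have "card (x ` {1..<Suc m}) \<le> card {y. poly q y = 0}"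
        by (intro card_mono poly_roots_finite q)
      also have "\<dots> < m"
        using card_poly_roots_bound[OF q] deg q by simp
      finally show False
        using True by (simp add: card_image)
    qed
    then show ?thesis
      using poly_q[of "x 0"] by simp
  qed
  moreover have "M (x 0) = Matrix.mat (Suc m) (Suc m) (\<lambda>(i, j). poly (p j) (x i))"
    by (auto simp: M_def intro!: eq_matI)
  moreover have "(\<Prod>j<Suc m. \<Prod>i<j. x i - x j) = D * (\<Prod>j<m. x 0 - x (Suc j))"
    unfolding D_def prod.lessThan_Suc_shift by (simp add: prod.distrib prod.lessThan_Suc_shift del: prod.lessThan_Suc)
  ultimately show ?case by simp
qed

section \<open>The determinant of reciprocal factorials\<close>

definition rfact :: "int \<Rightarrow> real" where
  "rfact k = (if k < 0 then 0 else inverse (fact (nat k)))"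

lemma rfact_of_nat [simp]: "rfact (int n) = inverse (fact n)"
  by (simp add: rfact_def)

lemma rfact_neg [simp]: "k < 0 \<Longrightarrow> rfact k = 0"
  by (simp add: rfact_def)

text \<open>This is \<open>1 / (k - 1)! = k / k!\<close>. Extending by 0 to negative integers makes
  it valid for every \<open>k\<close>: at \<open>k = 0\<close> both sides vanish. The later
  identities can thus ignore whether a shape is a partition.\<close>

lemma rfact_pred: "rfact (k - 1) = of_int k * rfact k"
proof (cases "k > 0")
  case True
  then obtain n where k: "k = int (Suc n)"
    by (metis zero_less_imp_eq_int gr0_implies_Suc)
  have "rfact (k - 1) = inverse (fact n)"
    using rfact_of_nat[of n] by (simp add: k)
  also have "\<dots> = real (Suc n) * inverse (real (Suc n) * fact n)"
    by (simp add: field_simps del: of_nat_Suc)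
  also have "\<dots> = of_int k * rfact k"
    unfolding k rfact_of_nat fact_Suc by simp
  finally show ?thesis .
next
  case False
  then show ?thesis by (cases "k = 0") auto
qed

definition fdet :: "nat \<Rightarrow> (nat \<Rightarrow> int) \<Rightarrow> real" where
  "fdet m x = det (Matrix.mat m m (\<lambda>(i, j). rfact (x i + int j)))"

text \<open>Factoring out the smallest reciprocal factorial of a row leaves a monic polynomial of
  degree \<open>n - j\<close> in \<open>x\<close>, as \<open>det_monic_polys\<close> wants
  it.\<close>

lemma rfact_poly:
  assumes "j \<le> n"
  shows "rfact (x + int j) = rfact (x + int n) * poly (\<Prod>t\<in>{j<..n}. [:of_nat t, 1:]) (of_int x)"
  using assms
proof (induction rule: inc_induct)
  case (step k)
  then have "{k<..n} = insert (Suc k) {Suc k<..n}" by auto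
  moreover have "rfact (x + int k) = rfact (x + int (Suc k)) * (of_nat (Suc k) + of_int x)"
    using rfact_pred[of "x + int (Suc k)"] by (simp add: algebra_simps)
  ultimately show ?case
    using step.IH by (simp add: algebra_simps)
qed simp

lemma fdet_eq:
  "fdet m x = (\<Prod>i<m. rfact (x i + int m - 1)) * (\<Prod>j<m. \<Prod>i<j. of_int (x i - x j))"
proof -
  define p :: "nat \<Rightarrow> real poly" where "p j = (\<Prod>t\<in>{j<..m-1}. [:of_nat t, 1:])" for j
  have eq: "rfact (x i + int j) = rfact (x i + int m - 1) * poly (p j) (of_int (x i))" if "j < m" for i j
    using rfact_poly[of j "m - 1" "x i"] that by (simp add: p_def of_nat_diff algebra_simps)
  have deg: "degree (p j) = m - 1 - j" "lead_coeff (p j) = 1" for j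
    unfolding p_def by (subst degree_prod_sum_eq) (auto simp: lead_coeff_prod)
  define A where "A = Matrix.mat m m (\<lambda>(i, j). poly (p j) (real_of_int (x i)))"
  have A: "A \<in> carrier_mat m m" by (simp add: A_def)
  \<comment> \<open>The row factors are pulled out inside the Leibniz expansion, which is valid even
    when some of them are 0.\<close>
  have "fdet m x = (\<Sum>q | q permutes {0..<m}. signof q * (\<Prod>i=0..<m. rfact (x i + int m - 1) * A $$ (i, q i)))"
    unfolding fdet_def
    by (subst det_def'[of _ m], simp, intro sum.cong refl arg_cong2[of _ _ _ _ "(*)"] prod.cong)
       (auto simp: A_def eq)
  also have "\<dots> = (\<Prod>i<m. rfact (x i + int m - 1)) * det A"
    by (simp add: det_def'[OF A] prod.distrib sum_distrib_left mult.left_commute atLeast0LessThan)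
  also have "det A = (\<Prod>j<m. \<Prod>i<j. of_int (x i - x j))"
    using det_monic_polys[of m p "\<lambda>i. real_of_int (x i)", OF deg] by (simp add: A_def)
  finally show ?thesis .
qed

lemma fdet_swap:
  assumes "a < m" "b < m" "a \<noteq> b"
  shows "fdet m (x \<circ> Transposition.transpose a b) = - fdet m x"
proof -
  have t: "Transposition.transpose a b permutes {0..<m}"
    using assms by (intro permutes_swap_id) auto
  define A where "A = Matrix.mat m m (\<lambda>(i, j). rfact (x i + int j))"
  have "Matrix.mat m m (\<lambda>(i, j). rfact ((x \<circ> Transposition.transpose a b) i + int j))
      = Matrix.mat m m (\<lambda>(i, j). A $$ (Transposition.transpose a b i, j))"
    using assms by (intro eq_matI) (auto simp: A_def Transposition.transpose_def)
  moreover have "A \<in> carrier_mat m m"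
    by (simp add: A_def)
  ultimately show ?thesis
    using det_permute_rows[of A m, OF _ t] assms
    by (simp add: fdet_def A_def[symmetric] sign_swap_id)
qed

text \<open>In the Leibniz term of a permutation \<open>q\<close>, lowering \<open>x i\<close>
  multiplies by \<open>x i + q i\<close>. Summed over \<open>i\<close> this no longer depends on
  \<open>q\<close>, so it comes out of the determinant. For \<open>x i = l i - i\<close> the factor
  is the number of boxes.\<close>

lemma fdet_degree:
  "of_int (\<Sum>i<m. x i + int i) * fdet m x = (\<Sum>i<m. fdet m (x(i := x i - 1)))"
proof -
  define F where "F q y = (\<Prod>i<m. rfact (y i + int (q i)))" for q :: "nat \<Rightarrow> nat" and y
  have F: "fdet m y = (\<Sum>q | q permutes {0..<m}. signof q * F q y)" for y
    unfolding fdet_def F_def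
    by (subst det_def'[of _ m], simp, intro sum.cong refl arg_cong2[of _ _ _ _ "(*)"])
       (auto simp: atLeast0LessThan intro!: prod.cong dest: permutes_in_image)
  have step: "F q (x(i := x i - 1)) = of_int (x i + int (q i)) * F q x" if "i < m" for q i
  proof -
    have "F q y = rfact (y i + int (q i)) * (\<Prod>k\<in>{..<m} - {i}. rfact (y k + int (q k)))" for y
      unfolding F_def using that by (subst prod.remove[of _ i]) auto
    then show ?thesis
      using rfact_pred[of "x i + int (q i)"] by (simp add: algebra_simps)
  qed
  have "(\<Sum>i<m. fdet m (x(i := x i - 1)))
      = (\<Sum>q | q permutes {0..<m}. \<Sum>i<m. signof q * (of_int (x i + int (q i)) * F q x))"
    unfolding F by (subst sum.swap) (simp add: step)
  also have "\<dots> = (\<Sum>q | q permutes {0..<m}. of_int (\<Sum>i<m. x i + int i) * (signof q * F q x))"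
  proof (intro sum.cong refl)
    fix q assume "q \<in> {q. q permutes {0..<m}}"
    then have "(\<Sum>i<m. int (q i)) = (\<Sum>i<m. int i)"
      using sum.permute[of q "{0..<m}" int] by (simp add: atLeast0LessThan o_def)
    then have "(\<Sum>i<m. x i + int i) = (\<Sum>i<m. x i + int (q i))"
      by (simp add: sum.distrib)
    then show "(\<Sum>i<m. signof q * (of_int (x i + int (q i)) * F q x)) =
        of_int (\<Sum>i<m. x i + int i) * (signof q * F q x)"
      by (simp add: sum_distrib_left sum_distrib_right mult_ac)
  qed
  finally show ?thesis
    by (simp add: F sum_distrib_left)
qed


section \<open>The operators \<open>A\<close> (\<open>raise m\<close>) and \<open>E\<^sub>i\<close>
  (\<open>lower i\<close>) and their commutation\<close>

definition raise :: "nat \<Rightarrow> ((nat \<Rightarrow> int) \<Rightarrow> real) \<Rightarrow> (nat \<Rightarrow> int) \<Rightarrow> real" where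
  "raise m f l = (\<Sum>j<m. of_int (l j) * f (l(j := l j + 1)))"

definition lower :: "nat \<Rightarrow> ((nat \<Rightarrow> int) \<Rightarrow> real) \<Rightarrow> (nat \<Rightarrow> int) \<Rightarrow> real" where
  "lower i f l = f (l(i := l i - 1))"

text \<open>Only the summand \<open>j = i\<close> differs: there the coefficient is
  \<open>l i - 1\<close> on one side and \<open>l i\<close> on the other, and both evaluate
  \<open>f\<close> at \<open>l\<close> itself.\<close>

lemma lower_raise:
  assumes "i < m"
  shows "lower i (raise m f) l = raise m (lower i f) l - f l"
proof -
  have "of_int ((l(i := l i - 1)) j) * f ((l(i := l i - 1))(j := (l(i := l i - 1)) j + 1))
      = of_int (l j) * lower i f (l(j := l j + 1)) - (if j = i then f l else 0)" for j
    by (auto simp: lower_def fun_upd_twist algebra_simps)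
  then show ?thesis
    using assms by (simp add: raise_def lower_def[of i "raise m f"] sum_subtractf)
qed

lemma raise_linear:
  "raise m (\<lambda>l. a * f l + b * h l) l = a * raise m f l + b * raise m h l"
  by (simp add: raise_def algebra_simps sum.distrib sum_distrib_left)

text \<open>The commutator is a constant, so it accumulates linearly, as for a derivative. At
  \<open>k = 0\<close> the truncated \<open>k - 1\<close> is harmless because of the factor
  \<open>k\<close>.\<close>

lemma raise_power_lower:
  assumes "i < m"
  shows "(raise m ^^ k) (lower i f) = (\<lambda>l. lower i ((raise m ^^ k) f) l + real k * (raise m ^^ (k - 1)) f l)"
proof (induction k)
  case (Suc k)
  have "(raise m ^^ Suc k) (lower i f) l
      = raise m (lower i ((raise m ^^ k) f)) l + real k * raise m ((raise m ^^ (k - 1)) f) l" for l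
    using raise_linear[of m 1 _ "real k"] by (simp add: Suc.IH)
  moreover have "real k * raise m ((raise m ^^ (k - 1)) f) l = real k * (raise m ^^ k) f l" for l
    by (cases k) auto
  ultimately show ?case
    using lower_raise[OF assms, of "(raise m ^^ k) f"]
    by (intro ext) (simp add: distrib_right)
qed auto

lemma raise_power_sum:
  "(raise m ^^ k) (\<lambda>l. \<Sum>i\<in>I. f i l) = (\<lambda>l. \<Sum>i\<in>I. (raise m ^^ k) (f i) l)"
proof (induction k)
  case (Suc k)
  have "raise m (\<lambda>l. \<Sum>i\<in>I. h i l) l = (\<Sum>i\<in>I. raise m (h i) l)" for h l
    unfolding raise_def by (subst sum.swap) (simp add: sum_distrib_left)
  then show ?case
    by (simp add: Suc.IH)
qed auto

text \<open>Each application of \<open>raise m\<close> evaluates its argument at a point with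
  coordinate sum one higher, so the multiplier grows by one.\<close>

lemma raise_power_degree:
  "(raise m ^^ k) (\<lambda>l. of_int (\<Sum>i<m. l i) * f l) = (\<lambda>l. of_int ((\<Sum>i<m. l i) + int k) * (raise m ^^ k) f l)"
proof (induction k)
  case (Suc k)
  have "raise m (\<lambda>l. of_int ((\<Sum>i<m. l i) + int k) * h l) l = of_int ((\<Sum>i<m. l i) + int (Suc k)) * raise m h l" for h l
    unfolding raise_def sum_distrib_left
  proof (intro sum.cong refl)
    fix j assume "j \<in> {..<m}"
    then have "(\<Sum>i<m. (l(j := l j + 1)) i) = (\<Sum>i<m. l i) + 1"
      by (simp add: sum.remove[of "{..<m}" j])
    then show "of_int (l j) * (of_int ((\<Sum>i<m. (l(j := l j + 1)) i) + int k) * h (l(j := l j + 1))) =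
        of_int ((\<Sum>i<m. l i) + int (Suc k)) * (of_int (l j) * h (l(j := l j + 1)))"
      by (simp only:) simp
  qed
  then show ?case
    by (simp only: funpow.simps o_apply Suc.IH)
qed auto

text \<open>\<open>raise m\<close> treats the first \<open>m\<close> coordinates alike and therefore
  commutes with permuting them.\<close>

lemma raise_power_antisym:
  assumes "a < m" "b < m" "\<And>l. f (l \<circ> Transposition.transpose a b) = - f l"
  shows "(raise m ^^ k) f (l \<circ> Transposition.transpose a b) = - (raise m ^^ k) f l"
proof (induction k arbitrary: l)
  case (Suc k)
  let ?t = "Transposition.transpose a b"
  have t: "?t permutes {..<m}"
    using assms by (intro permutes_swap_id) auto
  have "raise m ((raise m ^^ k) f) (l \<circ> ?t)
      = (\<Sum>j<m. of_int (l (?t j)) * (raise m ^^ k) f ((l \<circ> ?t)(j := l (?t j) + 1)))"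
    by (simp add: raise_def[of m "(raise m ^^ k) f"])
  also have "\<dots> = (\<Sum>j<m. of_int (l j) * (raise m ^^ k) f ((l \<circ> ?t)(?t j := l j + 1)))"
    using sum.permute[OF t, of "\<lambda>j. of_int (l j) * (raise m ^^ k) f ((l \<circ> ?t)(?t j := l j + 1))"]
    by (simp add: o_def)
  also have "\<dots> = (\<Sum>j<m. of_int (l j) * (raise m ^^ k) f (l(j := l j + 1) \<circ> ?t))"
    by (intro sum.cong refl arg_cong2[of _ _ _ _ "(*)"] arg_cong[where f = "(raise m ^^ k) f"])
       (auto simp: fun_eq_iff Transposition.transpose_def)
  also have "\<dots> = - raise m ((raise m ^^ k) f) l"
    unfolding Suc.IH raise_def[of m "(raise m ^^ k) f"] by (simp add: sum_negf)
  moreover have "(raise m ^^ Suc k) f = raise m ((raise m ^^ k) f)"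
    by simp
  ultimately show ?case
    by (simp only:)
qed (simp add: assms)

text \<open>The one summand that would leave the hyperplane \<open>l i = 0\<close> carries the
  coefficient \<open>l i\<close>.\<close>

lemma raise_power_vanish:
  assumes "\<And>l. l i = 0 \<Longrightarrow> f l = 0" "l i = 0"
  shows "(raise m ^^ k) f l = 0"
  using assms(2)
proof (induction k arbitrary: l)
  case (Suc k)
  have "of_int (l j) * (raise m ^^ k) f (l(j := l j + 1)) = 0" for j
    using Suc by (cases "j = i") auto
  then show ?case by (auto simp: raise_def[of m "(raise m ^^ k) f"] intro!: sum.neutral)
qed (simp add: assms)

section \<open>The closed formula for the number of tableaux\<close>

definition shape_det :: "nat \<Rightarrow> (nat \<Rightarrow> int) \<Rightarrow> real" where
  "shape_det m l = fdet m (\<lambda>i. l i - int i)"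

definition shape_sum :: "nat \<Rightarrow> nat \<Rightarrow> (nat \<Rightarrow> int) \<Rightarrow> real" where
  "shape_sum m k = (raise m ^^ k) (shape_det m)"

lemma shape_det_degree: "of_int (\<Sum>i<m. l i) * shape_det m l = (\<Sum>i<m. lower i (shape_det m) l)"
proof -
  have "(\<lambda>k. (l(i := l i - 1)) k - int k) = (\<lambda>i. l i - int i)(i := l i - int i - 1)" for i
    by auto
  then show ?thesis
    using fdet_degree[of "\<lambda>i. l i - int i" m] by (simp add: shape_det_def lower_def)
qed

text \<open>Lowering row \<open>i\<close> gives the rows \<open>i\<close> and \<open>Suc i\<close>
  the same shift, namely \<open>Suc i\<close>, so swapping \<open>l i\<close> and
  \<open>l (Suc i)\<close> swaps two rows of the matrix; for equal lengths the value is its own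
  negative. For the last row with \<open>l i = 0\<close> the factor \<open>rfact (-1)\<close> in the
  product form of the determinant vanishes.\<close>

lemma shape_sum_noncorner:
  assumes "i < m" "if Suc i < m then l i = l (Suc i) else l i = 0"
  shows "(raise m ^^ k) (lower i (shape_det m)) l = 0"
proof (cases "Suc i < m")
  case True
  let ?t = "Transposition.transpose i (Suc i)"
  have "lower i (shape_det m) (l \<circ> ?t) = - lower i (shape_det m) l" for l
  proof -
    have "(\<lambda>k. ((l \<circ> ?t)(i := (l \<circ> ?t) i - 1)) k - int k) = (\<lambda>k. (l(i := l i - 1)) k - int k) \<circ> ?t"
      by (auto simp: fun_eq_iff Transposition.transpose_def)
    then show ?thesis
      using fdet_swap[of i m "Suc i"] True by (simp add: lower_def shape_det_def)
  qed
  from raise_power_antisym[where f = "lower i (shape_det m)", OF \<open>i < m\<close> True this, of k l]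
  have "(raise m ^^ k) (lower i (shape_det m)) (l \<circ> ?t) = - (raise m ^^ k) (lower i (shape_det m)) l" .
  moreover have "l \<circ> ?t = l"
    using assms True by (auto simp: fun_eq_iff Transposition.transpose_def)
  ultimately show ?thesis by simp
next
  case False
  then have m: "m = Suc i" using assms by simp
  have "lower i (shape_det m) l = 0" if "l i = 0" for l
  proof -
    have "(\<Prod>k<m. rfact ((l(i := l i - 1)) k - int k + int m - 1)) = 0"
      using that m by (intro prod_zero) (auto intro!: bexI[of _ i])
    then show ?thesis by (simp add: lower_def shape_det_def fdet_eq)
  qed
  then show ?thesis
    using assms False by (intro raise_power_vanish) auto
qed

text \<open>The k-th power of \<open>raise m\<close> is applied to both sides of
  \<open>shape_det_degree\<close>: on the left it shifts the multiplier, on the right it is moved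
  past each \<open>lower i\<close>.\<close>

lemma shape_sum_rec:
  "of_int ((\<Sum>i<m. l i) + int k) * shape_sum m k l =
    (\<Sum>i | i < m \<and> \<not> (if Suc i < m then l i = l (Suc i) else l i = 0).
       shape_sum m k (l(i := l i - 1)) + real k * shape_sum m (k - 1) l)"
proof -
  have "of_int ((\<Sum>i<m. l i) + int k) * shape_sum m k l
      = (raise m ^^ k) (\<lambda>l. \<Sum>i<m. lower i (shape_det m) l) l"
    unfolding shape_det_degree[symmetric] raise_power_degree by (simp add: shape_sum_def)
  also have "\<dots> = (\<Sum>i<m. (raise m ^^ k) (lower i (shape_det m)) l)"
    by (simp add: raise_power_sum)
  also have "\<dots> = (\<Sum>i | i < m \<and> \<not> (if Suc i < m then l i = l (Suc i) else l i = 0).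
       (raise m ^^ k) (lower i (shape_det m)) l)"
    by (intro sum.mono_neutral_right) (auto intro!: shape_sum_noncorner)
  also have "\<dots> = (\<Sum>i | i < m \<and> \<not> (if Suc i < m then l i = l (Suc i) else l i = 0).
       shape_sum m k (l(i := l i - 1)) + real k * shape_sum m (k - 1) l)"
    by (intro sum.cong) (auto simp: raise_power_lower shape_sum_def lower_def)
  finally show ?thesis .
qed

lemma shape_det_zero: "shape_det m (\<lambda>_. 0) = 1"
proof -
  have "shape_det m (\<lambda>_. 0) = prod_list (diag_mat (Matrix.mat m m (\<lambda>(i, j). rfact (0 - int i + int j))))"
    unfolding shape_det_def fdet_def by (rule det_upper_triangular) (auto simp: upper_triangular_def)
  also have "\<dots> = 1"
    using rfact_of_nat[of 0] by (simp add: prod_list_diag_prod)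
  finally show ?thesis .
qed

definition row_lengths :: "nat list \<Rightarrow> nat \<Rightarrow> int" where
  "row_lengths lam i = (if i < length lam then int (lam ! i) else 0)"

lemma sum_row_lengths: "(\<Sum>i<length lam. row_lengths lam i) = int (sum_list lam)"
  by (simp add: row_lengths_def sum_list_sum_nth atLeast0LessThan)

lemma row_lengths_decrease:
  assumes "i \<in> corners lam"
  shows "row_lengths (lam[i := lam ! i - 1]) = (row_lengths lam)(i := row_lengths lam i - 1)"
  using assms by (auto simp: row_lengths_def corners_def fun_eq_iff nth_list_update)

lemma corners_eq:
  assumes "sorted_wrt (\<ge>) lam"
  shows "corners lam = {i. i < length lam \<and> \<not> (if Suc i < length lam
    then row_lengths lam i = row_lengths lam (Suc i) else row_lengths lam i = 0)}"
proof -
  have "lam ! Suc i \<le> lam ! i" if "Suc i < length lam" for i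
    using assms that by (simp add: sorted_wrt_iff_nth_less)
  then show ?thesis
    by (fastforce simp: corners_def row_lengths_def split: if_splits)
qed

text \<open>Multiplied by \<open>fact N / fact k\<close>, the summands of
  \<open>shape_sum_rec\<close> become the two counts of the recurrence, since
  \<open>real k / fact k = 1 / fact (k - 1)\<close> for positive \<open>k\<close>; the multiplier on
  its left is \<open>Suc N\<close>.\<close>

theorem num_SVT_formula:
  assumes "sorted_wrt (\<ge>) lam" "sum_list lam + k = N"
  shows "real (num_SVT lam N) = fact N / fact k * shape_sum (length lam) k (row_lengths lam)"
  using assms
proof (induction N arbitrary: lam k)
  case 0
  then have "\<forall>k\<in>set lam. k = 0" "k = 0" by auto
  moreover from this(1) have "row_lengths lam = (\<lambda>_. 0)"
    by (auto simp: row_lengths_def fun_eq_iff)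
  ultimately show ?case
    by (simp add: num_SVT_0 shape_sum_def shape_det_zero)
next
  case (Suc N)
  let ?m = "length lam" and ?l = "row_lengths lam"
  have "real (num_SVT (lam[i := lam ! i - 1]) N + num_SVT lam N) = fact N / fact k *
      (shape_sum ?m k (?l(i := ?l i - 1)) + real k * shape_sum ?m (k - 1) ?l)"
    if i: "i \<in> corners lam" for i
  proof -
    have "Suc (sum_list (lam[i := lam ! i - 1])) = sum_list lam"
      using i by (intro sum_list_decrease) (auto simp: corners_def)
    then have "sum_list (lam[i := lam ! i - 1]) + k = N"
      using Suc.prems(2) by linarith
    from Suc.IH[OF corner_sorted[OF Suc.prems(1) i] this]
    have "real (num_SVT (lam[i := lam ! i - 1]) N) = fact N / fact k * shape_sum ?m k (?l(i := ?l i - 1))"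
      by (simp only: row_lengths_decrease[OF i] length_list_update)
    moreover have "real (num_SVT lam N) = fact N / fact k * (real k * shape_sum ?m (k - 1) ?l)"
    proof (cases k)
      \<comment> \<open>Without excess \<open>N\<close> lies below the size of the shape: the count
        is 0, and so is the factor \<open>real k\<close>.\<close>
      case 0
      then show ?thesis
        using num_SVT_eq_0[OF Suc.prems(1), of N] Suc.prems(2) by simp
    next
      case (Suc k')
      then show ?thesis
        using Suc.IH[OF Suc.prems(1), of k'] Suc.prems(2) by (simp add: field_simps del: of_nat_Suc)
    qed
    ultimately show ?thesis
      by (simp add: distrib_left)
  qed
  then have "real (num_SVT lam (Suc N)) = (\<Sum>i\<in>corners lam. fact N / fact k *
      (shape_sum ?m k (?l(i := ?l i - 1)) + real k * shape_sum ?m (k - 1) ?l))"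
    by (simp add: num_SVT_Suc[OF Suc.prems(1)])
  also have "\<dots> = fact N / fact k * (of_int ((\<Sum>i<?m. ?l i) + int k) * shape_sum ?m k ?l)"
    unfolding shape_sum_rec corners_eq[OF Suc.prems(1)] by (rule sum_distrib_left[symmetric])
  also have "(\<Sum>i<?m. ?l i) + int k = int (Suc N)"
    using Suc.prems(2) by (simp add: sum_row_lengths)
  finally show ?case by simp
qed

section \<open>Cost bounds for deterministic programs\<close>

text \<open>The value of \<open>Digits\<close> may be exponential in the value of its argument,
  which would destroy every bound of the form \<open>2 ^ (B * asize e)\<close>. The exact algorithms
  consult neither parameter.\<close>

fun digit_free :: "aexp \<Rightarrow> bool" where
  "digit_free (Num n) = True"
| "digit_free (Get x e) = digit_free e"
| "digit_free (Add e1 e2) = (digit_free e1 \<and> digit_free e2)"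
| "digit_free (Sub e1 e2) = (digit_free e1 \<and> digit_free e2)"
| "digit_free (Mul e1 e2) = (digit_free e1 \<and> digit_free e2)"
| "digit_free (Div e1 e2) = (digit_free e1 \<and> digit_free e2)"
| "digit_free (Digits q e) = False"

text \<open>A numeral counts with its value, so that values are at most \<open>2 ^ (B * asize e)\<close>
  when all memory cells are at most \<open>2 ^ B\<close>.\<close>

fun asize :: "aexp \<Rightarrow> nat" where
  "asize (Num n) = n + 1"
| "asize (Get x e) = asize e + 1"
| "asize (Add e1 e2) = asize e1 + asize e2 + 1"
| "asize (Sub e1 e2) = asize e1 + asize e2 + 1"
| "asize (Mul e1 e2) = asize e1 + asize e2 + 1"
| "asize (Div e1 e2) = asize e1 + asize e2 + 1"
| "asize (Digits q e) = asize e + 1"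

definition bounded_store :: "nat \<Rightarrow> store \<Rightarrow> bool" where
  "bounded_store B s \<longleftrightarrow> (\<forall>x i. s x i \<le> 2 ^ B)"

lemma asize_pos: "0 < asize e"
  by (cases e) auto

lemma pow2_add_le: "a \<le> 2 ^ m \<Longrightarrow> b \<le> 2 ^ n \<Longrightarrow> m + n < k \<Longrightarrow> a + b \<le> (2 :: nat) ^ k"
proof -
  assume a: "a \<le> 2 ^ m" "b \<le> 2 ^ n" "m + n < k"
  have "a + b \<le> 2 ^ (m + n) + 2 ^ (m + n)"
    by (intro add_mono order.trans[OF a(1)] order.trans[OF a(2)] power_increasing) auto
  also have "\<dots> = 2 ^ Suc (m + n)" by simp
  also have "\<dots> \<le> 2 ^ k" using a(3) by (intro power_increasing) auto
  finally show ?thesis .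
qed

lemma aval_bound:
  assumes "bounded_store B s" "0 < B" "digit_free e"
  shows "aval \<rho> s e \<le> 2 ^ (B * asize e)"
  using assms(3)
proof (induction e)
  case (Num n)
  have "n \<le> 2 ^ n" by (simp add: less_imp_le_nat)
  also have "(2::nat) ^ n \<le> 2 ^ (B * (n + 1))"
    using assms(2) by (intro power_increasing) (cases B, auto)
  finally show ?case by simp
next
  case (Get x e)
  have "aval \<rho> s (Get x e) \<le> 2 ^ B"
    using assms(1) by (simp add: bounded_store_def)
  also have "(2::nat) ^ B \<le> 2 ^ (B * asize (Get x e))"
    by (intro power_increasing) auto
  finally show ?case .
next
  case (Add e1 e2)
  then show ?case
    using assms(2) by (auto intro!: pow2_add_le simp: algebra_simps)
next
  case (Sub e1 e2)
  have "aval \<rho> s e1 - aval \<rho> s e2 \<le> 2 ^ (B * asize e1)"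
    using Sub by (simp add: le_diff_conv trans_le_add1)
  also have "(2::nat) ^ (B * asize e1) \<le> 2 ^ (B * asize (Sub e1 e2))"
    by (intro power_increasing) (auto simp: algebra_simps)
  finally show ?case by simp
next
  case (Mul e1 e2)
  have "aval \<rho> s e1 * aval \<rho> s e2 \<le> 2 ^ (B * asize e1) * 2 ^ (B * asize e2)"
    using Mul by (intro mult_mono) auto
  also have "\<dots> \<le> 2 ^ (B * asize (Mul e1 e2))"
    unfolding power_add[symmetric] by (intro power_increasing) (auto simp: algebra_simps)
  finally show ?case by simp
next
  case (Div e1 e2)
  have "aval \<rho> s e1 div aval \<rho> s e2 \<le> 2 ^ (B * asize e1)"
    using Div by (intro order.trans[OF div_le_dividend]) auto
  also have "(2::nat) ^ (B * asize e1) \<le> 2 ^ (B * asize (Div e1 e2))"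
    by (intro power_increasing) (auto simp: algebra_simps)
  finally show ?case by simp
qed simp

lemma bit_size_bound: "n \<le> 2 ^ k \<Longrightarrow> bit_size n \<le> k + 2"
proof -
  assume "n \<le> 2 ^ k"
  then have "n < 2 ^ (k + 1)"
    by (rule order.strict_trans1) simp
  then show ?thesis
    by (simp add: bit_size_def floorlog_le_iff)
qed

definition acost_bound :: "aexp \<Rightarrow> nat" where
  "acost_bound e = 3 * (asize e)\<^sup>2"

text \<open>There are at most \<open>asize e\<close> nodes, each charged at most
  \<open>B * asize e + 2\<close>. The 3 in \<open>acost_bound\<close> absorbs the additive 2,
  because \<open>B * asize e\<close> is at least 1.\<close>

lemma acost_le:
  assumes "bounded_store B s" "0 < B" "digit_free e"
  shows "acost \<rho> s e \<le> acost_bound e * B"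
proof -
  have bs: "bit_size (aval \<rho> s e) \<le> B * asize e + 2" if "digit_free e" for e
    using aval_bound[OF assms(1,2) that] by (rule bit_size_bound)
  have bin: "a * (B * a + 2) + b * (B * b + 2) + (B * (a + b + 1) + 2) \<le> (a + b + 1) * (B * (a + b + 1) + 2)" for a b :: nat
    by (simp add: algebra_simps)
  have "acost \<rho> s e \<le> asize e * (B * asize e + 2)"
    using assms(3)
  proof (induction e)
    case (Num n)
    have "bit_size n \<le> B * asize (Num n) + 2"
      using bs[of "Num n"] by simp
    also have "\<dots> \<le> asize (Num n) * (B * asize (Num n) + 2)" by simp
    finally show ?case by simp
  next
    case (Get x e)
    then have "acost \<rho> s (Get x e) \<le> asize e * (B * asize e + 2) + (B * asize (Get x e) + 2)"
      using bs[of "Get x e"] by simp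
    also have "\<dots> \<le> asize (Get x e) * (B * asize (Get x e) + 2)"
      by (simp add: algebra_simps)
    finally show ?case .
  next
    case (Add e1 e2)
    then have "acost \<rho> s (Add e1 e2) \<le> asize e1 * (B * asize e1 + 2) + asize e2 * (B * asize e2 + 2) + (B * asize (Add e1 e2) + 2)"
      using bs[of "Add e1 e2"] by simp
    with bin[of "asize e1" "asize e2"] show ?case by (simp del: acost.simps)
  next
    case (Sub e1 e2)
    then have "acost \<rho> s (Sub e1 e2) \<le> asize e1 * (B * asize e1 + 2) + asize e2 * (B * asize e2 + 2) + (B * asize (Sub e1 e2) + 2)"
      using bs[of "Sub e1 e2"] by simp
    with bin[of "asize e1" "asize e2"] show ?case by (simp del: acost.simps)
  next
    case (Mul e1 e2)
    then have "acost \<rho> s (Mul e1 e2) \<le> asize e1 * (B * asize e1 + 2) + asize e2 * (B * asize e2 + 2) + (B * asize (Mul e1 e2) + 2)"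
      using bs[of "Mul e1 e2"] by simp
    with bin[of "asize e1" "asize e2"] show ?case by (simp del: acost.simps)
  next
    case (Div e1 e2)
    then have "acost \<rho> s (Div e1 e2) \<le> asize e1 * (B * asize e1 + 2) + asize e2 * (B * asize e2 + 2) + (B * asize (Div e1 e2) + 2)"
      using bs[of "Div e1 e2"] by simp
    with bin[of "asize e1" "asize e2"] show ?case by (simp del: acost.simps)
  qed simp
  also have "\<dots> \<le> asize e * (B * asize e + 2 * (B * asize e))"
  proof -
    have "1 \<le> B * asize e" using assms(2) asize_pos[of e] by (simp add: Suc_le_eq)
    then show ?thesis by (intro mult_le_mono2) linarith
  qed
  also have "\<dots> = acost_bound e * B"
    by (simp add: acost_bound_def power2_eq_square algebra_simps)
  finally show ?thesis .
qed

fun csize :: "com \<Rightarrow> nat" where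
  "csize Skip = 1"
| "csize (Assign x e1 e2) = 1 + acost_bound e1 + acost_bound e2"
| "csize (Toss x e) = 1 + acost_bound e"
| "csize (Seq P Q) = csize P + csize Q"
| "csize (Cond e P Q) = 1 + acost_bound e + csize P + csize Q"
| "csize (While e P) = 1 + acost_bound e + csize P"

text \<open>\<open>P\<close> tosses no coins, keeps all memory cells below \<open>2 ^ B\<close> and takes time at most
  \<open>csize P * R * B\<close>; here \<open>csize P\<close> is a constant, and \<open>R\<close> accounts for the
  iterations of the loops.\<close>

definition run :: "(rparam \<Rightarrow> real) \<Rightarrow> nat \<Rightarrow> nat \<Rightarrow> com \<Rightarrow> store \<Rightarrow> (store \<Rightarrow> bool) \<Rightarrow> bool" where
  "run \<rho> B R P s Q \<longleftrightarrow> 0 < B \<and> 0 < R \<and> (bounded_store B s \<longrightarrow>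
     (\<exists>s'. bounded_store B s' \<and> Q s' \<and>
       (\<forall>\<omega>. \<exists>t \<le> csize P * R * B. exec \<rho> P (s, \<omega>) t (s', \<omega>))))"

lemma run_conseq:
  assumes "run \<rho> B R P s Q" "R \<le> R'" "\<And>s'. Q s' \<Longrightarrow> Q' s'"
  shows "run \<rho> B R' P s Q'"
proof -
  have "csize P * R * B \<le> csize P * R' * B"
    using assms(2) by simp
  with assms show ?thesis
    unfolding run_def by (meson le_trans less_le_trans)
qed

lemma run_Skip: "0 < B \<Longrightarrow> 0 < R \<Longrightarrow> Q s \<Longrightarrow> run \<rho> B R Skip s Q"
  unfolding run_def
  by (auto intro!: exI[of _ s] exI[of _ "1::nat"] exec.Skip simp: Suc_le_eq)

lemma run_Assign:
  assumes "0 < B" "0 < R" "digit_free e1" "digit_free e2" "aval \<rho> s e2 \<le> 2 ^ B"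
    "Q (store_upd s x (aval \<rho> s e1) (aval \<rho> s e2))"
  shows "run \<rho> B R (Assign x e1 e2) s Q"
  unfolding run_def
proof (intro conjI impI assms(1,2))
  assume s: "bounded_store B s"
  let ?s = "store_upd s x (aval \<rho> s e1) (aval \<rho> s e2)"
  have "bounded_store B ?s"
    using s assms(5) by (auto simp: bounded_store_def store_upd_def)
  moreover have "1 + acost \<rho> s e1 + acost \<rho> s e2 \<le> csize (Assign x e1 e2) * R * B"
  proof -
    have "1 + acost \<rho> s e1 + acost \<rho> s e2 \<le> B + acost_bound e1 * B + acost_bound e2 * B"
      using acost_le[OF s assms(1,3), of \<rho>] acost_le[OF s assms(1,4), of \<rho>] assms(1) by linarith
    also have "\<dots> = csize (Assign x e1 e2) * 1 * B"
      by (simp add: algebra_simps)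
    also have "\<dots> \<le> csize (Assign x e1 e2) * R * B"
      using assms(2) by (intro mult_le_mono) auto
    finally show ?thesis .
  qed
  ultimately show "\<exists>s'. bounded_store B s' \<and> Q s' \<and>
      (\<forall>\<omega>. \<exists>t\<le>csize (Assign x e1 e2) * R * B. exec \<rho> (Assign x e1 e2) (s, \<omega>) t (s', \<omega>))"
    using assms(6) exec.Assign by blast
qed

lemma run_Seq:
  assumes "run \<rho> B R P1 s (\<lambda>s'. run \<rho> B R P2 s' Q)"
  shows "run \<rho> B R (Seq P1 P2) s Q"
  unfolding run_def
proof (intro conjI impI)
  show "0 < B" "0 < R" using assms by (auto simp: run_def)
  assume "bounded_store B s"
  with assms obtain s1 where s1: "bounded_store B s1" "run \<rho> B R P2 s1 Q"
    "\<And>\<omega>. \<exists>t\<le>csize P1 * R * B. exec \<rho> P1 (s, \<omega>) t (s1, \<omega>)"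
    unfolding run_def[of _ _ _ P1] by blast
  then obtain s2 where s2: "bounded_store B s2" "Q s2"
    "\<And>\<omega>. \<exists>t\<le>csize P2 * R * B. exec \<rho> P2 (s1, \<omega>) t (s2, \<omega>)"
    unfolding run_def by blast
  have "\<exists>t\<le>csize (Seq P1 P2) * R * B. exec \<rho> (Seq P1 P2) (s, \<omega>) t (s2, \<omega>)" for \<omega>
  proof -
    obtain t1 t2 where "t1 \<le> csize P1 * R * B" "exec \<rho> P1 (s, \<omega>) t1 (s1, \<omega>)"
      "t2 \<le> csize P2 * R * B" "exec \<rho> P2 (s1, \<omega>) t2 (s2, \<omega>)"
      using s1(3) s2(3) by blast
    then show ?thesis
      by (intro exI[of _ "t1 + t2"]) (auto intro: exec.Seq simp: algebra_simps)
  qed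
  with s2 show "\<exists>s'. bounded_store B s' \<and> Q s' \<and>
      (\<forall>\<omega>. \<exists>t\<le>csize (Seq P1 P2) * R * B. exec \<rho> (Seq P1 P2) (s, \<omega>) t (s', \<omega>))"
    by blast
qed

lemma run_Cond:
  assumes "0 < B" "0 < R" "digit_free e"
    "aval \<rho> s e \<noteq> 0 \<Longrightarrow> run \<rho> B R P1 s Q" "aval \<rho> s e = 0 \<Longrightarrow> run \<rho> B R P2 s Q"
  shows "run \<rho> B R (Cond e P1 P2) s Q"
  unfolding run_def
proof (intro conjI impI assms(1,2))
  assume s: "bounded_store B s"
  have c: "1 + acost \<rho> s e \<le> (1 + acost_bound e) * R * B"
  proof -
    have "1 + acost \<rho> s e \<le> B + acost_bound e * B"
      using acost_le[OF s assms(1,3), of \<rho>] assms(1) by linarith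
    also have "\<dots> = (1 + acost_bound e) * 1 * B"
      by (simp add: algebra_simps)
    also have "\<dots> \<le> (1 + acost_bound e) * R * B"
      using assms(2) by (intro mult_le_mono) auto
    finally show ?thesis .
  qed
  show "\<exists>s'. bounded_store B s' \<and> Q s' \<and>
      (\<forall>\<omega>. \<exists>t\<le>csize (Cond e P1 P2) * R * B. exec \<rho> (Cond e P1 P2) (s, \<omega>) t (s', \<omega>))"
  proof (cases "aval \<rho> s e = 0")
    case True
    from assms(5)[OF True] s obtain s2 where s2: "bounded_store B s2" "Q s2"
      "\<And>\<omega>. \<exists>t\<le>csize P2 * R * B. exec \<rho> P2 (s, \<omega>) t (s2, \<omega>)"
      unfolding run_def by blast
    have "\<exists>t\<le>csize (Cond e P1 P2) * R * B. exec \<rho> (Cond e P1 P2) (s, \<omega>) t (s2, \<omega>)" for \<omega>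
    proof -
      obtain t where "t \<le> csize P2 * R * B" "exec \<rho> P2 (s, \<omega>) t (s2, \<omega>)"
        using s2(3) by blast
      then show ?thesis
        using c by (intro exI[of _ "1 + acost \<rho> s e + t"] conjI exec.CondFalse[OF True])
          (simp_all add: algebra_simps)
    qed
    with s2 show ?thesis by blast
  next
    case False
    from assms(4)[OF False] s obtain s2 where s2: "bounded_store B s2" "Q s2"
      "\<And>\<omega>. \<exists>t\<le>csize P1 * R * B. exec \<rho> P1 (s, \<omega>) t (s2, \<omega>)"
      unfolding run_def by blast
    have "\<exists>t\<le>csize (Cond e P1 P2) * R * B. exec \<rho> (Cond e P1 P2) (s, \<omega>) t (s2, \<omega>)" for \<omega>
    proof -
      obtain t where "t \<le> csize P1 * R * B" "exec \<rho> P1 (s, \<omega>) t (s2, \<omega>)"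
        using s2(3) by blast
      then show ?thesis
        using c by (intro exI[of _ "1 + acost \<rho> s e + t"] conjI exec.CondTrue[OF False])
          (simp_all add: algebra_simps)
    qed
    with s2 show ?thesis by blast
  qed
qed

text \<open>\<open>I i\<close> holds after \<open>i\<close> rounds, and the number \<open>n\<close>
  of rounds is known in advance. The factor is \<open>n + 1\<close> because the guard is evaluated
  once more on leaving. Nested loops thus multiply their budgets \<open>R\<close>, while
  \<open>csize\<close> stays a constant of the program text.\<close>

lemma run_While:
  assumes "0 < B" "0 < R'" "(n + 1) * R' \<le> R" "digit_free e" "I 0 s"
    and step: "\<And>i s. i < n \<Longrightarrow> I i s \<Longrightarrow> aval \<rho> s e \<noteq> 0 \<and> run \<rho> B R' P s (I (Suc i))"
    and exit: "\<And>s. I n s \<Longrightarrow> aval \<rho> s e = 0 \<and> Q s"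
  shows "run \<rho> B R (While e P) s Q"
  unfolding run_def
proof (intro conjI impI assms(1))
  show "0 < R" by (rule less_le_trans[OF _ assms(3)]) (simp add: assms(2))
  have guard: "1 + acost \<rho> s e \<le> (1 + acost_bound e) * R' * B" if "bounded_store B s" for s
  proof -
    have "1 + acost \<rho> s e \<le> B + acost_bound e * B"
      using acost_le[OF that assms(1,4), of \<rho>] assms(1) by linarith
    also have "\<dots> = (1 + acost_bound e) * 1 * B"
      by (simp add: algebra_simps)
    also have "\<dots> \<le> (1 + acost_bound e) * R' * B"
      using assms(2) by (intro mult_le_mono) auto
    finally show ?thesis .
  qed
  \<comment> \<open>Induction on the number \<open>k\<close> of rounds still to come.\<close>
  have *: "\<exists>s'. bounded_store B s' \<and> Q s' \<and>
      (\<forall>\<omega>. \<exists>t\<le>csize (While e P) * ((k + 1) * R') * B. exec \<rho> (While e P) (s, \<omega>) t (s', \<omega>))"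
    if "bounded_store B s" "k \<le> n" "I (n - k) s" for k s
    using that
  proof (induction k arbitrary: s)
    case 0
    have ex: "aval \<rho> s e = 0" "Q s" using exit[of s] 0 by auto
    have "1 + acost \<rho> s e \<le> csize (While e P) * ((0 + 1) * R') * B"
      by (rule order.trans[OF guard[OF 0(1)]]) simp
    with ex 0 show ?case
      by (intro exI[of _ s]) (auto intro!: exI[of _ "1 + acost \<rho> s e"] exec.WhileFalse)
  next
    case (Suc k)
    have *: "aval \<rho> s e \<noteq> 0" "run \<rho> B R' P s (I (n - k))"
      using step[of "n - Suc k" s] Suc.prems by (auto simp: Suc_diff_Suc)
    then obtain s1 where s1: "bounded_store B s1" "I (n - k) s1"
      "\<And>\<omega>. \<exists>t\<le>csize P * R' * B. exec \<rho> P (s, \<omega>) t (s1, \<omega>)"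
      using Suc.prems(1) unfolding run_def by blast
    obtain s2 where s2: "bounded_store B s2" "Q s2"
      "\<And>\<omega>. \<exists>t\<le>csize (While e P) * ((k + 1) * R') * B. exec \<rho> (While e P) (s1, \<omega>) t (s2, \<omega>)"
      using Suc.IH[OF s1(1) _ s1(2)] Suc.prems(2) by auto
    have "\<exists>t\<le>csize (While e P) * ((Suc k + 1) * R') * B. exec \<rho> (While e P) (s, \<omega>) t (s2, \<omega>)" for \<omega>
    proof -
      obtain t1 t2 where t: "t1 \<le> csize P * R' * B" "exec \<rho> P (s, \<omega>) t1 (s1, \<omega>)"
        "t2 \<le> csize (While e P) * ((k + 1) * R') * B" "exec \<rho> (While e P) (s1, \<omega>) t2 (s2, \<omega>)"
        using s1(3) s2(3) by blast
      have "1 + acost \<rho> s e + t1 + t2 \<le>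
          (1 + acost_bound e) * R' * B + csize P * R' * B + csize (While e P) * ((k + 1) * R') * B"
        using guard[OF Suc.prems(1)] t(1,3) by linarith
      also have "\<dots> = csize (While e P) * ((Suc k + 1) * R') * B"
        by (simp add: algebra_simps)
      finally show ?thesis
        using exec.WhileTrue[OF *(1) t(2,4)] by blast
    qed
    with s2 show ?case by blast
  qed
  assume "bounded_store B s"
  from *[OF this, of n] assms(5) obtain s' where s': "bounded_store B s'" "Q s'"
    "\<And>\<omega>. \<exists>t\<le>csize (While e P) * ((n + 1) * R') * B. exec \<rho> (While e P) (s, \<omega>) t (s', \<omega>)"
    by auto
  have "csize (While e P) * ((n + 1) * R') * B \<le> csize (While e P) * R * B"
    by (intro mult_le_mono1 mult_le_mono2 assms(3))
  then have "\<exists>t\<le>csize (While e P) * R * B. exec \<rho> (While e P) (s, \<omega>) t (s', \<omega>)" for \<omega>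
    using s'(3)[of \<omega>] order.trans by blast
  with s'(1,2) show "\<exists>s'. bounded_store B s' \<and> Q s' \<and>
      (\<forall>\<omega>. \<exists>t\<le>csize (While e P) * R * B. exec \<rho> (While e P) (s, \<omega>) t (s', \<omega>))"
    by blast
qed

lemma run_SeqI:
  assumes "run \<rho> B R P1 s Q'" "\<And>s'. Q' s' \<Longrightarrow> run \<rho> B R P2 s' Q"
  shows "run \<rho> B R (Seq P1 P2) s Q"
  by (rule run_Seq, rule run_conseq[OF assms(1) order.refl]) (rule assms(2))

section \<open>From exact polynomial-time programs to approximation schemes\<close>

lemma real_polynomial_function_snd_fst: 
  "real_polynomial_function (\<lambda>x :: real \<times> real \<times> real \<times> real. fst (snd x))"
  by (intro real_polynomial_function.intros(1) bounded_linear_fst_comp bounded_linear_snd)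

lemma prob_space_coins: "prob_space coins"
  unfolding coins_def by (intro prob_space.prob_space_stream_space measure_pmf.prob_space_axioms)

lemma space_coins: "space coins = UNIV"
  by (simp add: coins_def space_stream_space)

text \<open>An exact result lies in the required interval for every outcome of the coins, so the
  success event is the whole space. The bound \<open>csize P * R * B\<close> is polynomial in
  \<open>N\<close> for fixed \<open>K\<close>, \<open>d\<close> and \<open>r\<close>.\<close>

lemma has_FPRASI:
  assumes "\<And>lam N \<rho>. (lam, N) \<in> I \<Longrightarrow> bounded_store (K * (N + 1) ^ d) (input_store lam N) \<and>
       run \<rho> (K * (N + 1) ^ d) ((2 * N + 1) ^ r) P (input_store lam N) (\<lambda>s. result s = real (f lam N))"
  shows "has_FPRAS f I"
  unfolding has_FPRAS_def
proof (intro exI conjI ballI, safe)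
  let ?p = "\<lambda>x :: real \<times> real \<times> real \<times> real. real (csize P) * (2 * fst (snd x) + 1) ^ r * (real K * (fst (snd x) + 1) ^ d)"
  show "real_polynomial_function ?p"
    by (intro real_polynomial_function.intros(2-4) real_polynomial_function_power real_polynomial_function_snd_fst)
  fix lam N and \<epsilon> \<delta> :: real
  assume I: "(lam, N) \<in> I" and \<epsilon>: "\<epsilon> \<in> {0<..1}" and \<delta>: "\<delta> \<in> {0<..1}"
  let ?\<rho> = "real_params \<epsilon> \<delta>"
  obtain s' where s': "result s' = real (f lam N)"
    "\<And>\<omega>. \<exists>t \<le> csize P * (2 * N + 1) ^ r * (K * (N + 1) ^ d). exec ?\<rho> P (input_store lam N, \<omega>) t (s', \<omega>)"
    using assms[OF I, of ?\<rho>] unfolding run_def by blast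
  {
    fix \<omega>
    obtain t where t: "t \<le> csize P * (2 * N + 1) ^ r * (K * (N + 1) ^ d)"
      "exec ?\<rho> P (input_store lam N, \<omega>) t (s', \<omega>)"
      using s'(2) by blast
    have "real t \<le> real (csize P * (2 * N + 1) ^ r * (K * (N + 1) ^ d))"
      using t(1) of_nat_le_iff by blast
    also have "\<dots> = ?p (real (sum_list lam), real N, 1 / \<epsilon>, ln (1 / \<delta>))"
      by (simp only: of_nat_mult of_nat_power of_nat_add of_nat_1 of_nat_numeral fst_conv snd_conv)
    finally show "\<exists>t s' \<omega>'. exec ?\<rho> P (input_store lam N, \<omega>) t (s', \<omega>') \<and>
        real t \<le> ?p (real (sum_list lam), real N, 1 / \<epsilon>, ln (1 / \<delta>))"
      using t(2) by blast
  }
  have "(1 - \<epsilon>) * real (f lam N) \<le> result s' \<and> result s' \<le> (1 + \<epsilon>) * real (f lam N)"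
    using \<epsilon> by (simp add: s'(1) algebra_simps)
  then have "{\<omega>. \<exists>t s' \<omega>'. exec ?\<rho> P (input_store lam N, \<omega>) t (s', \<omega>') \<and>
      (1 - \<epsilon>) * real (f lam N) \<le> result s' \<and> result s' \<le> (1 + \<epsilon>) * real (f lam N)} = space coins"
    using s'(2) unfolding space_coins by blast
  then show "1 - \<delta> \<le> measure coins {\<omega>. \<exists>t s' \<omega>'. exec ?\<rho> P (input_store lam N, \<omega>) t (s', \<omega>') \<and>
      (1 - \<epsilon>) * real (f lam N) \<le> result s' \<and> result s' \<le> (1 + \<epsilon>) * real (f lam N)}"
    using \<delta> prob_space.prob_space[OF prob_space_coins] by simp
qed

section \<open>Bounded excess\<close>

abbreviation Var :: "string \<Rightarrow> aexp" where
  "Var x \<equiv> Get x (Num 0)"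

abbreviation SetVar :: "string \<Rightarrow> aexp \<Rightarrow> com" where
  "SetVar x e \<equiv> Assign x (Num 0) e"

lemma run_Seq_Assign:
  assumes "0 < B" "0 < R" "digit_free e1" "digit_free e2" "aval \<rho> s e2 \<le> 2 ^ B"
    "run \<rho> B R P (store_upd s x (aval \<rho> s e1) (aval \<rho> s e2)) Q"
  shows "run \<rho> B R (Seq (Assign x e1 e2) P) s Q"
  by (rule run_Seq, rule run_Assign) (use assms in auto)

definition same_on :: "string set \<Rightarrow> store \<Rightarrow> store \<Rightarrow> bool" where
  "same_on A s s' \<longleftrightarrow> (\<forall>x\<in>A. s' x = s x)"

lemma same_on_refl [simp]: "same_on A s s"
  by (simp add: same_on_def)

lemma same_on_upd: "x \<notin> A \<Longrightarrow> same_on A s (store_upd s' x i v) \<longleftrightarrow> same_on A s s'"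
  by (auto simp: same_on_def store_upd_def)

lemma same_onD: "same_on A s s' \<Longrightarrow> x \<in> A \<Longrightarrow> s' x = s x"
  by (simp add: same_on_def)

lemma store_upd_apply: "store_upd s x i v y j = (if y = x \<and> j = i then v else s y j)"
  by (simp add: store_upd_def)

text \<open>Memory cells are natural numbers; a signed product is kept as the difference of
  the cells \<open>p\<close> and \<open>q\<close>, and a signed sum as that of \<open>pos\<close> and \<open>neg\<close>.\<close>

definition pq :: "store \<Rightarrow> real \<Rightarrow> nat \<Rightarrow> bool" where
  "pq s z b \<longleftrightarrow> real (s ''p'' 0) - real (s ''q'' 0) = z \<and> s ''p'' 0 + s ''q'' 0 \<le> b"

lemma pq_upd: "x \<notin> {''p'', ''q''} \<Longrightarrow> pq (store_upd s x i v) z b \<longleftrightarrow> pq s z b"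
  by (auto simp: pq_def store_upd_def)

lemma pq_mono: "pq s z b \<Longrightarrow> b \<le> b' \<Longrightarrow> pq s z b'"
  by (auto simp: pq_def)

text \<open>One signed multiplication:
  \<open>(p - q) * (u - v) = (p * u + q * v) - (p * v + q * u)\<close>. Cell \<open>t\<close> holds
  the new \<open>p\<close>, since the new \<open>q\<close> still needs the old one.\<close>

definition pair_step :: com where
  "pair_step =
    Seq (SetVar ''t'' (Add (Mul (Var ''p'') (Add (Get ''lambda'' (Var ''i'')) (Var ''j'')))
                           (Mul (Var ''q'') (Add (Get ''lambda'' (Var ''j'')) (Var ''i'')))))
    (Seq (SetVar ''q'' (Add (Mul (Var ''p'') (Add (Get ''lambda'' (Var ''j'')) (Var ''i'')))
                            (Mul (Var ''q'') (Add (Get ''lambda'' (Var ''i'')) (Var ''j'')))))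
    (Seq (SetVar ''p'' (Var ''t''))
         (SetVar ''i'' (Add (Var ''i'') (Num 1)))))"

text \<open>The Vandermonde factor \<open>(L i - i) - (L j - j)\<close>, regrouped so that both
  brackets are natural numbers.\<close>

definition pair_diff :: "(nat \<Rightarrow> nat) \<Rightarrow> nat \<Rightarrow> nat \<Rightarrow> real" where
  "pair_diff L i j = (real (L i) + real j) - (real (L j) + real i)"

lemma run_pair_step:
  assumes "0 < B" "pq s z b" "s ''i'' 0 = i" "s ''j'' 0 = j" "s ''lambda'' = L"
    "i < 2 ^ B" "L i + j + (L j + i) \<le> X" "b * X \<le> 2 ^ B" "A \<inter> {''t'', ''q'', ''p'', ''i''} = {}" "same_on A s0 s"
  shows "run \<rho> B 1 pair_step s (\<lambda>s'. same_on A s0 s' \<and> s' ''j'' 0 = j \<and> s' ''i'' 0 = Suc i \<and>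
    pq s' (z * pair_diff L i j) (b * X))"
proof -
  define p q u v where "p = s ''p'' 0" and "q = s ''q'' 0" and "u = L i + j" and "v = L j + i"
  have pq: "real p - real q = z" "p + q \<le> b"
    using assms(2) by (auto simp: pq_def p_def q_def)
  \<comment> \<open>The new cells sum to exactly \<open>(p + q) * (u + v)\<close>, so a bound on the
    sum is all that has to be carried along.\<close>
  have "(p * u + q * v) + (p * v + q * u) = (p + q) * (u + v)"
    by (simp add: algebra_simps)
  also have "\<dots> \<le> b * X"
    using pq assms(7) by (intro mult_mono) (auto simp: u_def v_def)
  finally have sum: "(p * u + q * v) + (p * v + q * u) \<le> b * X" .
  then have bd: "p * u + q * v \<le> 2 ^ B" "p * v + q * u \<le> 2 ^ B"
    using assms(8) by linarith+
  have "real (p * u + q * v) - real (p * v + q * u) = z * pair_diff L i j"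
    unfolding pq(1)[symmetric] by (simp add: u_def v_def pair_diff_def algebra_simps)
  with assms sum bd show ?thesis
    unfolding pair_step_def pq_def
    by (intro run_Seq_Assign run_Assign)
      (simp_all add: store_upd_apply same_on_upd p_def[symmetric] q_def[symmetric] u_def[symmetric] v_def[symmetric]
        del: of_nat_add of_nat_mult)
qed

definition pair_loop :: com where
  "pair_loop = While (Sub (Var ''j'') (Var ''i'')) pair_step"

text \<open>In the size bound \<open>W * X ^ e\<close> the exponent counts multiplications, each by
  a number of at most \<open>X\<close>.\<close>

lemma run_pair_loop:
  assumes "0 < B" "same_on A s0 s" "''lambda'' \<in> A" "A \<inter> {''t'', ''q'', ''p'', ''i''} = {}" "s0 ''lambda'' = L"
    and "s ''i'' 0 = 0" "s ''j'' 0 = j" "j + 1 \<le> R" "j \<le> 2 ^ B" "pq s z (W * X ^ e)"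
    and X: "\<And>i. i < j \<Longrightarrow> L i + j + (L j + i) \<le> X" "W * X ^ (e + j) \<le> 2 ^ B" "0 < X"
  shows "run \<rho> B R pair_loop s (\<lambda>s'. same_on A s0 s' \<and> s' ''j'' 0 = j \<and>
    pq s' (z * (\<Prod>i<j. pair_diff L i j)) (W * X ^ (e + j)))"
  unfolding pair_loop_def
proof (rule run_While[where n = j and R' = 1 and I = "\<lambda>i s'. same_on A s0 s' \<and> s' ''j'' 0 = j \<and> s' ''i'' 0 = i \<and>
    pq s' (z * (\<Prod>i'<i. pair_diff L i' j)) (W * X ^ (e + i))"])
  fix i s' assume i: "i < j" and I: "same_on A s0 s' \<and> s' ''j'' 0 = j \<and> s' ''i'' 0 = i \<and>
    pq s' (z * (\<Prod>i'<i. pair_diff L i' j)) (W * X ^ (e + i))"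
  have "W * X ^ (e + i) * X = W * X ^ (e + Suc i)" by simp
  also have "\<dots> \<le> W * X ^ (e + j)"
    using i X(3) by (intro mult_le_mono2 power_increasing) auto
  finally have "W * X ^ (e + i) * X \<le> 2 ^ B" using X(2) by linarith
  moreover have "s' ''lambda'' = L" using same_onD[of A s0 s' "''lambda''"] I assms by simp
  ultimately have "run \<rho> B 1 pair_step s' (\<lambda>t. same_on A s0 t \<and> t ''j'' 0 = j \<and> t ''i'' 0 = Suc i \<and>
    pq t (z * (\<Prod>i'<i. pair_diff L i' j) * pair_diff L i j) (W * X ^ (e + i) * X))"
    using assms I i by (intro run_pair_step) auto
  then show "aval \<rho> s' (Sub (Var ''j'') (Var ''i'')) \<noteq> 0 \<and> run \<rho> B 1 pair_step s'
     (\<lambda>s'. same_on A s0 s' \<and> s' ''j'' 0 = j \<and> s' ''i'' 0 = Suc i \<and>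
    pq s' (z * (\<Prod>i'<Suc i. pair_diff L i' j)) (W * X ^ (e + Suc i)))"
    using I i by (simp add: mult_ac)
qed (use assms in auto)

definition pair_loops :: com where
  "pair_loops = While (Sub (Var ''len'') (Var ''j''))
    (Seq (SetVar ''i'' (Num 0)) (Seq pair_loop (SetVar ''j'' (Add (Var ''j'') (Num 1)))))"

lemma run_pair_loops:
  assumes "0 < B" "same_on A s0 s" "''lambda'' \<in> A" "''len'' \<in> A" "A \<inter> {''t'', ''q'', ''p'', ''i'', ''j''} = {}"
    and "s0 ''lambda'' = L" "s0 ''len'' 0 = m" "s ''j'' 0 = 0" "(m + 1)\<^sup>2 \<le> R" "m \<le> 2 ^ B" "pq s z (W * X ^ e)"
    and X: "\<And>i j. i < m \<Longrightarrow> j < m \<Longrightarrow> L i + j + (L j + i) \<le> X" "W * X ^ (e + m * m) \<le> 2 ^ B" "0 < X"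
  shows "run \<rho> B R pair_loops s (\<lambda>s'. same_on A s0 s' \<and>
    pq s' (z * (\<Prod>j<m. \<Prod>i<j. pair_diff L i j)) (W * X ^ (e + m * m)))"
  unfolding pair_loops_def
proof (rule run_While[where n = m and R' = "m + 1" and I = "\<lambda>j s'. same_on A s0 s' \<and> s' ''j'' 0 = j \<and>
    pq s' (z * (\<Prod>j'<j. \<Prod>i<j'. pair_diff L i j')) (W * X ^ (e + j * m))"])
  fix j s' assume j: "j < m" and I: "same_on A s0 s' \<and> s' ''j'' 0 = j \<and>
    pq s' (z * (\<Prod>j'<j. \<Prod>i<j'. pair_diff L i j')) (W * X ^ (e + j * m))"
  have len: "s' ''len'' 0 = m"
    using same_onD[of A s0 s' "''len''"] assms I by simp
  \<comment> \<open>The inner loop makes only \<open>j\<close> multiplications but is charged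
    \<open>m\<close>, which keeps the exponent linear in \<open>j\<close>.\<close>
  have le: "W * X ^ (e + j * m + j) \<le> W * X ^ (e + Suc j * m)"
    using j X(3) by (intro mult_le_mono2 power_increasing) auto
  have "e + Suc j * m \<le> e + m * m"
    using j by (intro add_left_mono mult_le_mono1) simp
  then have "W * X ^ (e + Suc j * m) \<le> 2 ^ B"
    using X(3) by (intro order.trans[OF mult_le_mono2[OF power_increasing] X(2)]) auto
  with le have le2: "W * X ^ (e + j * m + j) \<le> 2 ^ B" by linarith
  let ?z = "z * (\<Prod>j'<j. \<Prod>i<j'. pair_diff L i j')"
  have 1: "run \<rho> B (m + 1) pair_loop (store_upd s' ''i'' 0 0) (\<lambda>t. same_on A s0 t \<and> t ''j'' 0 = j \<and>
    pq t (?z * (\<Prod>i<j. pair_diff L i j)) (W * X ^ (e + j * m + j)))"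
    using assms I j le2 by (intro run_pair_loop) (auto simp: same_on_upd pq_upd store_upd_apply)
  have 2: "run \<rho> B (m + 1) (SetVar ''j'' (Add (Var ''j'') (Num 1))) t (\<lambda>s'. same_on A s0 s' \<and> s' ''j'' 0 = Suc j \<and>
    pq s' (z * (\<Prod>j'<Suc j. \<Prod>i<j'. pair_diff L i j')) (W * X ^ (e + Suc j * m)))"
    if "same_on A s0 t \<and> t ''j'' 0 = j \<and> pq t (?z * (\<Prod>i<j. pair_diff L i j)) (W * X ^ (e + j * m + j))" for t
    using that assms j pq_mono[OF _ le]
    by (intro run_Assign) (auto simp: same_on_upd pq_upd store_upd_apply mult.assoc simp del: mult_Suc power_Suc)
  show "aval \<rho> s' (Sub (Var ''len'') (Var ''j'')) \<noteq> 0 \<and>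
      run \<rho> B (m + 1) (Seq (SetVar ''i'' (Num 0)) (Seq pair_loop (SetVar ''j'' (Add (Var ''j'') (Num 1))))) s'
     (\<lambda>s'. same_on A s0 s' \<and> s' ''j'' 0 = Suc j \<and>
    pq s' (z * (\<Prod>j'<Suc j. \<Prod>i<j'. pair_diff L i j')) (W * X ^ (e + Suc j * m)))"
    using run_SeqI[OF 1 2] len I j assms(1)
    by (auto intro!: run_Seq_Assign simp del: mult_Suc power_Suc prod.lessThan_Suc)
next
  fix s' assume "same_on A s0 s' \<and> s' ''j'' 0 = m \<and>
    pq s' (z * (\<Prod>j'<m. \<Prod>i<j'. pair_diff L i j')) (W * X ^ (e + m * m))"
  then show "aval \<rho> s' (Sub (Var ''len'') (Var ''j'')) = 0 \<and> same_on A s0 s' \<and>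
    pq s' (z * (\<Prod>j<m. \<Prod>i<j. pair_diff L i j)) (W * X ^ (e + m * m))"
    using same_onD[of A s0 s' "''len''"] assms by simp
qed (use assms in \<open>auto simp: power2_eq_square\<close>)

text \<open>Division is avoided by giving all terms the denominator \<open>(2 * N)! ^ m\<close>: the
  loop below multiplies by \<open>(2 * N)! / y!\<close>.\<close>

definition fact_step :: com where
  "fact_step = Seq (SetVar ''y'' (Add (Var ''y'') (Num 1)))
    (Seq (SetVar ''p'' (Mul (Var ''p'') (Var ''y''))) (SetVar ''q'' (Mul (Var ''q'') (Var ''y''))))"

lemma run_fact_step:
  assumes "0 < B" "pq s z b" "s ''y'' 0 = y" "y < X" "X \<le> 2 ^ B" "b * X \<le> 2 ^ B"
    "A \<inter> {''y'', ''q'', ''p''} = {}" "same_on A s0 s"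
  shows "run \<rho> B 1 fact_step s (\<lambda>s'. same_on A s0 s' \<and> s' ''y'' 0 = Suc y \<and> s' ''j'' 0 = s ''j'' 0 \<and>
    pq s' (z * real (Suc y)) (b * X))"
proof -
  define p q where "p = s ''p'' 0" and "q = s ''q'' 0"
  have pq: "real p - real q = z" "p + q \<le> b"
    using assms(2) by (auto simp: pq_def p_def q_def)
  have "p * Suc y + q * Suc y = (p + q) * Suc y"
    by (simp add: algebra_simps)
  also have "\<dots> \<le> b * X"
    using pq assms(4) by (intro mult_mono) auto
  finally have sum: "p * Suc y + q * Suc y \<le> b * X" .
  then have bd: "p * Suc y \<le> 2 ^ B" "q * Suc y \<le> 2 ^ B"
    using assms(6) by linarith+
  have "real (p * Suc y) - real (q * Suc y) = z * real (Suc y)"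
    unfolding pq(1)[symmetric] of_nat_mult by (simp only: left_diff_distrib)
  with assms sum bd show ?thesis
    unfolding fact_step_def pq_def
    by (intro run_Seq_Assign run_Assign)
      (simp_all add: store_upd_apply same_on_upd p_def[symmetric] q_def[symmetric] del: mult_Suc_right of_nat_Suc of_nat_mult)
qed

definition fact_loop :: com where
  "fact_loop = While (Sub (Add (Var ''N'') (Var ''N'')) (Var ''y'')) fact_step"

lemma run_fact_loop:
  assumes "0 < B" "same_on A s0 s" "''N'' \<in> A" "A \<inter> {''y'', ''q'', ''p''} = {}"
    and "s0 ''N'' 0 = N" "s ''y'' 0 = y" "y \<le> 2 * N" "2 * N + 1 \<le> R" "s ''j'' 0 = j" "pq s z (W * X ^ e)"
    and X: "2 * N \<le> X" "X \<le> 2 ^ B" "W * X ^ (e + 2 * N) \<le> 2 ^ B" "0 < X"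
  shows "run \<rho> B R fact_loop s (\<lambda>s'. same_on A s0 s' \<and> s' ''j'' 0 = j \<and>
    pq s' (z * (fact (2 * N) / fact y)) (W * X ^ (e + 2 * N)))"
  unfolding fact_loop_def
proof (rule run_While[where n = "2 * N - y" and R' = 1 and I = "\<lambda>i s'. same_on A s0 s' \<and> s' ''j'' 0 = j \<and>
    s' ''y'' 0 = y + i \<and> pq s' (z * (fact (y + i) / fact y)) (W * X ^ (e + i))"])
  fix i s' assume i: "i < 2 * N - y" and I: "same_on A s0 s' \<and> s' ''j'' 0 = j \<and>
    s' ''y'' 0 = y + i \<and> pq s' (z * (fact (y + i) / fact y)) (W * X ^ (e + i))"
  have "W * X ^ (e + i) * X = W * X ^ (e + Suc i)" by simp
  also have "\<dots> \<le> W * X ^ (e + 2 * N)"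
    using i X(4) by (intro mult_le_mono2 power_increasing) auto
  finally have "W * X ^ (e + i) * X \<le> 2 ^ B" using X(3) by linarith
  then have "run \<rho> B 1 fact_step s' (\<lambda>t. same_on A s0 t \<and> t ''y'' 0 = Suc (y + i) \<and> t ''j'' 0 = s' ''j'' 0 \<and>
    pq t (z * (fact (y + i) / fact y) * real (Suc (y + i))) (W * X ^ (e + i) * X))"
    using assms I i by (intro run_fact_step) auto
  moreover have "z * (fact (y + i) / fact y) * real (Suc (y + i)) = z * (fact (y + Suc i) / fact y)"
    by (simp add: field_simps)
  moreover have "s' ''N'' 0 = N" using same_onD[of A s0 s' "''N''"] I assms by simp
  ultimately show "aval \<rho> s' (Sub (Add (Var ''N'') (Var ''N'')) (Var ''y'')) \<noteq> 0 \<and> run \<rho> B 1 fact_step s'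
     (\<lambda>s'. same_on A s0 s' \<and> s' ''j'' 0 = j \<and>
    s' ''y'' 0 = y + Suc i \<and> pq s' (z * (fact (y + Suc i) / fact y)) (W * X ^ (e + Suc i)))"
    using I i by (auto elim!: run_conseq simp: mult_ac)
next
  fix s' assume I: "same_on A s0 s' \<and> s' ''j'' 0 = j \<and> s' ''y'' 0 = y + (2 * N - y) \<and>
    pq s' (z * (fact (y + (2 * N - y)) / fact y)) (W * X ^ (e + (2 * N - y)))"
  have "W * X ^ (e + (2 * N - y)) \<le> W * X ^ (e + 2 * N)"
    using X(4) by (intro mult_le_mono2 power_increasing) auto
  moreover have "s' ''N'' 0 = N" using same_onD[of A s0 s' "''N''"] I assms by simp
  ultimately show "aval \<rho> s' (Sub (Add (Var ''N'') (Var ''N'')) (Var ''y'')) = 0 \<and> same_on A s0 s' \<and>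
     s' ''j'' 0 = j \<and> pq s' (z * (fact (2 * N) / fact y)) (W * X ^ (e + 2 * N))"
    using I assms(7) by (auto intro: pq_mono)
qed (use assms in auto)

text \<open>\<open>y\<close> starts at the argument of the factorial that row \<open>j\<close> has
  in the denominator of \<open>shape_det_nat\<close>. It is at most \<open>2 * N\<close>, since a
  row and the number of rows are each at most \<open>N\<close>; this is why \<open>(2 * N)!\<close>
  is a common multiple.\<close>

definition fact_loops :: com where
  "fact_loops = While (Sub (Var ''len'') (Var ''j''))
    (Seq (SetVar ''y'' (Sub (Add (Get ''lambda'' (Var ''j'')) (Var ''len'')) (Add (Var ''j'') (Num 1))))
    (Seq fact_loop (SetVar ''j'' (Add (Var ''j'') (Num 1)))))"

lemma run_fact_loops:
  assumes "0 < B" "same_on A s0 s" "''lambda'' \<in> A" "''len'' \<in> A" "''N'' \<in> A" "A \<inter> {''y'', ''q'', ''p'', ''j''} = {}"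
    and "s0 ''lambda'' = L" "s0 ''len'' 0 = m" "s0 ''N'' 0 = N" "s ''j'' 0 = 0" "(m + 1) * (2 * N + 1) \<le> R"
    and "m \<le> 2 ^ B" "pq s z (W * X ^ e)" "\<And>j. j < m \<Longrightarrow> L j + m \<le> 2 * N"
    and X: "2 * N \<le> X" "X \<le> 2 ^ B" "W * X ^ (e + m * (2 * N)) \<le> 2 ^ B" "0 < X"
  shows "run \<rho> B R fact_loops s (\<lambda>s'. same_on A s0 s' \<and>
    pq s' (z * (\<Prod>j<m. fact (2 * N) / fact (L j + m - (j + 1)))) (W * X ^ (e + m * (2 * N))))"
  unfolding fact_loops_def
proof (rule run_While[where n = m and R' = "2 * N + 1" and I = "\<lambda>j s'. same_on A s0 s' \<and> s' ''j'' 0 = j \<and>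
    pq s' (z * (\<Prod>j<j. fact (2 * N) / fact (L j + m - (j + 1)))) (W * X ^ (e + j * (2 * N)))"])
  fix j s' assume j: "j < m" and I: "same_on A s0 s' \<and> s' ''j'' 0 = j \<and>
    pq s' (z * (\<Prod>j<j. fact (2 * N) / fact (L j + m - (j + 1)))) (W * X ^ (e + j * (2 * N)))"
  have rd: "s' ''len'' 0 = m" "s' ''lambda'' = L"
    using same_onD[of A s0 s'] assms I by simp_all
  have "e + j * (2 * N) + 2 * N = e + Suc j * (2 * N)" by simp
  also have "\<dots> \<le> e + m * (2 * N)"
    using j by (intro add_left_mono mult_le_mono1) simp
  finally have le2: "W * X ^ (e + j * (2 * N) + 2 * N) \<le> 2 ^ B"
    using X(4) by (intro order.trans[OF mult_le_mono2[OF power_increasing] X(3)]) auto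
  let ?z = "z * (\<Prod>j<j. fact (2 * N) / fact (L j + m - (j + 1)))" and ?y = "L j + m - (j + 1)"
  have y: "?y \<le> 2 * N" using assms(14)[OF j] by linarith
  have 1: "run \<rho> B (2 * N + 1) fact_loop (store_upd s' ''y'' 0 ?y) (\<lambda>t. same_on A s0 t \<and> t ''j'' 0 = j \<and>
    pq t (?z * (fact (2 * N) / fact ?y)) (W * X ^ (e + j * (2 * N) + 2 * N)))"
    using assms I le2 y by (intro run_fact_loop) (auto simp: same_on_upd pq_upd store_upd_apply)
  have 2: "run \<rho> B (2 * N + 1) (SetVar ''j'' (Add (Var ''j'') (Num 1))) t (\<lambda>s'. same_on A s0 s' \<and> s' ''j'' 0 = Suc j \<and>
    pq s' (z * (\<Prod>j<Suc j. fact (2 * N) / fact (L j + m - (j + 1)))) (W * X ^ (e + Suc j * (2 * N))))"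
    if "same_on A s0 t \<and> t ''j'' 0 = j \<and> pq t (?z * (fact (2 * N) / fact ?y)) (W * X ^ (e + j * (2 * N) + 2 * N))" for t
    using that assms j
    by (intro run_Assign) (auto simp: same_on_upd pq_upd store_upd_apply mult.assoc add_ac)
  have "?y \<le> 2 ^ B" using y X by linarith
  then show "aval \<rho> s' (Sub (Var ''len'') (Var ''j'')) \<noteq> 0 \<and>
      run \<rho> B (2 * N + 1) (Seq (SetVar ''y'' (Sub (Add (Get ''lambda'' (Var ''j'')) (Var ''len'')) (Add (Var ''j'') (Num 1))))
    (Seq fact_loop (SetVar ''j'' (Add (Var ''j'') (Num 1))))) s'
     (\<lambda>s'. same_on A s0 s' \<and> s' ''j'' 0 = Suc j \<and>
    pq s' (z * (\<Prod>j<Suc j. fact (2 * N) / fact (L j + m - (j + 1)))) (W * X ^ (e + Suc j * (2 * N))))"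
    using run_SeqI[OF 1 2] rd I j assms(1)
    by (auto intro!: run_Seq_Assign simp del: mult_Suc power_Suc prod.lessThan_Suc)
next
  fix s' assume "same_on A s0 s' \<and> s' ''j'' 0 = m \<and>
    pq s' (z * (\<Prod>j<m. fact (2 * N) / fact (L j + m - (j + 1)))) (W * X ^ (e + m * (2 * N)))"
  then show "aval \<rho> s' (Sub (Var ''len'') (Var ''j'')) = 0 \<and> same_on A s0 s' \<and>
    pq s' (z * (\<Prod>j<m. fact (2 * N) / fact (L j + m - (j + 1)))) (W * X ^ (e + m * (2 * N)))"
    using same_onD[of A s0 s' "''len''"] assms by simp
qed (use assms in auto)

lemma shape_det_nat:
  "shape_det m (\<lambda>i. int (L i)) =
    (\<Prod>j<m. 1 / fact (L j + m - (j + 1))) * (\<Prod>j<m. \<Prod>i<j. pair_diff L i j)"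
proof -
  have "rfact (int (L j) - int j + int m - 1) = 1 / fact (L j + m - (j + 1))" if "j < m" for j
  proof -
    have "int (L j) - int j + int m - 1 = int (L j + m - (j + 1))"
      using that by simp
    then show ?thesis by (simp only: rfact_of_nat inverse_eq_divide)
  qed
  then show ?thesis
    unfolding shape_det_def fdet_eq
    by (intro arg_cong2[of _ _ _ _ "(*)"] prod.cong refl) (auto simp: pair_diff_def)
qed

text \<open>The accumulators only grow. Recording their increments instead of their values lets the
  contributions of successive terms add up, as in \<open>delta_trans\<close>.\<close>

definition delta :: "store \<Rightarrow> store \<Rightarrow> real \<Rightarrow> nat \<Rightarrow> bool" where
  "delta s s' d b \<longleftrightarrow> (\<exists>P M. s' ''pos'' 0 = s ''pos'' 0 + P \<and> s' ''neg'' 0 = s ''neg'' 0 + M \<and>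
     real P - real M = d \<and> P + M \<le> b)"

lemma delta_refl: "delta s s 0 0"
  by (auto simp: delta_def)

lemma delta_trans:
  assumes "delta s t d b" "delta t u d' b'"
  shows "delta s u (d + d') (b + b')"
proof -
  obtain P M where 1: "t ''pos'' 0 = s ''pos'' 0 + P" "t ''neg'' 0 = s ''neg'' 0 + M"
    "real P - real M = d" "P + M \<le> b"
    using assms(1) by (auto simp: delta_def)
  obtain P' M' where 2: "u ''pos'' 0 = t ''pos'' 0 + P'" "u ''neg'' 0 = t ''neg'' 0 + M'"
    "real P' - real M' = d'" "P' + M' \<le> b'"
    using assms(2) by (auto simp: delta_def)
  show ?thesis
    unfolding delta_def using 1 2 by (intro exI[of _ "P + P'"] exI[of _ "M + M'"]) auto
qed

lemma delta_mono:
  assumes "delta s t d b" "b \<le> b'"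
  shows "delta s t d b'"
proof -
  obtain P M where "t ''pos'' 0 = s ''pos'' 0 + P" "t ''neg'' 0 = s ''neg'' 0 + M"
    "real P - real M = d" "P + M \<le> b"
    using assms(1) by (auto simp: delta_def)
  with assms(2) show ?thesis
    unfolding delta_def by (intro exI[of _ P] exI[of _ M]) auto
qed

lemma delta_bound: "delta s t d b \<Longrightarrow> t ''pos'' 0 + t ''neg'' 0 \<le> s ''pos'' 0 + s ''neg'' 0 + b"
  by (auto simp: delta_def)

lemma delta_upd:
  "x \<notin> {''pos'', ''neg''} \<Longrightarrow> delta s (store_upd t x i v) d b \<longleftrightarrow> delta s t d b"
  "x \<notin> {''pos'', ''neg''} \<Longrightarrow> delta (store_upd s x i v) t d b \<longleftrightarrow> delta s t d b"
  by (auto simp: delta_def store_upd_def)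

text \<open>The innermost body of the nested loops: one summand of the expanded power of
  \<open>raise m\<close>, whose coefficient is in \<open>w\<close> and whose raised shape is
  currently in \<open>lambda\<close>.\<close>

definition term_prog :: com where
  "term_prog = Seq (SetVar ''p'' (Var ''w'')) (Seq (SetVar ''q'' (Num 0)) (Seq (SetVar ''j'' (Num 0))
    (Seq pair_loops (Seq (SetVar ''j'' (Num 0)) (Seq fact_loops
    (Seq (SetVar ''pos'' (Add (Var ''pos'') (Var ''p''))) (SetVar ''neg'' (Add (Var ''neg'') (Var ''q'')))))))))"

lemma run_term_prog:
  assumes "0 < B" "s ''len'' 0 = m" "s ''N'' 0 = N" "s ''lambda'' = L" "s ''w'' 0 = W" "0 < N" "m \<le> N"
    and L: "\<And>j. j < m \<Longrightarrow> L j \<le> N" and X: "X = 4 * N" "X \<le> 2 ^ B"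
    and le: "s ''pos'' 0 + s ''neg'' 0 + W * X ^ (m * m + m * (2 * N)) \<le> 2 ^ B" "(2 * N + 1)\<^sup>2 \<le> R"
  shows "run \<rho> B R term_prog s (\<lambda>s'. same_on {''lambda'', ''len'', ''N'', ''w'', ''k''} s s' \<and>
    delta s s' (real W * fact (2 * N) ^ m * shape_det m (\<lambda>i. int (L i))) (W * X ^ (m * m + m * (2 * N))))"
proof -
  let ?A = "{''lambda'', ''len'', ''N'', ''w'', ''k'', ''pos'', ''neg''}"
  let ?E = "m * m + m * (2 * N)"
  let ?z1 = "real W * (\<Prod>j<m. \<Prod>i<j. pair_diff L i j)"
  let ?z2 = "?z1 * (\<Prod>j<m. fact (2 * N) / fact (L j + m - (j + 1)))"
  have X0: "0 < X" using X assms(6) by simp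
  have WE: "W * X ^ ?E \<le> 2 ^ B" using le(1) by linarith
  have "W * X ^ (0 + m * m) \<le> W * X ^ ?E"
    using X0 by (intro mult_le_mono2 power_increasing) auto
  with WE have WE1: "W * X ^ (0 + m * m) \<le> 2 ^ B" by linarith
  have "W * X ^ 0 \<le> W * X ^ ?E"
    using X0 by (intro mult_le_mono2 power_increasing) auto
  from order.trans[OF this WE] have W: "W \<le> 2 ^ B"
    by (simp only: power_0 mult_1_right)
  have m: "m \<le> 2 ^ B" using assms(7) X by linarith
  have R: "(m + 1)\<^sup>2 \<le> R" "(m + 1) * (2 * N + 1) \<le> R" "0 < R"
  proof -
    show "(m + 1)\<^sup>2 \<le> R"
      using assms(7) by (intro order.trans[OF _ le(2)] power_mono) auto
    have "(m + 1) * (2 * N + 1) \<le> (2 * N + 1) * (2 * N + 1)"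
      using assms(7) by (intro mult_le_mono1) simp
    with le(2) show "(m + 1) * (2 * N + 1) \<le> R"
      by (simp only: power2_eq_square)
    show "0 < R" by (rule less_le_trans[OF _ le(2)]) simp
  qed
  let ?s = "store_upd (store_upd (store_upd s ''p'' 0 W) ''q'' 0 0) ''j'' 0 0"
  have 1: "run \<rho> B R pair_loops ?s (\<lambda>t. same_on ?A s t \<and> pq t ?z1 (W * X ^ (0 + m * m)))"
  proof (rule run_pair_loops)
    show "pq ?s (real W) (W * X ^ 0)" by (simp add: pq_def store_upd_apply)
    \<comment> \<open>Four summands, each at most \<open>N\<close>: the origin of
      \<open>X = 4 * N\<close>.\<close>
    show "L i + j + (L j + i) \<le> X" if "i < m" "j < m" for i j
      using L[OF that(1)] L[OF that(2)] that assms(7) X by linarith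
  qed (use assms R m WE1 X0 in \<open>auto simp: same_on_upd store_upd_apply\<close>)
  have 2: "run \<rho> B R fact_loops (store_upd t ''j'' 0 0) (\<lambda>u. same_on ?A s u \<and> pq u ?z2 (W * X ^ (m * m + m * (2 * N))))"
    if t: "same_on ?A s t \<and> pq t ?z1 (W * X ^ (0 + m * m))" for t
  proof (rule run_fact_loops)
    show "L j + m \<le> 2 * N" if "j < m" for j
      using L[OF that] assms(7) by linarith
  qed (use assms R m WE X0 t in \<open>auto simp: same_on_upd store_upd_apply pq_upd\<close>)
  have z2: "?z2 = real W * fact (2 * N) ^ m * shape_det m (\<lambda>i. int (L i))"
    unfolding shape_det_nat by (simp add: prod_dividef mult_ac)
  have 3: "run \<rho> B R (Seq (SetVar ''pos'' (Add (Var ''pos'') (Var ''p''))) (SetVar ''neg'' (Add (Var ''neg'') (Var ''q'')))) u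
      (\<lambda>s'. same_on {''lambda'', ''len'', ''N'', ''w'', ''k''} s s' \<and> delta s s' ?z2 (W * X ^ ?E))"
    if u: "same_on ?A s u \<and> pq u ?z2 (W * X ^ (m * m + m * (2 * N)))" for u
  proof -
    have rd: "u ''pos'' = s ''pos''" "u ''neg'' = s ''neg''" using u by (auto dest: same_onD)
    have pq: "u ''p'' 0 + u ''q'' 0 \<le> W * X ^ ?E" "real (u ''p'' 0) - real (u ''q'' 0) = ?z2"
      using u by (auto simp: pq_def)
    have "same_on {''lambda'', ''len'', ''N'', ''w'', ''k''} s u" using u by (auto simp: same_on_def)
    then show ?thesis
      using assms(1) R(3) le(1) pq
      by (intro run_Seq_Assign run_Assign)
         (auto simp: rd store_upd_apply same_on_upd delta_def simp del: distrib_left_numeral)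
  qed
  have 4: "run \<rho> B R (Seq (SetVar ''j'' (Num 0)) (Seq fact_loops
    (Seq (SetVar ''pos'' (Add (Var ''pos'') (Var ''p''))) (SetVar ''neg'' (Add (Var ''neg'') (Var ''q'')))))) t
      (\<lambda>s'. same_on {''lambda'', ''len'', ''N'', ''w'', ''k''} s s' \<and> delta s s' ?z2 (W * X ^ ?E))"
    if "same_on ?A s t \<and> pq t ?z1 (W * X ^ (0 + m * m))" for t
    using run_SeqI[OF 2[OF that] 3] assms(1) R(3) by (intro run_Seq_Assign) simp_all
  show ?thesis
    unfolding term_prog_def z2[symmetric]
    using run_SeqI[OF 1 4] assms(1,5) R(3) W by (intro run_Seq_Assign) (simp_all add: store_upd_apply)
qed

text \<open>One loop per application of \<open>raise m\<close>, unrolled because \<open>k\<close> is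
  a constant of the program. Cell \<open>k\<close> of the array \<open>k\<close> is the loop index
  of this level, cell \<open>k\<close> of \<open>w\<close> the coefficient handed inwards. The
  coefficient uses the row length before it is raised; the raised row is restored after the inner
  call, so no shapes need to be stored.\<close>

fun nest :: "nat \<Rightarrow> com" where
  "nest 0 = term_prog"
| "nest (Suc k) = Seq (Assign ''k'' (Num k) (Num 0))
    (While (Sub (Var ''len'') (Get ''k'' (Num k)))
      (Seq (Assign ''w'' (Num k) (Mul (Get ''w'' (Num (Suc k))) (Get ''lambda'' (Get ''k'' (Num k)))))
      (Seq (Assign ''lambda'' (Get ''k'' (Num k)) (Add (Get ''lambda'' (Get ''k'' (Num k))) (Num 1)))
      (Seq (nest k)
      (Seq (Assign ''lambda'' (Get ''k'' (Num k)) (Sub (Get ''lambda'' (Get ''k'' (Num k))) (Num 1)))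
           (Assign ''k'' (Num k) (Add (Get ''k'' (Num k)) (Num 1))))))))"

lemma shape_sum_Suc_nat:
  "shape_sum m (Suc k) (\<lambda>i. int (L i)) =
    (\<Sum>j<m. real (L j) * shape_sum m k (\<lambda>i. int ((L(j := L j + 1)) i)))"
proof -
  have "(\<lambda>i. int (L i))(j := int (L j) + 1) = (\<lambda>i. int ((L(j := L j + 1)) i))" for j
    by auto
  then show ?thesis
    by (simp add: shape_sum_def raise_def[of m "(raise m ^^ k) (shape_det m)"])
qed

text \<open>Each level has \<open>m\<close> branches and multiplies the coefficient by at most
  \<open>N\<close>, hence \<open>(m * N) ^ k\<close>; its loop multiplies the time budget by
  \<open>m + 1\<close>, on top of the square needed by \<open>term_prog\<close>. The margin
  \<open>k\<close> in the bound on the rows pays for the raises still to come. Array cells below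
  \<open>k\<close> are scratch space of the inner levels.\<close>

lemma run_nest:
  assumes "0 < B" "0 < N" "m \<le> N" and X: "X = 4 * N" "X \<le> 2 ^ B" and E: "E = m * m + m * (2 * N)"
    and "s ''len'' 0 = m" "s ''N'' 0 = N" "\<And>j. j < m \<Longrightarrow> s ''lambda'' j + k \<le> N"
    and "s ''pos'' 0 + s ''neg'' 0 + s ''w'' k * (m * N) ^ k * X ^ E \<le> 2 ^ B" "(2 * N + 1) ^ (k + 2) \<le> R"
  shows "run \<rho> B R (nest k) s (\<lambda>s'. s' ''lambda'' = s ''lambda'' \<and> s' ''len'' 0 = m \<and> s' ''N'' 0 = N \<and>
    (\<forall>i\<ge>k. s' ''w'' i = s ''w'' i \<and> s' ''k'' i = s ''k'' i) \<and>
    delta s s' (real (s ''w'' k) * fact (2 * N) ^ m * shape_sum m k (\<lambda>i. int (s ''lambda'' i)))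
      (s ''w'' k * (m * N) ^ k * X ^ E))"
  using assms(7-)
proof (induction k arbitrary: s R)
  case 0
  have "run \<rho> B R term_prog s (\<lambda>s'. same_on {''lambda'', ''len'', ''N'', ''w'', ''k''} s s' \<and>
    delta s s' (real (s ''w'' 0) * fact (2 * N) ^ m * shape_det m (\<lambda>i. int (s ''lambda'' i)))
      (s ''w'' 0 * X ^ (m * m + m * (2 * N))))"
    using 0 assms by (intro run_term_prog) (auto simp: numeral_2_eq_2)
  then show ?case
    using 0 by (auto simp: E shape_sum_def elim!: run_conseq dest: same_onD)
next
  case (Suc k)
  define L W D where "L = s ''lambda''" and "W = s ''w'' (Suc k)" and "D = (fact (2 * N) ^ m :: real)"
  \<comment> \<open>\<open>W * c\<close> bounds what a single branch adds to the
    accumulators.\<close>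
  define c where "c = N * (m * N) ^ k * X ^ E"
  define F where "F j = shape_sum m k (\<lambda>i. int ((L(j := L j + 1)) i))" for j
  define R' where "R' = (2 * N + 1) ^ (k + 2)"
  have "0 < R'" by (simp add: R'_def)
  have mWc: "m * (W * c) = W * (m * N) ^ Suc k * X ^ E"
    by (simp add: c_def algebra_simps)
  have X0: "0 < X" using X assms(2) by simp
  have RR: "(m + 1) * R' \<le> R"
  proof -
    have "(m + 1) * R' \<le> (2 * N + 1) * R'"
      using assms(3) by (intro mult_le_mono1) simp
    also have "\<dots> = (2 * N + 1) ^ (Suc k + 2)" by (simp add: R'_def)
    finally show ?thesis using Suc.prems(5) by simp
  qed
  have "0 < R" using RR \<open>0 < R'\<close> by (metis add_is_0 bot_nat_0.not_eq_extremum le_zero_eq mult_is_0 one_neq_zero)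
  define I where "I i t \<longleftrightarrow> t ''lambda'' = L \<and> t ''len'' 0 = m \<and> t ''N'' 0 = N \<and> t ''k'' k = i \<and>
    (\<forall>i\<ge>Suc k. t ''w'' i = s ''w'' i \<and> t ''k'' i = s ''k'' i) \<and>
    delta s t (real W * D * (\<Sum>j<i. real (L j) * F j)) (i * (W * c))" for i t
  let ?body = "Seq (Assign ''w'' (Num k) (Mul (Get ''w'' (Num (Suc k))) (Get ''lambda'' (Get ''k'' (Num k)))))
      (Seq (Assign ''lambda'' (Get ''k'' (Num k)) (Add (Get ''lambda'' (Get ''k'' (Num k))) (Num 1)))
      (Seq (nest k)
      (Seq (Assign ''lambda'' (Get ''k'' (Num k)) (Sub (Get ''lambda'' (Get ''k'' (Num k))) (Num 1)))
           (Assign ''k'' (Num k) (Add (Get ''k'' (Num k)) (Num 1))))))"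
  have body: "run \<rho> B R' ?body t (I (Suc i))" if i: "i < m" and t: "I i t" for i t
  proof -
    let ?t = "store_upd (store_upd t ''w'' k (W * L i)) ''lambda'' i (L i + 1)"
    have rd: "t ''lambda'' = L" "t ''len'' 0 = m" "t ''N'' 0 = N" "t ''k'' k = i" "t ''w'' (Suc k) = W"
      using t by (auto simp: I_def W_def)
    have lam: "?t ''lambda'' = L(i := L i + 1)"
      by (simp add: store_upd_def rd)
    have wk: "?t ''w'' k = W * L i" by (simp add: store_upd_def)
    have Li: "L i + Suc k \<le> N" using Suc.prems(3)[OF i] by (simp add: L_def)
    have b1: "W * L i * (m * N) ^ k * X ^ E \<le> W * c"
      using Li by (simp add: c_def mult.assoc)
    have "Suc i * (W * c) \<le> m * (W * c)" using i by (intro mult_le_mono1) simp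
    then have b2: "s ''pos'' 0 + s ''neg'' 0 + (i * (W * c) + W * c) \<le> 2 ^ B"
      using Suc.prems(4) unfolding mWc W_def[symmetric] by simp
    have pn: "t ''pos'' 0 + t ''neg'' 0 \<le> s ''pos'' 0 + s ''neg'' 0 + i * (W * c)"
      using t by (intro delta_bound) (auto simp: I_def)
    have b3: "t ''pos'' 0 + t ''neg'' 0 + W * L i * (m * N) ^ k * X ^ E \<le> 2 ^ B"
      using b1 b2 pn by linarith
    have "W * L i * 1 \<le> W * L i * ((m * N) ^ k * X ^ E)"
      using i assms(2) X0 by (intro mult_le_mono2) (simp add: Suc_le_eq)
    moreover have "W * L i * ((m * N) ^ k * X ^ E) \<le> 2 ^ B"
      using b3 unfolding mult.assoc by linarith
    ultimately have b4: "W * L i \<le> 2 ^ B" by linarith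
    have b5: "L i + 1 \<le> 2 ^ B" "Suc i \<le> 2 ^ B" using Li X assms(2,3) i by linarith+
    have 1: "run \<rho> B R' (nest k) ?t (\<lambda>u. u ''lambda'' = ?t ''lambda'' \<and> u ''len'' 0 = m \<and> u ''N'' 0 = N \<and>
      (\<forall>i\<ge>k. u ''w'' i = ?t ''w'' i \<and> u ''k'' i = ?t ''k'' i) \<and>
      delta ?t u (real (?t ''w'' k) * fact (2 * N) ^ m * shape_sum m k (\<lambda>i. int (?t ''lambda'' i)))
        (?t ''w'' k * (m * N) ^ k * X ^ E))"
    proof (rule Suc.IH)
      show "?t ''lambda'' j + k \<le> N" if "j < m" for j
        using Suc.prems(3)[OF that] unfolding lam by (auto simp: L_def)
      show "?t ''pos'' 0 + ?t ''neg'' 0 + ?t ''w'' k * (m * N) ^ k * X ^ E \<le> 2 ^ B"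
        using b3 unfolding wk by (simp add: store_upd_apply)
    qed (simp_all add: store_upd_apply rd R'_def)
    have 2: "run \<rho> B R' (Seq (Assign ''lambda'' (Get ''k'' (Num k)) (Sub (Get ''lambda'' (Get ''k'' (Num k))) (Num 1)))
           (Assign ''k'' (Num k) (Add (Get ''k'' (Num k)) (Num 1)))) u (I (Suc i))"
      if u: "u ''lambda'' = ?t ''lambda'' \<and> u ''len'' 0 = m \<and> u ''N'' 0 = N \<and>
      (\<forall>i\<ge>k. u ''w'' i = ?t ''w'' i \<and> u ''k'' i = ?t ''k'' i) \<and>
      delta ?t u (real (?t ''w'' k) * fact (2 * N) ^ m * shape_sum m k (\<lambda>i. int (?t ''lambda'' i)))
        (?t ''w'' k * (m * N) ^ k * X ^ E)" for u
    proof -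
      have uk: "u ''k'' k = i" "u ''lambda'' = L(i := L i + 1)" "u ''len'' 0 = m" "u ''N'' 0 = N"
        using u by (simp_all add: store_upd_def rd)
      have uw: "u ''w'' i = s ''w'' i \<and> u ''k'' i = s ''k'' i" if "i \<ge> Suc k" for i
        using u t that by (simp add: store_upd_def I_def)
      have "delta t u (real (W * L i) * D * F i) (W * L i * (m * N) ^ k * X ^ E)"
        using u unfolding wk lam by (simp add: delta_upd D_def F_def)
      then have "delta t u (real (W * L i) * D * F i) (W * c)"
        using b1 by (rule delta_mono)
      with t have "delta s u (real W * D * (\<Sum>j<i. real (L j) * F j) + real (W * L i) * D * F i) (i * (W * c) + W * c)"
        by (intro delta_trans) (auto simp: I_def)
      then have du: "delta s u (real W * D * (\<Sum>j<Suc i. real (L j) * F j)) (Suc i * (W * c))"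
        by (simp add: algebra_simps)
      let ?v = "store_upd (store_upd u ''lambda'' i (L i)) ''k'' k (Suc i)"
      have "?v ''lambda'' = L" using uk by (simp add: store_upd_def)
      moreover have "?v ''w'' i' = s ''w'' i' \<and> ?v ''k'' i' = s ''k'' i'" if "i' \<ge> Suc k" for i'
        using uw[OF that] that by (simp add: store_upd_def)
      moreover have "delta s ?v (real W * D * (\<Sum>j<Suc i. real (L j) * F j)) (Suc i * (W * c))"
      proof -
        have "delta s ?v d b \<longleftrightarrow> delta s u d b" for d b
          by (simp add: delta_upd)
        with du show ?thesis by (simp only:)
      qed
      ultimately have "I (Suc i) ?v"
        using uk unfolding I_def by (simp add: store_upd_apply)
      then show ?thesis
        using assms(1) \<open>0 < R'\<close> b5 uk
        by (intro run_Seq_Assign run_Assign) (simp_all add: store_upd_apply)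
    qed
    show ?thesis
      using run_SeqI[OF 1 2] assms(1) \<open>0 < R'\<close> b4 b5 rd
      by (intro run_Seq_Assign) (simp_all add: store_upd_apply)
  qed
  have "run \<rho> B R (While (Sub (Var ''len'') (Get ''k'' (Num k))) ?body) (store_upd s ''k'' k 0) (I m)"
  proof (rule run_While[where n = m and R' = R' and I = I])
    show "I 0 (store_upd s ''k'' k 0)"
      using Suc.prems delta_refl by (simp add: I_def delta_upd store_upd_apply L_def)
        (simp add: store_upd_def)
    show "aval \<rho> t (Sub (Var ''len'') (Get ''k'' (Num k))) \<noteq> 0 \<and> run \<rho> B R' ?body t (I (Suc i))"
      if "i < m" "I i t" for i t
      using body[OF that] that by (simp add: I_def)
  qed (use assms \<open>0 < R'\<close> RR in \<open>auto simp: I_def\<close>)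
  then have "run \<rho> B R (nest (Suc k)) s (I m)"
    using assms(1) \<open>0 < R\<close> by (auto intro!: run_Seq_Assign)
  then show ?case
  proof (rule run_conseq[OF _ order.refl])
    fix s' assume "I m s'"
    then show "s' ''lambda'' = s ''lambda'' \<and> s' ''len'' 0 = m \<and> s' ''N'' 0 = N \<and>
      (\<forall>i\<ge>Suc k. s' ''w'' i = s ''w'' i \<and> s' ''k'' i = s ''k'' i) \<and>
      delta s s' (real (s ''w'' (Suc k)) * fact (2 * N) ^ m * shape_sum m (Suc k) (\<lambda>i. int (s ''lambda'' i)))
        (s ''w'' (Suc k) * (m * N) ^ Suc k * X ^ E)"
      unfolding I_def mWc shape_sum_Suc_nat unfolding L_def W_def D_def F_def by blast
  qed
qed

definition den_loop :: com where
  "den_loop = While (Sub (Var ''len'') (Var ''j''))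
    (Seq (SetVar ''y'' (Num 0)) (Seq fact_loop (SetVar ''j'' (Add (Var ''j'') (Num 1)))))"

lemma run_den_loop:
  assumes "0 < B" "same_on A s0 s" "''len'' \<in> A" "''N'' \<in> A" "A \<inter> {''y'', ''q'', ''p'', ''j''} = {}"
    and "s0 ''len'' 0 = m" "s0 ''N'' 0 = N" "s ''j'' 0 = 0" "(m + 1) * (2 * N + 1) \<le> R"
    and "m \<le> 2 ^ B" "pq s z (W * X ^ e)"
    and X: "2 * N \<le> X" "X \<le> 2 ^ B" "W * X ^ (e + m * (2 * N)) \<le> 2 ^ B" "0 < X"
  shows "run \<rho> B R den_loop s (\<lambda>s'. same_on A s0 s' \<and>
    pq s' (z * fact (2 * N) ^ m) (W * X ^ (e + m * (2 * N))))"
  unfolding den_loop_def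
proof (rule run_While[where n = m and R' = "2 * N + 1" and I = "\<lambda>j s'. same_on A s0 s' \<and> s' ''j'' 0 = j \<and>
    pq s' (z * fact (2 * N) ^ j) (W * X ^ (e + j * (2 * N)))"])
  fix j s' assume j: "j < m" and I: "same_on A s0 s' \<and> s' ''j'' 0 = j \<and>
    pq s' (z * fact (2 * N) ^ j) (W * X ^ (e + j * (2 * N)))"
  have rd: "s' ''len'' 0 = m"
    using same_onD[of A s0 s'] assms I by simp
  have "e + j * (2 * N) + 2 * N = e + Suc j * (2 * N)" by simp
  also have "\<dots> \<le> e + m * (2 * N)"
    using j by (intro add_left_mono mult_le_mono1) simp
  finally have le2: "W * X ^ (e + j * (2 * N) + 2 * N) \<le> 2 ^ B"
    using X(4) by (intro order.trans[OF mult_le_mono2[OF power_increasing] X(3)]) auto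
  let ?z = "z * fact (2 * N) ^ j"
  have 1: "run \<rho> B (2 * N + 1) fact_loop (store_upd s' ''y'' 0 0) (\<lambda>t. same_on A s0 t \<and> t ''j'' 0 = j \<and>
    pq t (?z * (fact (2 * N) / fact 0)) (W * X ^ (e + j * (2 * N) + 2 * N)))"
    using assms I le2 by (intro run_fact_loop) (auto simp: same_on_upd pq_upd store_upd_apply)
  have 2: "run \<rho> B (2 * N + 1) (SetVar ''j'' (Add (Var ''j'') (Num 1))) t (\<lambda>s'. same_on A s0 s' \<and> s' ''j'' 0 = Suc j \<and>
    pq s' (z * fact (2 * N) ^ Suc j) (W * X ^ (e + Suc j * (2 * N))))"
    if "same_on A s0 t \<and> t ''j'' 0 = j \<and> pq t (?z * (fact (2 * N) / fact 0)) (W * X ^ (e + j * (2 * N) + 2 * N))" for t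
    using that assms j
    by (intro run_Assign) (auto simp: same_on_upd pq_upd store_upd_apply mult.assoc add_ac mult.commute[of "fact (2 * N)"])
  show "aval \<rho> s' (Sub (Var ''len'') (Var ''j'')) \<noteq> 0 \<and>
      run \<rho> B (2 * N + 1) (Seq (SetVar ''y'' (Num 0)) (Seq fact_loop (SetVar ''j'' (Add (Var ''j'') (Num 1))))) s'
     (\<lambda>s'. same_on A s0 s' \<and> s' ''j'' 0 = Suc j \<and>
    pq s' (z * fact (2 * N) ^ Suc j) (W * X ^ (e + Suc j * (2 * N))))"
    using run_SeqI[OF 1 2] rd I j assms(1)
    by (auto intro!: run_Seq_Assign simp del: mult_Suc power_Suc)
next
  fix s' assume "same_on A s0 s' \<and> s' ''j'' 0 = m \<and>
    pq s' (z * fact (2 * N) ^ m) (W * X ^ (e + m * (2 * N)))"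
  then show "aval \<rho> s' (Sub (Var ''len'') (Var ''j'')) = 0 \<and> same_on A s0 s' \<and>
    pq s' (z * fact (2 * N) ^ m) (W * X ^ (e + m * (2 * N)))"
    using same_onD[of A s0 s' "''len''"] assms by simp
qed (use assms in auto)

text \<open>\<open>fact_loop\<close> can only multiply by \<open>(2 * N)! / y!\<close>. The factor
  \<open>N!\<close> of the formula is therefore produced as a quotient: \<open>(2 * N)!\<close>
  here, with \<open>y\<close> starting at 0, and \<open>(2 * N)! / N!\<close> in
  \<open>den_prog\<close>, with \<open>y\<close> starting at \<open>N\<close>.\<close>

definition num_prog :: com where
  "num_prog = Seq (SetVar ''p'' (Var ''pos'')) (Seq (SetVar ''q'' (Var ''neg'')) (Seq (SetVar ''y'' (Num 0))
    (Seq fact_loop (SetVar ''num'' (Sub (Var ''p'') (Var ''q''))))))"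

lemma run_num_prog:
  assumes "0 < B" "s ''N'' 0 = N" "2 * N + 1 \<le> R" "real (s ''pos'' 0) - real (s ''neg'' 0) = z" "0 \<le> z"
    and "s ''pos'' 0 + s ''neg'' 0 \<le> b" "2 * N \<le> X" "X \<le> 2 ^ B" "b * X ^ (2 * N) \<le> 2 ^ B" "0 < X"
  shows "run \<rho> B R num_prog s (\<lambda>s'. same_on {''len'', ''N''} s s' \<and> real (s' ''num'' 0) = z * fact (2 * N))"
proof -
  let ?s = "store_upd (store_upd (store_upd s ''p'' 0 (s ''pos'' 0)) ''q'' 0 (s ''neg'' 0)) ''y'' 0 0"
  have R: "0 < R" using assms(3) by linarith
  have "b * 1 \<le> b * X ^ (2 * N)" using assms(10) by (intro mult_le_mono2) (simp add: Suc_le_eq)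
  then have b: "b \<le> 2 ^ B" using assms(9) by linarith
  have 1: "run \<rho> B R fact_loop ?s (\<lambda>t. same_on {''len'', ''N''} s t \<and> t ''j'' 0 = s ''j'' 0 \<and>
      pq t (z * (fact (2 * N) / fact 0)) (b * X ^ (0 + 2 * N)))"
    using assms by (intro run_fact_loop) (auto simp: same_on_upd store_upd_apply pq_def)
  have 2: "run \<rho> B R (SetVar ''num'' (Sub (Var ''p'') (Var ''q''))) t
      (\<lambda>s'. same_on {''len'', ''N''} s s' \<and> real (s' ''num'' 0) = z * fact (2 * N))"
    if t: "same_on {''len'', ''N''} s t \<and> t ''j'' 0 = s ''j'' 0 \<and>
      pq t (z * (fact (2 * N) / fact 0)) (b * X ^ (0 + 2 * N))" for t
  proof -
    have t': "real (t ''p'' 0) - real (t ''q'' 0) = z * fact (2 * N)" "t ''p'' 0 + t ''q'' 0 \<le> 2 ^ B"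
      using t assms(9) by (auto simp: pq_def)
    moreover have "0 \<le> z * fact (2 * N)" using assms(5) by simp
    \<comment> \<open>The signed value is nonnegative, so the truncated subtraction is
      exact.\<close>
    ultimately have "t ''q'' 0 \<le> t ''p'' 0" by linarith
    then show ?thesis
      using t t' assms(1) R by (intro run_Assign) (auto simp: same_on_upd store_upd_apply of_nat_diff)
  qed
  show ?thesis
    unfolding num_prog_def using run_SeqI[OF 1 2] assms(1,6) R b
    by (intro run_Seq_Assign) (simp_all add: store_upd_apply)
qed

definition den_prog :: "nat \<Rightarrow> com" where
  "den_prog c = Seq (SetVar ''p'' (Num (fact c))) (Seq (SetVar ''q'' (Num 0)) (Seq (SetVar ''j'' (Num 0))
    (Seq (SetVar ''y'' (Var ''N'')) (Seq fact_loop
    (Seq den_loop (SetVar ''den'' (Sub (Var ''p'') (Var ''q''))))))))"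

lemma run_den_prog:
  assumes "0 < B" "s ''N'' 0 = N" "s ''len'' 0 = m" "m \<le> N" "(2 * N + 1)\<^sup>2 \<le> R"
    and "2 * N \<le> X" "X \<le> 2 ^ B" "fact c * X ^ (2 * N + m * (2 * N)) \<le> 2 ^ B" "0 < X"
  shows "run \<rho> B R (den_prog c) s (\<lambda>s'. same_on {''num''} s s' \<and>
    real (s' ''den'' 0) = fact c * (fact (2 * N) / fact N) * fact (2 * N) ^ m)"
proof -
  let ?s = "store_upd (store_upd (store_upd (store_upd s ''p'' 0 (fact c)) ''q'' 0 0) ''j'' 0 0) ''y'' 0 N"
  let ?A = "{''len'', ''N'', ''num''}"
  have R: "(m + 1) * (2 * N + 1) \<le> R" "2 * N + 1 \<le> R" "0 < R"
  proof -
    have "(m + 1) * (2 * N + 1) \<le> (2 * N + 1) * (2 * N + 1)"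
      using assms(4) by (intro mult_le_mono1) simp
    with assms(5) show "(m + 1) * (2 * N + 1) \<le> R"
      by (simp only: power2_eq_square)
    then show "2 * N + 1 \<le> R" "0 < R" by (auto intro: order.trans[rotated])
  qed
  have le: "fact c * X ^ k \<le> 2 ^ B" if "k \<le> 2 * N + m * (2 * N)" for k
    using that assms(9) by (intro order.trans[OF mult_le_mono2[OF power_increasing] assms(8)]) auto
  have m: "m \<le> 2 ^ B" "N \<le> 2 ^ B" using assms(4,6,7) by linarith+
  have 1: "run \<rho> B R fact_loop ?s (\<lambda>t. same_on ?A s t \<and> t ''j'' 0 = 0 \<and>
      pq t (fact c * (fact (2 * N) / fact N)) (fact c * X ^ (0 + 2 * N)))"
  proof (rule run_fact_loop)
    show "fact c * X ^ (0 + 2 * N) \<le> 2 ^ B" by (rule le) simp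
  qed (use assms R in \<open>auto simp: same_on_upd store_upd_apply pq_def\<close>)
  have 2: "run \<rho> B R den_loop t (\<lambda>t. same_on ?A s t \<and>
      pq t (fact c * (fact (2 * N) / fact N) * fact (2 * N) ^ m) (fact c * X ^ (2 * N + m * (2 * N))))"
    if "same_on ?A s t \<and> t ''j'' 0 = 0 \<and>
      pq t (fact c * (fact (2 * N) / fact N)) (fact c * X ^ (0 + 2 * N))" for t
    using that assms R m by (intro run_den_loop) auto
  have 3: "run \<rho> B R (SetVar ''den'' (Sub (Var ''p'') (Var ''q''))) t (\<lambda>s'. same_on {''num''} s s' \<and>
    real (s' ''den'' 0) = fact c * (fact (2 * N) / fact N) * fact (2 * N) ^ m)"
    if t: "same_on ?A s t \<and>
      pq t (fact c * (fact (2 * N) / fact N) * fact (2 * N) ^ m) (fact c * X ^ (2 * N + m * (2 * N)))" for t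
  proof -
    let ?z = "fact c * (fact (2 * N) / fact N) * fact (2 * N) ^ m :: real"
    have t': "real (t ''p'' 0) - real (t ''q'' 0) = ?z" "t ''p'' 0 + t ''q'' 0 \<le> 2 ^ B"
      using t assms(8) by (auto simp: pq_def)
    moreover have "0 \<le> ?z" by simp
    ultimately have "t ''q'' 0 \<le> t ''p'' 0" by linarith
    moreover have "same_on {''num''} s t" using t by (auto simp: same_on_def)
    ultimately show ?thesis
      using t' assms(1) R by (intro run_Assign) (auto simp: same_on_upd store_upd_apply of_nat_diff)
  qed
  have "fact c \<le> (2::nat) ^ B" using le[of 0] by simp
  then show ?thesis
    unfolding den_prog_def using run_SeqI[OF 1 run_SeqI[OF 2 3]] assms(1,2) R(3) m(2)
    by (intro run_Seq_Assign) (simp_all add: store_upd_apply)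
qed

definition excess_prog :: "nat \<Rightarrow> com" where
  "excess_prog c = Seq (Assign ''w'' (Num c) (Num 1)) (Seq (nest c) (Seq num_prog (den_prog c)))"

section \<open>Correctness and cost of the program for bounded excess\<close>

lemma length_le_sum_list:
  assumes "is_partition lam"
  shows "length lam \<le> sum_list lam"
proof -
  have "\<forall>k\<in>set lam. 0 < k" using assms by (simp add: is_partition_def)
  then show ?thesis by (induction lam) auto
qed

lemma power_le_two_power: "(x::nat) ^ n \<le> 2 ^ (x * n)"
  using power_mono[of x "2 ^ x" n] less_exp[of x] by (simp add: power_mult)

lemma run_excess_prog:
  assumes lam: "is_partition lam" "0 < N" "sum_list lam + c = N"
    and B: "B = (8 * c + 20 + fact c) * (N + 1) ^ 3"
  shows "run \<rho> B ((2 * N + 1) ^ (c + 2)) (excess_prog c) (input_store lam N)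
    (\<lambda>s. result s = real (num_SVT lam N))"
proof -
  define s where "s = input_store lam N"
  define m where "m = length lam"
  define X where "X = 4 * N"
  define E where "E = m * m + m * (2 * N)"
  define R where "R = (2 * N + 1) ^ (c + 2)"
  define z where "z = fact (2 * N) ^ m * shape_sum m c (row_lengths lam)"
  have srt: "sorted_wrt (\<ge>) lam" using lam(1) by (simp add: is_partition_def)
  have m: "m \<le> N" using length_le_sum_list[OF lam(1)] lam(3) by (simp add: m_def)
  have R: "(2 * N + 1) ^ 2 \<le> R" "2 * N + 1 \<le> R" "0 < R"
  proof -
    show "(2 * N + 1) ^ 2 \<le> R"
      unfolding R_def by (intro power_increasing) auto
    show "2 * N + 1 \<le> R"
      unfolding R_def by (rule self_le_power) auto
    then show "0 < R" by linarith
  qed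
  have X: "X = 4 * N" "0 < X" "2 * N \<le> X" "N \<le> X" using lam(2) by (auto simp: X_def)
  have "0 < B" by (simp add: B)
  \<comment> \<open>In powers of \<open>X\<close>: \<open>2 * c\<close> for
    \<open>(m * N) ^ c\<close>, \<open>E\<close> for one term, and \<open>2 * N\<close> for the last
    multiplication in \<open>num_prog\<close>.\<close>
  have exponents: "2 * c + E + 2 * N \<le> (2 * c + 5) * (N + 1)\<^sup>2"
  proof -
    have "E \<le> N * N + N * (2 * N)"
      unfolding E_def using m by (intro add_mono mult_le_mono) auto
    moreover have "(2 * c + 5) * (N + 1)\<^sup>2 = 2 * c + 5 + (2 * c) * (N * N + 2 * N) + 5 * (N * N) + 10 * N"
      by (simp add: power2_eq_square algebra_simps)
    ultimately show ?thesis by simp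
  qed
  have Xpow: "fact c * X ^ k \<le> 2 ^ B" if "k \<le> 2 * c + E + 2 * N" for k
  proof -
    \<comment> \<open>Origin of the constants in \<open>B\<close>: \<open>X ^ k\<close> is at most
      \<open>2 ^ (X * k)\<close>, and \<open>X * k\<close> is at most cubic in \<open>N + 1\<close>.
      The additional \<open>fact c\<close> in \<open>B\<close> pays for the numeral in
      \<open>den_prog\<close>.\<close>
    have "X * k \<le> (4 * (N + 1)) * ((2 * c + 5) * (N + 1)\<^sup>2)"
      using that exponents by (intro mult_le_mono) (auto simp: X_def)
    also have "\<dots> = (8 * c + 20) * (N + 1) ^ 3"
      by (simp add: power2_eq_square power3_eq_cube algebra_simps)
    finally have "X * k \<le> (8 * c + 20) * (N + 1) ^ 3" .
    moreover have "fact c * 1 \<le> fact c * (N + 1) ^ 3" by (intro mult_le_mono2) simp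
    ultimately have exp: "fact c + X * k \<le> B" unfolding B distrib_right[of "8 * c + 20"] by linarith
    have "fact c * X ^ k \<le> 2 ^ fact c * 2 ^ (X * k)"
      by (rule mult_le_mono[OF less_imp_le[OF less_exp] power_le_two_power])
    also have "\<dots> = 2 ^ (fact c + X * k)" by (simp add: power_add)
    also have "\<dots> \<le> 2 ^ B" using exp by (intro power_increasing) auto
    finally show ?thesis .
  qed
  have f1: "1 \<le> (fact c :: nat)" by (simp add: Suc_le_eq)
  have Xpow1: "X ^ k \<le> 2 ^ B" if "k \<le> 2 * c + E + 2 * N" for k
    using Xpow[OF that] f1 by (metis le_trans mult.commute mult_le_mono2 mult_1_right)
  have mN: "(m * N) ^ c \<le> X ^ (2 * c)"
  proof -
    have "m * N \<le> X ^ 2" unfolding power2_eq_square using m X by (intro mult_le_mono) auto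
    then show ?thesis unfolding power_mult by (rule power_mono) simp
  qed
  have mNX: "(m * N) ^ c * X ^ k \<le> 2 ^ B" if "k \<le> E + 2 * N" for k
  proof -
    have "(m * N) ^ c * X ^ k \<le> X ^ (2 * c) * X ^ k" using mN by (intro mult_le_mono1)
    also have "\<dots> = X ^ (2 * c + k)" by (simp add: power_add)
    also have "\<dots> \<le> 2 ^ B" using that by (intro Xpow1) simp
    finally show ?thesis .
  qed
  have XB: "X \<le> 2 ^ B" using Xpow1[of 1] lam(2) by simp
  let ?s = "store_upd s ''w'' c 1"
  have s: "s ''len'' 0 = m" "s ''N'' 0 = N" "s ''pos'' 0 = 0" "s ''neg'' 0 = 0"
    "\<And>j. s ''lambda'' j = (if j < m then lam ! j else 0)"
    by (simp_all add: s_def m_def input_store_def)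
  have lamc: "lam ! j + c \<le> N" if "j < m" for j
    using elem_le_sum_list[of j lam] that lam(3) by (simp add: m_def)
  have rows: "(\<lambda>i. int (s ''lambda'' i)) = row_lengths lam"
    by (auto simp: s row_lengths_def m_def fun_eq_iff)
  have formula: "real (num_SVT lam N) = fact N / fact c * shape_sum m c (row_lengths lam)"
    using num_SVT_formula[OF srt lam(3)] by (simp add: m_def)
  \<comment> \<open>The sign of the sum is not visible from its terms; it is read off from the fact
    that the sum counts tableaux.\<close>
  have "0 \<le> fact c / fact N * real (num_SVT lam N)" by simp
  also have "\<dots> = shape_sum m c (row_lengths lam)" by (simp add: formula)
  finally have z0: "0 \<le> z" by (simp add: z_def)
  have 1: "run \<rho> B R (nest c) ?s (\<lambda>t. t ''lambda'' = ?s ''lambda'' \<and> t ''len'' 0 = m \<and> t ''N'' 0 = N \<and>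
    (\<forall>i\<ge>c. t ''w'' i = ?s ''w'' i \<and> t ''k'' i = ?s ''k'' i) \<and>
    delta ?s t (real (?s ''w'' c) * fact (2 * N) ^ m * shape_sum m c (\<lambda>i. int (?s ''lambda'' i)))
      (?s ''w'' c * (m * N) ^ c * X ^ E))"
  proof (rule run_nest)
    show "?s ''lambda'' j + c \<le> N" if "j < m" for j
      using lamc[OF that] that by (simp add: s store_upd_apply)
    show "?s ''pos'' 0 + ?s ''neg'' 0 + ?s ''w'' c * (m * N) ^ c * X ^ E \<le> 2 ^ B"
      using mNX[of E] by (simp add: s store_upd_apply)
  qed (use \<open>0 < B\<close> lam(2) m X(1) XB in \<open>simp_all add: E_def R_def s store_upd_apply\<close>)
  have 2: "run \<rho> B R num_prog t (\<lambda>u. same_on {''len'', ''N''} t u \<and> real (u ''num'' 0) = z * fact (2 * N))"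
    if t: "t ''lambda'' = ?s ''lambda'' \<and> t ''len'' 0 = m \<and> t ''N'' 0 = N \<and>
    (\<forall>i\<ge>c. t ''w'' i = ?s ''w'' i \<and> t ''k'' i = ?s ''k'' i) \<and>
    delta ?s t (real (?s ''w'' c) * fact (2 * N) ^ m * shape_sum m c (\<lambda>i. int (?s ''lambda'' i)))
      (?s ''w'' c * (m * N) ^ c * X ^ E)" for t
  proof (rule run_num_prog[where X = X and b = "(m * N) ^ c * X ^ E"])
    have "delta ?s t z ((m * N) ^ c * X ^ E)"
      using t by (simp add: store_upd_apply rows z_def)
    then show "real (t ''pos'' 0) - real (t ''neg'' 0) = z" "t ''pos'' 0 + t ''neg'' 0 \<le> (m * N) ^ c * X ^ E"
      by (auto simp: delta_def store_upd_apply s)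
    show "(m * N) ^ c * X ^ E * X ^ (2 * N) \<le> 2 ^ B"
      using mNX[of "E + 2 * N"] by (simp add: power_add mult.assoc)
    show "t ''N'' 0 = N" using t by blast
  qed (rule \<open>0 < B\<close> R z0 X XB)+
  have 3: "run \<rho> B R (Seq num_prog (den_prog c)) t (\<lambda>s. result s = real (num_SVT lam N))"
    if t: "t ''lambda'' = ?s ''lambda'' \<and> t ''len'' 0 = m \<and> t ''N'' 0 = N \<and>
    (\<forall>i\<ge>c. t ''w'' i = ?s ''w'' i \<and> t ''k'' i = ?s ''k'' i) \<and>
    delta ?s t (real (?s ''w'' c) * fact (2 * N) ^ m * shape_sum m c (\<lambda>i. int (?s ''lambda'' i)))
      (?s ''w'' c * (m * N) ^ c * X ^ E)" for t
  proof (rule run_SeqI[OF 2[OF t]])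
    fix u assume u: "same_on {''len'', ''N''} t u \<and> real (u ''num'' 0) = z * fact (2 * N)"
    have "run \<rho> B R (den_prog c) u (\<lambda>s'. same_on {''num''} u s' \<and>
      real (s' ''den'' 0) = fact c * (fact (2 * N) / fact N) * fact (2 * N) ^ m)"
    proof (rule run_den_prog[where X = X])
      show "fact c * X ^ (2 * N + m * (2 * N)) \<le> 2 ^ B"
        by (rule Xpow) (simp add: E_def)
      have "u ''N'' = t ''N''" "u ''len'' = t ''len''" using u by (simp_all add: same_on_def)
      with t show "u ''N'' 0 = N" "u ''len'' 0 = m" by simp_all
    qed (rule \<open>0 < B\<close> m R X XB)+
    then show "run \<rho> B R (den_prog c) u (\<lambda>s. result s = real (num_SVT lam N))"
    proof (rule run_conseq[OF _ order.refl])
      fix v assume v: "same_on {''num''} u v \<and>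
        real (v ''den'' 0) = fact c * (fact (2 * N) / fact N) * fact (2 * N) ^ m"
      then have den: "real (v ''den'' 0) = fact c * (fact (2 * N) / fact N) * fact (2 * N) ^ m"
        and num: "real (v ''num'' 0) = z * fact (2 * N)"
        using u by (simp_all add: same_on_def)
      show "result v = real (num_SVT lam N)"
        unfolding result_def formula den num z_def by (simp add: field_simps)
    qed
  qed
  show ?thesis
    unfolding excess_prog_def s_def[symmetric] R_def[symmetric]
    using run_SeqI[OF 1 3] \<open>0 < B\<close> R(3) by (intro run_Seq_Assign) simp_all
qed

lemma bounded_input_store:
  assumes "is_partition lam" "sum_list lam \<le> N" "N \<le> B"
  shows "bounded_store B (input_store lam N)"
proof -
  have "N \<le> 2 ^ B" using assms(3) less_exp[of B] by linarith
  moreover have "length lam \<le> N" using length_le_sum_list[OF assms(1)] assms(2) by linarith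
  moreover have "lam ! i \<le> N" if "i < length lam" for i
    using elem_le_sum_list[OF that] assms(2) by linarith
  ultimately show ?thesis
    unfolding bounded_store_def input_store_def by (auto intro: order.trans)
qed

theorem FPRAS_excess:
  "has_FPRAS num_SVT {(lam, N). is_partition lam \<and> 0 < N \<and> sum_list lam \<le> N \<and> N - sum_list lam = c}"
proof (rule has_FPRASI)
  fix lam N \<rho>
  assume "(lam, N) \<in> {(lam, N). is_partition lam \<and> 0 < N \<and> sum_list lam \<le> N \<and> N - sum_list lam = c}"
  then have I: "is_partition lam" "0 < N" "sum_list lam \<le> N" "sum_list lam + c = N" by auto
  let ?B = "(8 * c + 20 + fact c) * (N + 1) ^ 3"
  have "1 * (N + 1) \<le> (8 * c + 20 + fact c) * (N + 1) ^ 3"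
    by (intro mult_le_mono self_le_power) auto
  then have "N \<le> ?B" by (rule order.trans[rotated]) simp
  then have "bounded_store ?B (input_store lam N)"
    by (rule bounded_input_store[OF I(1,3)])
  with run_excess_prog[OF I(1,2,4) refl]
  show "bounded_store ?B (input_store lam N) \<and>
     run \<rho> ?B ((2 * N + 1) ^ (c + 2)) (excess_prog c) (input_store lam N) (\<lambda>s. result s = real (num_SVT lam N))"
    by blast
qed

section \<open>Bounded size\<close>

text \<open>Row \<open>n\<close> of the table occupies the cells from \<open>K * n\<close> to
  \<open>K * n + K - 1\<close> of \<open>v\<close>. The matrix row \<open>a\<close> is built into
  the program as numerals, so the scalar product is a single expression of constant size.\<close>

fun row_expr :: "nat \<Rightarrow> (nat \<Rightarrow> nat) \<Rightarrow> nat \<Rightarrow> aexp" where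
  "row_expr K a 0 = Num 0"
| "row_expr K a (Suc j) =
     Add (row_expr K a j) (Mul (Num (a j)) (Get ''v'' (Add (Mul (Num K) (Var ''n'')) (Num j))))"

lemma aval_row_expr [simp]: "aval \<rho> s (row_expr K a r) = (\<Sum>j<r. a j * s ''v'' (K * s ''n'' 0 + j))"
  by (induction r) auto

lemma digit_free_row_expr [simp]: "digit_free (row_expr K a r)"
  by (induction r) auto

fun init_table :: "(nat \<Rightarrow> nat) \<Rightarrow> nat \<Rightarrow> com" where
  "init_table v0 0 = Skip"
| "init_table v0 (Suc i) = Seq (init_table v0 i) (Assign ''v'' (Num i) (Num (v0 i)))"

fun next_row :: "nat \<Rightarrow> (nat \<Rightarrow> nat \<Rightarrow> nat) \<Rightarrow> nat \<Rightarrow> com" where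
  "next_row K M 0 = Skip"
| "next_row K M (Suc i) = Seq (next_row K M i)
     (Assign ''v'' (Add (Mul (Num K) (Add (Var ''n'') (Num 1))) (Num i)) (row_expr K (M i) K))"

lemma run_init_table:
  assumes "0 < B" "0 < R" "\<And>i. i < r \<Longrightarrow> v0 i \<le> 2 ^ B"
  shows "run \<rho> B R (init_table v0 r) s
    (\<lambda>s'. same_on (- {''v''}) s s' \<and> (\<forall>i<r. s' ''v'' i = v0 i))"
  using assms(3)
proof (induction r)
  case (Suc r)
  show ?case
    unfolding init_table.simps
  proof (rule run_SeqI[OF Suc.IH])
    fix t assume "same_on (- {''v''}) s t \<and> (\<forall>i<r. t ''v'' i = v0 i)"
    then show "run \<rho> B R (Assign ''v'' (Num r) (Num (v0 r))) t
        (\<lambda>s'. same_on (- {''v''}) s s' \<and> (\<forall>i<Suc r. s' ''v'' i = v0 i))"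
      using assms(1,2) Suc.prems by (intro run_Assign) (auto simp: same_on_upd store_upd_apply less_Suc_eq)
  qed (use Suc.prems in auto)
qed (use assms in \<open>auto intro: run_Skip\<close>)

text \<open>The new row lies entirely beyond the old one, so its entries can be written one by one
  while the old row is still being read.\<close>

lemma run_next_row:
  assumes "0 < B" "0 < R" "r \<le> K" "\<And>i. i < r \<Longrightarrow> (\<Sum>j<K. M i j * s ''v'' (K * s ''n'' 0 + j)) \<le> 2 ^ B"
  shows "run \<rho> B R (next_row K M r) s (\<lambda>s'. same_on (- {''v''}) s s' \<and>
    (\<forall>j<K. s' ''v'' (K * s ''n'' 0 + j) = s ''v'' (K * s ''n'' 0 + j)) \<and>
    (\<forall>i<r. s' ''v'' (K * (s ''n'' 0 + 1) + i) = (\<Sum>j<K. M i j * s ''v'' (K * s ''n'' 0 + j))))"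
  using assms(3,4)
proof (induction r)
  case (Suc r)
  show ?case
    unfolding next_row.simps
  proof (rule run_SeqI[OF Suc.IH])
    fix t assume t: "same_on (- {''v''}) s t \<and>
    (\<forall>j<K. t ''v'' (K * s ''n'' 0 + j) = s ''v'' (K * s ''n'' 0 + j)) \<and>
    (\<forall>i<r. t ''v'' (K * (s ''n'' 0 + 1) + i) = (\<Sum>j<K. M i j * s ''v'' (K * s ''n'' 0 + j)))"
    have n: "t ''n'' = s ''n''" using t same_onD[of "- {''v''}" s t "''n''"] by simp
    have row: "(\<Sum>j<K. M r j * t ''v'' (K * s ''n'' 0 + j)) = (\<Sum>j<K. M r j * s ''v'' (K * s ''n'' 0 + j))"
      using t by (intro sum.cong) auto
    show "run \<rho> B R (Assign ''v'' (Add (Mul (Num K) (Add (Var ''n'') (Num 1))) (Num r)) (row_expr K (M r) K)) t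
      (\<lambda>s'. same_on (- {''v''}) s s' \<and>
    (\<forall>j<K. s' ''v'' (K * s ''n'' 0 + j) = s ''v'' (K * s ''n'' 0 + j)) \<and>
    (\<forall>i<Suc r. s' ''v'' (K * (s ''n'' 0 + 1) + i) = (\<Sum>j<K. M i j * s ''v'' (K * s ''n'' 0 + j))))"
      using assms(1,2) Suc.prems(2)[of r] t
      by (intro run_Assign) (auto simp: n row same_on_upd store_upd_apply less_Suc_eq distrib_left)
  qed (use Suc.prems in auto)
qed (use assms in \<open>auto intro: run_Skip\<close>)

definition table_prog :: "nat \<Rightarrow> (nat \<Rightarrow> nat \<Rightarrow> nat) \<Rightarrow> (nat \<Rightarrow> nat) \<Rightarrow> com" where
  "table_prog K M v0 = Seq (init_table v0 K) (Seq (SetVar ''n'' (Num 0))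
    (While (Sub (Var ''N'') (Var ''n'')) (Seq (next_row K M K) (SetVar ''n'' (Add (Var ''n'') (Num 1))))))"

lemma run_table_prog:
  assumes "0 < B" "s ''N'' 0 = N" "N \<le> 2 ^ B" "N + 1 \<le> R"
    and F: "\<And>i. i < K \<Longrightarrow> F i 0 = v0 i" "\<And>i n. i < K \<Longrightarrow> F i (Suc n) = (\<Sum>j<K. M i j * F j n)"
    and bound: "\<And>i n. i < K \<Longrightarrow> n \<le> N \<Longrightarrow> F i n \<le> 2 ^ B"
  shows "run \<rho> B R (table_prog K M v0) s (\<lambda>s'. same_on {''lambda'', ''len'', ''N''} s s' \<and>
    (\<forall>i<K. s' ''v'' (K * N + i) = F i N))"
proof -
  let ?A = "{''lambda'', ''len'', ''N''}"
  have "0 < R" using assms(4) by linarith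
  have 1: "run \<rho> B R (init_table v0 K) s
    (\<lambda>s'. same_on (- {''v''}) s s' \<and> (\<forall>i<K. s' ''v'' i = v0 i))"
    using assms(1) \<open>0 < R\<close> F(1) bound[of _ 0] by (intro run_init_table) auto
  have 2: "run \<rho> B R (While (Sub (Var ''N'') (Var ''n'')) (Seq (next_row K M K) (SetVar ''n'' (Add (Var ''n'') (Num 1)))))
      (store_upd t ''n'' 0 0) (\<lambda>s'. same_on ?A s s' \<and> (\<forall>i<K. s' ''v'' (K * N + i) = F i N))"
    if t: "same_on (- {''v''}) s t \<and> (\<forall>i<K. t ''v'' i = v0 i)" for t
  proof (rule run_While[where n = N and R' = 1 and I = "\<lambda>n s'. same_on ?A s s' \<and> s' ''n'' 0 = n \<and>
      (\<forall>i<K. s' ''v'' (K * n + i) = F i n)"])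
    show "same_on ?A s (store_upd t ''n'' 0 0) \<and> store_upd t ''n'' 0 0 ''n'' 0 = 0 \<and>
      (\<forall>i<K. store_upd t ''n'' 0 0 ''v'' (K * 0 + i) = F i 0)"
      using t F(1) by (auto simp: same_on_def store_upd_def)
  next
    fix n u assume n: "n < N" and u: "same_on ?A s u \<and> u ''n'' 0 = n \<and> (\<forall>i<K. u ''v'' (K * n + i) = F i n)"
    have row: "(\<Sum>j<K. M i j * u ''v'' (K * u ''n'' 0 + j)) = F i (Suc n)" if "i < K" for i
      unfolding F(2)[OF that] using u by (intro sum.cong) auto
    have 3: "run \<rho> B 1 (next_row K M K) u (\<lambda>s'. same_on (- {''v''}) u s' \<and>
      (\<forall>j<K. s' ''v'' (K * u ''n'' 0 + j) = u ''v'' (K * u ''n'' 0 + j)) \<and>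
      (\<forall>i<K. s' ''v'' (K * (u ''n'' 0 + 1) + i) = (\<Sum>j<K. M i j * u ''v'' (K * u ''n'' 0 + j))))"
      using assms(1) bound[of _ "Suc n"] n by (intro run_next_row) (auto simp: row)
    have 4: "run \<rho> B 1 (SetVar ''n'' (Add (Var ''n'') (Num 1))) w (\<lambda>s'. same_on ?A s s' \<and> s' ''n'' 0 = Suc n \<and>
      (\<forall>i<K. s' ''v'' (K * Suc n + i) = F i (Suc n)))"
      if w: "same_on (- {''v''}) u w \<and>
      (\<forall>j<K. w ''v'' (K * u ''n'' 0 + j) = u ''v'' (K * u ''n'' 0 + j)) \<and>
      (\<forall>i<K. w ''v'' (K * (u ''n'' 0 + 1) + i) = (\<Sum>j<K. M i j * u ''v'' (K * u ''n'' 0 + j)))" for w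
    proof -
      have "same_on ?A s w" "w ''n'' 0 = n" using w u by (auto simp: same_on_def)
      moreover have "w ''v'' (K * Suc n + i) = F i (Suc n)" if "i < K" for i
        using w u row[OF that] that by simp
      moreover have "Suc n \<le> 2 ^ B" using n assms(3) by linarith
      ultimately show ?thesis
        using assms(1) by (intro run_Assign) (auto simp: same_on_upd store_upd_apply)
    qed
    have "u ''N'' 0 = N" using u assms(2) by (simp add: same_on_def)
    then show "aval \<rho> u (Sub (Var ''N'') (Var ''n'')) \<noteq> 0 \<and>
      run \<rho> B 1 (Seq (next_row K M K) (SetVar ''n'' (Add (Var ''n'') (Num 1)))) u
      (\<lambda>s'. same_on ?A s s' \<and> s' ''n'' 0 = Suc n \<and> (\<forall>i<K. s' ''v'' (K * Suc n + i) = F i (Suc n)))"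
      using run_SeqI[OF 3 4] u n by simp
  next
    fix u assume "same_on ?A s u \<and> u ''n'' 0 = N \<and> (\<forall>i<K. u ''v'' (K * N + i) = F i N)"
    then show "aval \<rho> u (Sub (Var ''N'') (Var ''n'')) = 0 \<and> same_on ?A s u \<and>
      (\<forall>i<K. u ''v'' (K * N + i) = F i N)"
      using assms(2) by (simp add: same_on_def)
  qed (use assms in auto)
  show ?thesis
    unfolding table_prog_def
  proof (rule run_SeqI[OF 1])
    fix t assume "same_on (- {''v''}) s t \<and> (\<forall>i<K. t ''v'' i = v0 i)"
    then show "run \<rho> B R (Seq (SetVar ''n'' (Num 0))
      (While (Sub (Var ''N'') (Var ''n'')) (Seq (next_row K M K) (SetVar ''n'' (Add (Var ''n'') (Num 1)))))) t
      (\<lambda>s'. same_on ?A s s' \<and> (\<forall>i<K. s' ''v'' (K * N + i) = F i N))"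
      using 2 assms(1) \<open>0 < R\<close> by (intro run_Seq_Assign) auto
  qed
qed

text \<open>With truncated subtraction the inner sum is the distance of the two values, and
  \<open>1\<close> minus it is nonzero only for distance 0.\<close>

definition eq_expr :: "aexp \<Rightarrow> aexp \<Rightarrow> aexp" where
  "eq_expr e1 e2 = Sub (Num 1) (Add (Sub e1 e2) (Sub e2 e1))"

lemma aval_eq_expr: "aval \<rho> s (eq_expr e1 e2) \<noteq> 0 \<longleftrightarrow> aval \<rho> s e1 = aval \<rho> s e2"
  by (auto simp: eq_expr_def)

text \<open>Multiplication serves as conjunction; the length test at the end rules out inputs that
  merely begin with the given list.\<close>

fun match_expr :: "nat list \<Rightarrow> nat \<Rightarrow> aexp" where
  "match_expr [] i = eq_expr (Var ''len'') (Num i)"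
| "match_expr (x # xs) i = Mul (eq_expr (Get ''lambda'' (Num i)) (Num x)) (match_expr xs (Suc i))"

lemma aval_match_expr:
  "aval \<rho> s (match_expr xs i) \<noteq> 0 \<longleftrightarrow>
    s ''len'' 0 = i + length xs \<and> (\<forall>j<length xs. s ''lambda'' (i + j) = xs ! j)"
proof (induction xs arbitrary: i)
  case (Cons x xs)
  have "aval \<rho> s (match_expr (x # xs) i) \<noteq> 0 \<longleftrightarrow>
      s ''lambda'' i = x \<and> aval \<rho> s (match_expr xs (Suc i)) \<noteq> 0"
    by (simp only: match_expr.simps aval.simps(5) mult_eq_0_iff de_Morgan_disj aval_eq_expr aval.simps(1,2))
  moreover have "(\<forall>j<length (x # xs). s ''lambda'' (i + j) = (x # xs) ! j) \<longleftrightarrow>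
      s ''lambda'' i = x \<and> (\<forall>j<length xs. s ''lambda'' (Suc i + j) = xs ! j)"
    by (simp add: All_less_Suc2)
  ultimately show ?case
    unfolding Cons.IH by auto
next
  case Nil
  show ?case
    unfolding match_expr.simps aval_eq_expr by simp
qed

lemma digit_free_match_expr: "digit_free (match_expr xs i)"
  by (induction xs i rule: match_expr.induct) (auto simp: eq_expr_def)

lemma aval_match_expr_input:
  assumes "same_on {''lambda'', ''len''} (input_store lam N) s"
  shows "aval \<rho> s (match_expr xs 0) \<noteq> 0 \<longleftrightarrow> xs = lam"
  unfolding aval_match_expr using assms
  by (auto simp: same_on_def input_store_def list_eq_iff_nth_eq)

fun lookup_prog :: "nat \<Rightarrow> nat list list \<Rightarrow> nat \<Rightarrow> com" where
  "lookup_prog K [] i = Skip"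
| "lookup_prog K (l # ls) i = Cond (match_expr l 0)
     (SetVar ''num'' (Get ''v'' (Add (Mul (Num K) (Var ''N'')) (Num i)))) (lookup_prog K ls (Suc i))"

lemma run_lookup_prog:
  assumes "0 < B" "0 < R" "same_on {''lambda'', ''len''} (input_store lam N) s" "s ''N'' 0 = N"
    and "lam \<in> set ls" "\<And>j. j < length ls \<Longrightarrow> s ''v'' (K * N + (i + j)) = f (ls ! j)" "f lam \<le> 2 ^ B"
  shows "run \<rho> B R (lookup_prog K ls i) s (\<lambda>s'. s' ''num'' 0 = f lam)"
  using assms(5,6)
proof (induction ls arbitrary: i)
  case (Cons l ls)
  show ?case
    unfolding lookup_prog.simps
  proof (rule run_Cond[OF assms(1,2) digit_free_match_expr])
    assume "aval \<rho> s (match_expr l 0) \<noteq> 0"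
    then have "l = lam" using aval_match_expr_input[OF assms(3)] by simp
    then have "s ''v'' (K * N + i) = f lam" using Cons.prems(2)[of 0] by simp
    then show "run \<rho> B R (SetVar ''num'' (Get ''v'' (Add (Mul (Num K) (Var ''N'')) (Num i)))) s (\<lambda>s'. s' ''num'' 0 = f lam)"
      using assms by (intro run_Assign) (auto simp: store_upd_apply)
  next
    assume "aval \<rho> s (match_expr l 0) = 0"
    then have "l \<noteq> lam" using aval_match_expr_input[OF assms(3)] by blast
    then show "run \<rho> B R (lookup_prog K ls (Suc i)) s (\<lambda>s'. s' ''num'' 0 = f lam)"
      using Cons.prems(1) Cons.prems(2)[of "Suc _"] by (intro Cons.IH) auto
  qed
qed simp

text \<open>A row sum of at most \<open>C\<close> lets entries grow by at most the factor
  \<open>C\<close> per step, so their bit length is linear in \<open>n\<close>.\<close>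

lemma linear_recurrence_bound:
  fixes F :: "nat \<Rightarrow> nat \<Rightarrow> nat"
  assumes "\<And>i. i < K \<Longrightarrow> F i 0 \<le> C" "\<And>i n. i < K \<Longrightarrow> F i (Suc n) = (\<Sum>j<K. M i j * F j n)"
    and "\<And>i. i < K \<Longrightarrow> (\<Sum>j<K. M i j) \<le> C" "i < K"
  shows "F i n \<le> C ^ Suc n"
  using assms(4)
proof (induction n arbitrary: i)
  case (Suc n)
  have "F i (Suc n) \<le> (\<Sum>j<K. M i j * C ^ Suc n)"
    unfolding assms(2)[OF Suc.prems] by (intro sum_mono mult_le_mono2 Suc.IH) auto
  also have "\<dots> = (\<Sum>j<K. M i j) * C ^ Suc n" by (simp only: sum_distrib_right)
  also have "\<dots> \<le> C * C ^ Suc n" by (intro mult_le_mono1 assms(3) Suc.prems)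
  finally show ?case by simp
qed (use assms(1) in simp)

text \<open>Each corner contributes one transition to the shape without it and one transition back
  to the shape itself. Closure under removing corners keeps the system finite, and distinctness
  gives each shape exactly one column.\<close>

lemma num_SVT_linear_recurrence:
  assumes "distinct st" "\<And>l. l \<in> set st \<Longrightarrow> sorted_wrt (\<ge>) l"
    and "\<And>l i. l \<in> set st \<Longrightarrow> i \<in> corners l \<Longrightarrow> l[i := l ! i - 1] \<in> set st"
    and "i < length st"
  shows "num_SVT (st ! i) (Suc n) = (\<Sum>j<length st.
    (\<Sum>r\<in>corners (st ! i). of_bool (st ! j = (st ! i)[r := st ! i ! r - 1]) + of_bool (st ! j = st ! i)) * num_SVT (st ! j) n)"
proof -
  have pick: "(\<Sum>j<length st. of_bool (st ! j = l) * num_SVT (st ! j) n) = num_SVT l n" if "l \<in> set st" for l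
  proof -
    obtain k where k: "k < length st" "st ! k = l" using \<open>l \<in> set st\<close> by (metis in_set_conv_nth)
    have "(\<Sum>j<length st. of_bool (st ! j = l) * num_SVT (st ! j) n) = (\<Sum>j<length st. if j = k then num_SVT l n else 0)"
      using k assms(1) by (intro sum.cong) (auto simp: nth_eq_iff_index_eq)
    also have "\<dots> = num_SVT l n" using k by simp
    finally show ?thesis .
  qed
  let ?l = "st ! i"
  have l: "?l \<in> set st" using assms(4) by simp
  have "num_SVT ?l (Suc n) = (\<Sum>r\<in>corners ?l. num_SVT (?l[r := ?l ! r - 1]) n + num_SVT ?l n)"
    by (rule num_SVT_Suc[OF assms(2)[OF l]])
  also have "\<dots> = (\<Sum>r\<in>corners ?l. \<Sum>j<length st.
      (of_bool (st ! j = ?l[r := ?l ! r - 1]) + of_bool (st ! j = ?l)) * num_SVT (st ! j) n)"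
  proof (rule sum.cong[OF refl])
    fix r assume "r \<in> corners ?l"
    then show "num_SVT (?l[r := ?l ! r - 1]) n + num_SVT ?l n = (\<Sum>j<length st.
      (of_bool (st ! j = ?l[r := ?l ! r - 1]) + of_bool (st ! j = ?l)) * num_SVT (st ! j) n)"
      using pick[OF assms(3)[OF l]] pick[OF l] by (simp only: distrib_right sum.distrib)
  qed
  also have "\<dots> = (\<Sum>j<length st. (\<Sum>r\<in>corners ?l.
      of_bool (st ! j = ?l[r := ?l ! r - 1]) + of_bool (st ! j = ?l)) * num_SVT (st ! j) n)"
    by (subst sum.swap) (simp only: sum_distrib_right)
  finally show ?thesis .
qed

text \<open>Length and entries are bounded by \<open>c\<close> separately, instead of their sum:
  this makes a finite set that is plainly closed under decreasing an entry, zeros included.\<close>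

lemma small_shapes:
  "\<exists>st. distinct st \<and> (\<forall>l\<in>set st. sorted_wrt (\<ge>) l) \<and>
    (\<forall>l\<in>set st. \<forall>i\<in>corners l. l[i := l ! i - 1] \<in> set st) \<and>
    (\<forall>lam. is_partition lam \<longrightarrow> sum_list lam = c \<longrightarrow> lam \<in> set st)"
proof -
  let ?S = "{l. set l \<subseteq> {..c} \<and> length l \<le> c} \<inter> {l. sorted_wrt (\<ge>) l}"
  have fin: "finite ?S" by (intro finite_Int disjI1 finite_lists_length_le) simp
  obtain st where st: "set st = ?S" "distinct st"
    using finite_distinct_list[OF fin] by (elim exE conjE)
  show ?thesis
  proof (intro exI[of _ st] conjI ballI allI impI)
    fix l i assume "l \<in> set st" and i: "i \<in> corners l"
    then have l: "set l \<subseteq> {..c}" "length l \<le> c" "sorted_wrt (\<ge>) l"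
      by (simp_all add: st(1))
    have "i < length l" using i by (simp add: corners_def)
    then have "l ! i \<in> {..c}" by (rule subsetD[OF l(1) nth_mem])
    then have "set (l[i := l ! i - 1]) \<subseteq> {..c}"
      using l(1) by (intro order.trans[OF set_update_subset_insert]) simp
    then show "l[i := l ! i - 1] \<in> set st"
      using l(2) corner_sorted[OF l(3) i] by (simp add: st(1))
  next
    fix lam assume lam: "is_partition lam" "sum_list lam = c"
    have "set lam \<subseteq> {..c}"
      using lam(2) member_le_sum_list[of _ lam] by auto
    then show "lam \<in> set st"
      using lam length_le_sum_list[OF lam(1)] by (simp add: st(1) is_partition_def)
  qed (simp_all add: st)
qed

theorem FPRAS_size:
  "has_FPRAS num_SVT {(lam, N). is_partition lam \<and> 0 < N \<and> sum_list lam \<le> N \<and> sum_list lam = c}"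
proof -
  obtain st where st: "distinct st" "\<And>l. l \<in> set st \<Longrightarrow> sorted_wrt (\<ge>) l"
    "\<And>l i. l \<in> set st \<Longrightarrow> i \<in> corners l \<Longrightarrow> l[i := l ! i - 1] \<in> set st"
    "\<And>lam. is_partition lam \<Longrightarrow> sum_list lam = c \<Longrightarrow> lam \<in> set st"
    using small_shapes[of c] by blast
  define K where "K = length st"
  define M :: "nat \<Rightarrow> nat \<Rightarrow> nat" where "M i j = (\<Sum>r\<in>corners (st ! i).
    of_bool (st ! j = (st ! i)[r := st ! i ! r - 1]) + of_bool (st ! j = st ! i))" for i j
  define v0 where "v0 i = num_SVT (st ! i) 0" for i
  \<comment> \<open>A sum over all shapes dominates every initial value and every row sum at once;
    the leading 1 makes \<open>C\<close> positive, as the monotonicity of its powers and the bound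
    \<open>B\<close> require.\<close>
  define C where "C = 1 + (\<Sum>i<K. v0 i + (\<Sum>j<K. M i j))"
  let ?P = "Seq (table_prog K M v0) (Seq (lookup_prog K st 0) (SetVar ''den'' (Num 1)))"
  have rec: "num_SVT (st ! i) (Suc n) = (\<Sum>j<K. M i j * num_SVT (st ! j) n)" if "i < K" for i n
    unfolding K_def M_def using that num_SVT_linear_recurrence[OF st(1-3), of i n] by (simp add: K_def)
  have C: "v0 i + (\<Sum>j<K. M i j) \<le> C" if "i < K" for i
    using member_le_sum[of i "{..<K}" "\<lambda>i. v0 i + (\<Sum>j<K. M i j)"] that by (simp add: C_def)
  have bound: "num_SVT (st ! i) n \<le> C ^ Suc n" if "i < K" for i n
  proof (rule linear_recurrence_bound[where M = M and F = "\<lambda>i n. num_SVT (st ! i) n", OF _ rec _ that])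
    show "num_SVT (st ! i) 0 \<le> C" "(\<Sum>j<K. M i j) \<le> C" if "i < K" for i
      using C[OF that] by (simp_all add: v0_def)
  qed
  show ?thesis
  proof (rule has_FPRASI)
    fix lam N \<rho>
    assume "(lam, N) \<in> {(lam, N). is_partition lam \<and> 0 < N \<and> sum_list lam \<le> N \<and> sum_list lam = c}"
    then have I: "is_partition lam" "0 < N" "sum_list lam \<le> N" "sum_list lam = c" by auto
    let ?B = "C * (N + 1) ^ 1" and ?s = "input_store lam N" and ?R = "(2 * N + 1) ^ 1"
    have "1 \<le> C" by (simp add: C_def)
    then have B: "0 < ?B" by simp
    have "1 * (N + 1) \<le> ?B" using \<open>1 \<le> C\<close> by (intro mult_le_mono) auto
    then have NB: "N \<le> ?B" by (rule order.trans[rotated]) simp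
    have N2: "N \<le> 2 ^ ?B" by (rule order.trans[OF NB less_imp_le[OF less_exp]])
    have bound': "num_SVT (st ! i) n \<le> 2 ^ ?B" if "i < K" "n \<le> N" for i n
    proof -
      have "C ^ Suc n \<le> C ^ (N + 1)" using \<open>1 \<le> C\<close> that by (intro power_increasing) auto
      also have "\<dots> \<le> 2 ^ ?B" unfolding power_one_right by (rule power_le_two_power)
      finally show ?thesis by (rule order.trans[OF bound[OF that(1)]])
    qed
    obtain k where k: "k < K" "st ! k = lam"
      using st(4)[OF I(1,4)] by (metis in_set_conv_nth K_def)
    have 1: "run \<rho> ?B ?R (table_prog K M v0) ?s (\<lambda>s'. same_on {''lambda'', ''len'', ''N''} ?s s' \<and>
      (\<forall>i<K. s' ''v'' (K * N + i) = num_SVT (st ! i) N))"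
    proof (rule run_table_prog)
      show "num_SVT (st ! i) 0 = v0 i" for i by (simp only: v0_def)
      show "?s ''N'' 0 = N" by (simp add: input_store_def)
      show "N + 1 \<le> ?R" by simp
    qed (fact B N2 rec bound')+
    have 2: "run \<rho> ?B ?R (lookup_prog K st 0) t (\<lambda>s'. s' ''num'' 0 = num_SVT lam N)"
      if t: "same_on {''lambda'', ''len'', ''N''} ?s t \<and> (\<forall>i<K. t ''v'' (K * N + i) = num_SVT (st ! i) N)" for t
    proof (rule run_lookup_prog[where f = "\<lambda>l. num_SVT l N"])
      show "same_on {''lambda'', ''len''} ?s t" "t ''N'' 0 = N"
        using t by (simp_all add: same_on_def input_store_def)
      show "t ''v'' (K * N + (0 + j)) = num_SVT (st ! j) N" if "j < length st" for j
        using t that by (simp add: K_def)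
      show "num_SVT lam N \<le> 2 ^ ?B"
        using bound'[of k N] k by simp
      show "lam \<in> set st"
        by (rule st(4)[OF I(1,4)])
    qed (use B in simp_all)
    have 3: "run \<rho> ?B ?R (SetVar ''den'' (Num 1)) t (\<lambda>s. result s = real (num_SVT lam N))"
      if "t ''num'' 0 = num_SVT lam N" for t
      using that B by (intro run_Assign) (auto simp: store_upd_apply result_def)
    have "run \<rho> ?B ?R ?P ?s (\<lambda>s. result s = real (num_SVT lam N))"
      by (rule run_SeqI[OF 1 run_SeqI[OF 2 3]])
    with bounded_input_store[OF I(1,3) NB]
    show "bounded_store ?B ?s \<and> run \<rho> ?B ?R ?P ?s (\<lambda>s. result s = real (num_SVT lam N))"
      by blast
  qed
qed

theorem theorem1p4:
  fixes c :: nat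
  shows "has_FPRAS num_SVT
           {(lam, N). is_partition lam \<and> 0 < N \<and> sum_list lam \<le> N \<and> sum_list lam = c}
       \<and> has_FPRAS num_SVT
           {(lam, N). is_partition lam \<and> 0 < N \<and> sum_list lam \<le> N \<and> N - sum_list lam = c}"
  using FPRAS_size FPRAS_excess by blast

end
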